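(* The EDNR problem is NP-hard even when restricted to instances in which the graph is a grid of height three and every edge resistance satisfies $r_e \in \{0,1\}$.
   Context: The electrical distribution network reconfiguration (EDNR) problem: given a connected undirected graph $G=(V,E)$ with a fixed root $r\in V$, a demand $d_v\ge 0$ for each $v\in V\setminus\{r\}$, and a resistance $r_e\ge 0$ for each $e\in E$, find a spanning tree $T=(V,F)$ of $G$ minimizing the loss $L(T)=\sum_{e\in F} r_e\big(\sum_{v\in D_T(e)} d_v\big)^2$, where $D_T(e)$ is the vertex set of the connected component of $T-e$ not containing $r$. (NP-hardness refers to the associated decision version: given in addition a bound $B$, decide whether some spanning tree has loss at most $B$.) An $n\times m$-grid is the graph with vertex set $\{(i,j): 0\le i\le n-1,\ 0\le j\le m-1\}$ and edges $\{(i,j),(i',j')\}$ with $|i-i'|+|j-j'|=1$, or any graph isomorphic to it; its height is $n$. *)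

theory Defs
  imports
    Complex_Main
    "HOL-Library.Log_Nat"
    "HOL-Computational_Algebra.Polynomial"
begin

section \<open>Polynomial time, NP and NP-hardness\<close>

text \<open>
  Multi-tape Turing machines with two-way infinite tapes. A machine is given by its number of
  tapes and its finite transition relation; the states and tape symbols (both natural numbers) are
  those occurring in it. Symbol 0 is the blank, 1 and 2 are the input bits; state 0 is the initial
  state and state 1 the accepting one. A transition \<open>(q, xs, q', as)\<close> applies in state \<open>q\<close> when the
  scanned symbols are \<open>xs\<close>; it goes to state \<open>q'\<close> and, on the \<open>i\<close>-th tape, writes \<open>fst (as ! i)\<close>
  and then moves the head in direction \<open>snd (as ! i)\<close>. The machine halts when no transition applies.
\<close>

datatype dir = Go_Left | Stay | Go_Right

fun shift :: "dir \<Rightarrow> int" where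
  "shift Go_Left = - 1"
| "shift Stay = 0"
| "shift Go_Right = 1"

type_synonym transition = "nat \<times> nat list \<times> nat \<times> (nat \<times> dir) list"

record tm =
  num_tapes :: nat
  transitions :: "transition set"

type_synonym tape = "(int \<Rightarrow> nat) \<times> int"
type_synonym config = "nat \<times> tape list"

definition valid_tm :: "tm \<Rightarrow> bool" where
  "valid_tm M \<longleftrightarrow> 0 < num_tapes M \<and> finite (transitions M) \<and>
     (\<forall>(q, xs, q', as) \<in> transitions M. length xs = num_tapes M \<and> length as = num_tapes M)"

definition deterministic :: "tm \<Rightarrow> bool" where
  "deterministic M \<longleftrightarrow>
     (\<forall>q xs q' as q'' bs. (q, xs, q', as) \<in> transitions M \<longrightarrow> (q, xs, q'', bs) \<in> transitions M \<longrightarrow>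
        q' = q'' \<and> as = bs)"

definition step :: "tm \<Rightarrow> config rel" where
  "step M = {((q, ts), (q', ts')). \<exists>as.
     (q, map (\<lambda>(t, h). t h) ts, q', as) \<in> transitions M \<and>
     ts' = map2 (\<lambda>(t, h) (s, d). (t(h := s), h + shift d)) ts as}"

definition halted :: "tm \<Rightarrow> config \<Rightarrow> bool" where
  "halted M c \<longleftrightarrow> c \<notin> Domain (step M)"

definition word_tape :: "bool list \<Rightarrow> int \<Rightarrow> nat" where
  "word_tape w i =
     (if 0 \<le> i \<and> i < int (length w) then (if w ! nat i then 2 else 1) else 0)"

definition initial :: "tm \<Rightarrow> bool list \<Rightarrow> config" where
  "initial M w = (0, (word_tape w, 0) # replicate (num_tapes M - 1) (word_tape [], 0))"

definition runs_in_time :: "tm \<Rightarrow> (nat \<Rightarrow> nat) \<Rightarrow> bool" where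
  "runs_in_time M t \<longleftrightarrow> (\<forall>w n c. (initial M w, c) \<in> step M ^^ n \<longrightarrow> n \<le> t (length w))"

definition accepts :: "tm \<Rightarrow> bool list \<Rightarrow> bool" where
  "accepts M w \<longleftrightarrow> (\<exists>c. (initial M w, c) \<in> (step M)\<^sup>* \<and> halted M c \<and> fst c = 1)"

definition NP :: "bool list set set" where
  "NP = {A. \<exists>M (p :: nat poly). valid_tm M \<and> runs_in_time M (poly p) \<and> A = {w. accepts M w}}"

text \<open>The input is on the first tape, the output on the last one.\<close>

definition polytime_computable :: "(bool list \<Rightarrow> bool list) \<Rightarrow> bool" where
  "polytime_computable f \<longleftrightarrow>
     (\<exists>M (p :: nat poly). valid_tm M \<and> deterministic M \<and> runs_in_time M (poly p) \<and>
       (\<forall>w. \<exists>c. (initial M w, c) \<in> (step M)\<^sup>* \<and> halted M c \<and>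
          fst (last (snd c)) = word_tape (f w)))"

text \<open>
  NP-hardness of the decision problem with instances \<open>P\<close> (encoded by \<open>enc\<close>) and question \<open>yes\<close>,
  under polynomial-time many-one reductions. A reduction only produces members of \<open>P\<close>, so that this
  also expresses hardness of a problem restricted to a subset \<open>P\<close> of its instances.
\<close>

definition NP_hard :: "('i \<Rightarrow> bool list) \<Rightarrow> 'i set \<Rightarrow> ('i \<Rightarrow> bool) \<Rightarrow> bool" where
  "NP_hard enc P yes \<longleftrightarrow>
     (\<forall>A \<in> NP. \<exists>f. polytime_computable f \<and>
        (\<forall>w. \<exists>I \<in> P. f w = enc I \<and> (w \<in> A \<longleftrightarrow> yes I)))"


section \<open>Graphs\<close>

text \<open>A finite simple undirected graph is given by its vertex set and its set of two-element edges.\<close>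

definition ugraph :: "'a set \<Rightarrow> 'a set set \<Rightarrow> bool" where
  "ugraph V E \<longleftrightarrow> finite V \<and> (\<forall>e \<in> E. e \<subseteq> V \<and> card e = 2)"

definition reach :: "'a set \<Rightarrow> 'a set set \<Rightarrow> 'a rel" where
  "reach V E = {(u, v). u \<in> V \<and> v \<in> V \<and> (u, v) \<in> {(x, y). {x, y} \<in> E}\<^sup>*}"

definition components :: "'a set \<Rightarrow> 'a set set \<Rightarrow> 'a set set" where
  "components V E = V // reach V E"

definition connected_graph :: "'a set \<Rightarrow> 'a set set \<Rightarrow> bool" where
  "connected_graph V E \<longleftrightarrow> V \<noteq> {} \<and> (\<forall>u \<in> V. \<forall>v \<in> V. (u, v) \<in> reach V E)"

definition is_cycle :: "'a set set \<Rightarrow> 'a list \<Rightarrow> bool" where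
  "is_cycle E vs \<longleftrightarrow> 3 \<le> length vs \<and> distinct vs \<and>
     (\<forall>i < length vs. {vs ! i, vs ! (Suc i mod length vs)} \<in> E)"

definition is_tree :: "'a set \<Rightarrow> 'a set set \<Rightarrow> bool" where
  "is_tree V F \<longleftrightarrow> ugraph V F \<and> connected_graph V F \<and> (\<nexists>vs. is_cycle F vs)"

definition spanning_tree :: "'a set \<Rightarrow> 'a set set \<Rightarrow> 'a set set \<Rightarrow> bool" where
  "spanning_tree V E F \<longleftrightarrow> F \<subseteq> E \<and> is_tree V F"

definition graph_iso :: "'a set \<Rightarrow> 'a set set \<Rightarrow> 'b set \<Rightarrow> 'b set set \<Rightarrow> bool" where
  "graph_iso V E V' E' \<longleftrightarrow>
     (\<exists>\<phi>. bij_betw \<phi> V V' \<and> (\<forall>u \<in> V. \<forall>v \<in> V. {u, v} \<in> E \<longleftrightarrow> {\<phi> u, \<phi> v} \<in> E'))"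

definition grid_verts :: "nat \<Rightarrow> nat \<Rightarrow> (nat \<times> nat) set" where
  "grid_verts n m = {..<n} \<times> {..<m}"

definition grid_edges :: "nat \<Rightarrow> nat \<Rightarrow> (nat \<times> nat) set set" where
  "grid_edges n m = {{(i, j), (i', j')} | i j i' j'.
     (i, j) \<in> grid_verts n m \<and> (i', j') \<in> grid_verts n m \<and>
     \<bar>int i - int i'\<bar> + \<bar>int j - int j'\<bar> = 1}"

definition grid_of_height :: "nat \<Rightarrow> 'a set \<Rightarrow> 'a set set \<Rightarrow> bool" where
  "grid_of_height n V E \<longleftrightarrow> (\<exists>m. graph_iso V E (grid_verts n m) (grid_edges n m))"


section \<open>The EDNR problem\<close>

text \<open>
  The vertices are numbered from 0. All numerical data are rational; \<open>demand\<close> is only relevant on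
  the non-root vertices and \<open>resistance\<close> only on the edges.
\<close>

record ednr =
  num_verts :: nat
  edges :: "nat set set"
  root :: nat
  demand :: "nat \<Rightarrow> rat"
  resistance :: "nat set \<Rightarrow> rat"
  bound :: rat

definition verts :: "ednr \<Rightarrow> nat set" where
  "verts I = {..<num_verts I}"

definition ednr_instances :: "ednr set" where
  "ednr_instances = {I. ugraph (verts I) (edges I) \<and> connected_graph (verts I) (edges I) \<and>
     root I \<in> verts I \<and> (\<forall>v \<in> verts I - {root I}. 0 \<le> demand I v) \<and>
     (\<forall>e \<in> edges I. 0 \<le> resistance I e)}"

definition downstream :: "ednr \<Rightarrow> nat set set \<Rightarrow> nat set \<Rightarrow> nat set" where
  "downstream I F e = (THE C. C \<in> components (verts I) (F - {e}) \<and> root I \<notin> C)"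

definition loss :: "ednr \<Rightarrow> nat set set \<Rightarrow> rat" where
  "loss I F = (\<Sum>e\<in>F. resistance I e * (\<Sum>v\<in>downstream I F e. demand I v)\<^sup>2)"

definition ednr_yes :: "ednr \<Rightarrow> bool" where
  "ednr_yes I \<longleftrightarrow> (\<exists>F. spanning_tree (verts I) (edges I) F \<and> loss I F \<le> bound I)"

text \<open>
  Numbers are written in binary (least significant bit first), each bit preceded by \<open>True\<close>, with
  the end marked by \<open>False\<close>; this makes all the codes below prefix-free. The edges are listed as
  the upper triangle of the adjacency matrix, each 1-entry being followed by the resistance.
\<close>

definition enc_nat :: "nat \<Rightarrow> bool list" where
  "enc_nat n = concat (map (\<lambda>i. [True, bit n i]) [0..<floorlog 2 n]) @ [False]"

definition enc_rat :: "rat \<Rightarrow> bool list" where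
  "enc_rat x = (case quotient_of x of (a, b) \<Rightarrow>
     (a < 0) # enc_nat (nat \<bar>a\<bar>) @ enc_nat (nat b))"

definition enc_ednr :: "ednr \<Rightarrow> bool list" where
  "enc_ednr I =
     enc_nat (num_verts I) @ enc_nat (root I) @ enc_rat (bound I) @
     concat (map (\<lambda>v. enc_rat (demand I v)) (filter (\<lambda>v. v \<noteq> root I) [0..<num_verts I])) @
     concat (map (\<lambda>u. concat (map (\<lambda>v.
         if {u, v} \<in> edges I then True # enc_rat (resistance I {u, v}) else [False])
       [Suc u..<num_verts I])) [0..<num_verts I])"

end

theory Submission
  imports Defs "HOL-Library.Countable"
begin

text \<open>
  An accepting computation of a nondeterministic machine is a tiling of a rectangle, one row per
  step, by a finite set of tiles with coloured edges. Such tilings are encoded in binary numbers: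
  each pair of a cell and a tile gives a number, and each edge of the rectangle a block of bits in
  which adjacent tiles contribute complementary amounts iff their colours agree. Two further numbers
  balance the total, so that a tiling exists iff the numbers can be split into two sets of sum
  \<open>2 ^ n - 1\<close> each. The numbers become the demands of the middle row of a grid of height three
  whose other two rows are free of resistance and are each joined to the corner root through one edge of
  resistance 1. If the flows through these edges are \<open>a\<close> and \<open>b\<close>, the loss is at least
  \<open>a\<^sup>2 + b\<^sup>2\<close>, which is minimal exactly when \<open>a = b\<close>.

  The code of this instance is a concatenation of nested loops over counters, and it is printed by a
  multi-tape machine that stores each counter as a head position.
\<close>

section \<open>Partition as loss minimisation on a grid of height three\<close>

text \<open>Hardness is quantified over all of \<open>NP\<close>, so the reduction starts from an
  arbitrary machine and must itself be carried out by one. This shapes the numbers. The block width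
  \<open>\<beta>\<close> depends on the tiles only, hence each number is a sequence of constant bit
  blocks whose arrangement is given by counters, and a machine can print it without arithmetic on
  numbers of exponential size; \<open>enc_nat\<close> writes low bits first, so the blocks come in
  the order of the positions. The common half is \<open>2 ^ n - 1\<close> for two reasons: digit
  sums of up to twice the largest digit produce it in one way only, so no carry can hide a mismatch,
  and the loss bound \<open>2 * (2 ^ n - 1)\<^sup>2\<close> has an explicit bit pattern. On the
  grid, the spanning tree is arbitrary, but the lower bound looks only at the edges at the root, all
  others contributing nonnegative terms.\<close>

abbreviation adjacency :: "'a set set \<Rightarrow> 'a rel" where
  "adjacency E \<equiv> {(x, y). {x, y} \<in> E}"

section \<open>Bridges of trees, and trees given by parent pointers\<close>

lemma sym_adjacency_rtrancl: "sym ((adjacency E)\<^sup>*)"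
  by (rule sym_rtrancl) (auto simp: sym_def insert_commute)

lemma equiv_reach: "equiv V (reach V E)"
  using sym_adjacency_rtrancl[of E]
  by (intro equivI) (auto simp: reach_def refl_on_def sym_def trans_def intro: rtrancl_trans)

lemma distinct_path_if_rtrancl:
  assumes "(x, y) \<in> (adjacency E)\<^sup>*"
  shows "\<exists>vs. vs \<noteq> [] \<and> hd vs = x \<and> last vs = y \<and> distinct vs \<and>
    (\<forall>i. Suc i < length vs \<longrightarrow> {vs ! i, vs ! Suc i} \<in> E)"
  using assms
proof (induction rule: rtrancl_induct)
  case base
  show ?case by (rule exI[of _ "[x]"]) simp
next
  case (step y z)
  then obtain vs where vs: "vs \<noteq> []" "hd vs = x" "last vs = y" "distinct vs"
    "\<forall>i. Suc i < length vs \<longrightarrow> {vs ! i, vs ! Suc i} \<in> E" by auto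
  show ?case
  proof (cases "z \<in> set vs")
    case True
    then obtain i where i: "i < length vs" "vs ! i = z" by (auto simp: in_set_conv_nth)
    have "last (take (Suc i) vs) = z" using i by (simp add: take_Suc_conv_app_nth)
    then show ?thesis
      using vs by (intro exI[of _ "take (Suc i) vs"]) (auto simp: hd_take)
  next
    case False
    have "{(vs @ [z]) ! i, (vs @ [z]) ! Suc i} \<in> E" if "Suc i < length (vs @ [z])" for i
    proof (cases "Suc i < length vs")
      case True
      then show ?thesis using vs(5) by (simp add: nth_append)
    next
      case False
      then have "i = length vs - 1" "length vs > 0" using that vs(1) by auto
      then show ?thesis using step.hyps(2) vs(1,3) by (simp add: nth_append last_conv_nth)
    qed
    then show ?thesis using vs False by (intro exI[of _ "vs @ [z]"]) auto
  qed
qed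

text \<open>A path from \<open>x\<close> to \<open>r\<close> avoiding the edge would be closed by it
  to a cycle. Short paths must be excluded: one vertex would mean \<open>r = x\<close>, and two
  vertices would need the deleted edge itself.\<close>

lemma no_cycle_imp_bridge:
  assumes "\<nexists>vs. is_cycle F vs" "{r, x} \<in> F" "r \<noteq> x"
  shows "(x, r) \<notin> (adjacency (F - {{r, x}}))\<^sup>*"
proof
  assume "(x, r) \<in> (adjacency (F - {{r, x}}))\<^sup>*"
  from distinct_path_if_rtrancl[OF this] obtain vs where vs: "vs \<noteq> []" "hd vs = x" "last vs = r" "distinct vs"
    "\<forall>i. Suc i < length vs \<longrightarrow> {vs ! i, vs ! Suc i} \<in> F - {{r, x}}" by blast
  have 1: "length vs \<noteq> 1" using vs assms(3) by (auto simp: length_Suc_conv)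
  have 2: "length vs \<noteq> 2"
  proof
    assume "length vs = 2"
    then obtain a b where "vs = [a, b]" by (auto simp: numeral_2_eq_2 length_Suc_conv)
    then show False using vs(2,3) vs(5)[rule_format, of 0] by (simp add: insert_commute)
  qed
  have "length vs \<noteq> 0" using vs by simp
  with 1 2 have 3: "3 \<le> length vs" by linarith
  have "{vs ! i, vs ! (Suc i mod length vs)} \<in> F" if "i < length vs" for i
  proof (cases "Suc i < length vs")
    case True
    then show ?thesis using vs(5) by simp
  next
    case False
    then have "Suc i = length vs" using that by simp
    then have "i = length vs - 1" "Suc i mod length vs = 0" by simp_all
    then show ?thesis using vs(1-3) assms(2) by (simp add: last_conv_nth hd_conv_nth)
  qed
  then have "is_cycle F vs" using 3 vs(4) by (simp add: is_cycle_def)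
  then show False using assms(1) by blast
qed

text \<open>After its last passage through the deleted edge, a walk continues from one of the two
  ends of that edge.\<close>

lemma rtrancl_without_edge:
  assumes "(r, v) \<in> (adjacency F)\<^sup>*"
  shows "(r, v) \<in> (adjacency (F - {{r, x}}))\<^sup>* \<or> (x, v) \<in> (adjacency (F - {{r, x}}))\<^sup>*"
  using assms
proof (induction rule: rtrancl_induct)
  case base
  show ?case by simp
next
  case (step y z)
  show ?case
  proof (cases "{y, z} = {r, x}")
    case True
    then have "z = r \<or> z = x" by (auto simp: doubleton_eq_iff)
    then show ?thesis by auto
  next
    case False
    then have "(y, z) \<in> adjacency (F - {{r, x}})" using step.hyps(2) by simp
    then show ?thesis using step.IH by (meson rtrancl.rtrancl_into_rtrancl)
  qed
qed

text \<open>This resolves the definite description in \<open>downstream\<close>: existence comes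
  from the bridge property, uniqueness because every vertex stays connected to \<open>x\<close> or
  to the root. Edges at the root suffice, since the others are treated through resistance 0 or
  nonnegativity.\<close>

lemma downstream_root_edge:
  assumes "is_tree (verts I) F" "{root I, x} \<in> F" "root I \<in> verts I"
  shows "downstream I F {root I, x} = {v \<in> verts I. (x, v) \<in> (adjacency (F - {{root I, x}}))\<^sup>*}"
    and "root I \<notin> downstream I F {root I, x}"
proof -
  let ?V = "verts I" and ?r = "root I" and ?F = "F - {{root I, x}}"
  let ?C = "{v \<in> ?V. (x, v) \<in> (adjacency ?F)\<^sup>*}"
  have x: "x \<in> ?V" "?r \<noteq> x"
    using assms by (auto simp: is_tree_def ugraph_def)
  have "(x, ?r) \<notin> (adjacency ?F)\<^sup>*"
    by (rule no_cycle_imp_bridge) (use assms x in \<open>auto simp: is_tree_def\<close>)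
  then have r: "?r \<notin> ?C" by simp
  have C: "?C = reach ?V ?F `` {x}" using x by (auto simp: reach_def)
  have "downstream I F {?r, x} = ?C"
    unfolding downstream_def
  proof (rule the_equality)
    show "?C \<in> components ?V ?F \<and> ?r \<notin> ?C"
      using r x unfolding components_def C by (auto intro: quotientI)
    fix A assume A: "A \<in> components ?V ?F \<and> ?r \<notin> A"
    then obtain v where v: "v \<in> ?V" "A = reach ?V ?F `` {v}"
      unfolding components_def by (auto elim: quotientE)
    have "(?r, v) \<in> (adjacency F)\<^sup>*"
      using assms v by (auto simp: is_tree_def connected_graph_def reach_def)
    from rtrancl_without_edge[OF this, of x]
    have "(x, v) \<in> (adjacency ?F)\<^sup>*"
    proof
      assume "(?r, v) \<in> (adjacency ?F)\<^sup>*"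
      then have "(v, ?r) \<in> (adjacency ?F)\<^sup>*" using sym_adjacency_rtrancl by (rule_tac symD)
      then show ?thesis using A v assms(3) by (auto simp: reach_def)
    qed
    then have "(x, v) \<in> reach ?V ?F" using x v by (simp add: reach_def)
    then show "A = ?C" unfolding C v(2) using equiv_class_eq[OF equiv_reach] by metis
  qed
  then show "downstream I F {?r, x} = ?C" "?r \<notin> downstream I F {?r, x}" using r by auto
qed

text \<open>A vertex of maximal rank on a cycle has two distinct neighbours there, and both would
  have to be its parent.\<close>

lemma is_tree_parents:
  fixes rank :: "'a \<Rightarrow> nat"
  assumes "finite V" "r \<in> V" "\<And>v. v \<in> V - {r} \<Longrightarrow> p v \<in> V \<and> rank (p v) < rank v"
  shows "is_tree V ((\<lambda>v. {v, p v}) ` (V - {r}))" (is "is_tree V ?F")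
proof -
  have "ugraph V ?F" unfolding ugraph_def
  proof (intro conjI ballI)
    fix e assume "e \<in> ?F"
    then obtain v where v: "v \<in> V - {r}" "e = {v, p v}" by blast
    moreover have "v \<noteq> p v" using assms(3)[OF v(1)] by auto
    ultimately show "e \<subseteq> V" "card e = 2" using assms(3)[OF v(1)] by auto
  qed (rule assms(1))
  moreover have root: "(r, v) \<in> (adjacency ?F)\<^sup>*" if "v \<in> V" for v
    using that
  proof (induction "rank v" arbitrary: v rule: less_induct)
    case less
    show ?case
    proof (cases "v = r")
      case False
      then have v: "v \<in> V - {r}" using less by simp
      have "(r, p v) \<in> (adjacency ?F)\<^sup>*" using less assms(3)[OF v] by blast
      moreover have "(p v, v) \<in> adjacency ?F" using v by (auto simp: insert_commute)
      ultimately show ?thesis by (rule rtrancl_into_rtrancl)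
    qed simp
  qed
  have "connected_graph V ?F"
    unfolding connected_graph_def
  proof (intro conjI ballI)
    fix u v assume "u \<in> V" "v \<in> V"
    then show "(u, v) \<in> reach V ?F"
      using root symD[OF sym_adjacency_rtrancl root] unfolding reach_def by (auto intro: rtrancl_trans)
  qed (use assms(2) in blast)
  moreover have "\<not> is_cycle ?F vs" for vs
  proof
    assume cyc: "is_cycle ?F vs"
    let ?n = "length vs"
    have n: "3 \<le> ?n" and dist: "distinct vs" using cyc by (auto simp: is_cycle_def)
    have "finite (rank ` set vs)" "rank ` set vs \<noteq> {}" using n by auto
    from Max_in[OF this] obtain v where v: "v \<in> set vs" "rank v = Max (rank ` set vs)" by auto
    then have max: "rank u \<le> rank v" if "u \<in> set vs" for u using that by simp
    obtain i where i: "i < ?n" "vs ! i = v" using v(1) by (auto simp: in_set_conv_nth)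
    have parent: "u = p v" if uv: "{v, u} \<in> ?F" "u \<in> set vs" for u
    proof -
      obtain y where y: "y \<in> V - {r}" "{v, u} = {y, p y}" using uv(1) by blast
      show ?thesis
      proof (cases "y = v")
        case False
        then have "u = y" "v = p y" using y(2) by (auto simp: doubleton_eq_iff)
        then show ?thesis using assms(3)[OF y(1)] max[OF uv(2)] by simp
      qed (use y in \<open>auto simp: doubleton_eq_iff\<close>)
    qed
    define j where "j = (if i = 0 then ?n - 1 else i - 1)"
    have j: "j < ?n" "Suc j mod ?n = i" using n i by (auto simp: j_def)
    let ?s = "Suc i mod ?n"
    have s: "?s < ?n" by (rule mod_less_divisor) (use n in linarith)
    have sj: "?s \<noteq> j" using n i by (auto simp: j_def mod_Suc)
    have edge: "{vs ! i, vs ! (Suc i mod ?n)} \<in> ?F" if "i < ?n" for i using cyc that by (simp only: is_cycle_def)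
    have "{v, vs ! ?s} \<in> ?F" using edge[OF i(1)] i(2) by simp
    then have "vs ! ?s = p v" using parent s nth_mem by blast
    moreover have "{v, vs ! j} \<in> ?F" using edge[OF j(1)] j(2) i(2) by (simp add: insert_commute)
    then have "vs ! j = p v" using parent j(1) nth_mem by blast
    ultimately have "vs ! ?s = vs ! j" by (rule trans[OF _ sym])
    then show False using nth_eq_iff_index_eq[OF dist s j(1)] sj by blast
  qed
  ultimately show ?thesis by (simp add: is_tree_def)
qed

lemma rtrancl_adjacency_closed:
  assumes "(x, v) \<in> (adjacency F)\<^sup>*" "x \<in> S" "\<And>y z. {y, z} \<in> F \<Longrightarrow> y \<in> S \<Longrightarrow> z \<in> S"
  shows "v \<in> S"
  using assms(1,2) by (induction rule: rtrancl_induct) (use assms(3) in auto)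

section \<open>The ladder graph and the trees that feed its middle row\<close>

definition next_to :: "nat \<Rightarrow> nat \<Rightarrow> bool" where
  "next_to u v \<longleftrightarrow> v = u + 1 \<and> u mod 3 \<noteq> 2 \<or> v = u + 3"

text \<open>The vertex in row \<open>r < 3\<close> and column \<open>c\<close> is numbered \<open>3 * c + r\<close>. Rows 0 and 2 are two
  resistance-free feeders, and each middle vertex can be attached to either of them.\<close>

definition ladder :: "nat \<Rightarrow> (nat \<Rightarrow> nat) \<Rightarrow> nat \<Rightarrow> ednr" where
  "ladder m D h = \<lparr>num_verts = 3 * m,
     edges = {{u, v} | u v. u < 3 * m \<and> v < 3 * m \<and> next_to u v},
     root = 0,
     demand = (\<lambda>v. if v mod 3 = 1 then of_nat (D (v div 3)) else 0),
     resistance = (\<lambda>e. if e = {0, 1} \<or> e = {0, 3} \<or> (\<exists>c. e = {3 * c + 1, 3 * c + 4}) then 1 else 0),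
     bound = 2 * (of_nat h)\<^sup>2\<rparr>"

lemma ladder_simps [simp]:
  "num_verts (ladder m D h) = 3 * m" "root (ladder m D h) = 0" "verts (ladder m D h) = {..<3 * m}"
  "bound (ladder m D h) = 2 * (of_nat h)\<^sup>2"
  by (simp_all add: ladder_def verts_def)

lemma in_edges_ladder:
  "{u, v} \<in> edges (ladder m D h) \<longleftrightarrow> u < 3 * m \<and> v < 3 * m \<and> (next_to u v \<or> next_to v u)"
  by (auto simp: ladder_def doubleton_eq_iff)

lemma edges_ladderE:
  assumes "e \<in> edges (ladder m D h)"
  obtains u v where "e = {u, v}" "u < 3 * m" "v < 3 * m" "next_to u v"
  using assms by (auto simp: ladder_def)

lemma demand_ladder: "demand (ladder m D h) v = (if v mod 3 = 1 then of_nat (D (v div 3)) else 0)"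
  by (simp add: ladder_def)

lemma resistance_ladder: "resistance (ladder m D h) e =
   (if e = {0, 1} \<or> e = {0, 3} \<or> (\<exists>c. e = {3 * c + 1, 3 * c + 4}) then 1 else 0)"
  by (simp add: ladder_def)

lemma sum_demand_ladder:
  assumes "S \<subseteq> {..<3 * m}"
  shows "sum (demand (ladder m D h)) S = of_nat (sum D {c. 3 * c + 1 \<in> S})"
proof -
  have fin: "finite S" using assms finite_subset by blast
  have "sum (demand (ladder m D h)) S = (\<Sum>v \<in> {v \<in> S. v mod 3 = 1}. of_nat (D (v div 3)))"
    using fin by (simp add: demand_ladder sum.inter_filter)
  also have "\<dots> = (\<Sum>c \<in> {c. 3 * c + 1 \<in> S}. of_nat (D c))"
  proof (rule sum.reindex_bij_witness[of _ "\<lambda>c. 3 * c + 1" "\<lambda>v. v div 3"], goal_cases)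
    case (1 v)
    then show ?case using div_mult_mod_eq[of v 3] by (simp add: mult.commute)
  next
    case (2 v)
    then have "3 * (v div 3) + 1 = v" using div_mult_mod_eq[of v 3] by (simp add: mult.commute)
    then show ?case using 2 by simp
  qed (auto simp: mod_Suc)
  finally show ?thesis by simp
qed

lemma finite_edges_ladder: "finite (edges (ladder m D h))"
proof -
  have "edges (ladder m D h) \<subseteq> Pow {..<3 * m}" by (auto elim!: edges_ladderE)
  then show ?thesis by (rule finite_subset) simp
qed

text \<open>Rows 0 and 2 point towards column 0, row 2 reaching the root by way of vertices 2 and 1.
  For \<open>c > 0\<close>, \<open>c \<in> X\<close> means that the middle vertex of column
  \<open>c\<close> hangs on row 0 and is supplied through \<open>{0, 3}\<close>.\<close>

definition parent :: "nat set \<Rightarrow> nat \<Rightarrow> nat" where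
  "parent X v = (if v = 1 then 0 else if v = 2 then 1
     else if v mod 3 = 1 then (if v div 3 \<in> X then v - 1 else v + 1) else v - 3)"

definition ladder_tree :: "nat \<Rightarrow> nat set \<Rightarrow> nat set set" where
  "ladder_tree m X = (\<lambda>v. {v, parent X v}) ` ({..<3 * m} - {0})"

lemma mod_div_3 [simp]:
  "Suc (3 * c) mod 3 = 1" "Suc (Suc (3 * c)) mod 3 = 2" "(3 * c + 3) mod 3 = 0"
  "Suc (3 * c) div 3 = c" "Suc (Suc (3 * c)) div 3 = c" "(3 * c + 3) div 3 = c + 1" for c :: nat
  by presburger+

lemma vertex_cases:
  fixes v :: nat
  obtains "v = 0" | c where "v = 3 * c + 1" | c where "v = 3 * c + 2" | c where "v = 3 * c + 3"
proof -
  have "v = 0 \<or> (\<exists>c. v = 3 * c + 1) \<or> (\<exists>c. v = 3 * c + 2) \<or> (\<exists>c. v = 3 * c + 3)" by presburger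
  then show ?thesis using that by blast
qed

lemma parent_simps [simp]:
  "parent X (Suc (3 * c)) = (if c = 0 then 0 else if c \<in> X then 3 * c else 3 * c + 2)"
  "parent X (Suc (Suc (3 * c))) = (if c = 0 then 1 else 3 * (c - 1) + 2)"
  "parent X (3 * c + 3) = 3 * c"
  by (auto simp: parent_def)

lemma parent_first [simp]: "parent X (Suc 0) = 0" "parent X (Suc (Suc 0)) = Suc 0"
  by (simp_all add: parent_def)

lemma next_to_simps:
  "next_to (3 * c) (Suc (3 * c))" "next_to (Suc (3 * c)) (3 * c + 2)"
  "next_to (3 * c) (3 * c + 3)" "0 < c \<Longrightarrow> next_to (Suc (Suc (3 * (c - Suc 0)))) (Suc (Suc (3 * c)))"
  unfolding next_to_def by (presburger, presburger, presburger, auto)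

lemma parent_cases:
  assumes "v < 3 * m" "v \<noteq> 0"
  shows "parent X v < 3 * m" "next_to v (parent X v) \<or> next_to (parent X v) v"
proof -
  have "parent X v < 3 * m \<and> (next_to v (parent X v) \<or> next_to (parent X v) v)"
  proof (cases v rule: vertex_cases)
    case (2 c)
    have "3 * c + 2 < 3 * m" using assms 2 by presburger
    then show ?thesis using assms 2 next_to_simps(1,2)[of c] next_to_simps(1)[of 0] by auto
  next
    case (3 c)
    then show ?thesis using assms next_to_simps(2)[of 0] next_to_simps(4)[of c] by auto
  next
    case (4 c)
    then show ?thesis using assms next_to_simps(3)[of c] by auto
  qed (use assms in auto)
  then show "parent X v < 3 * m" "next_to v (parent X v) \<or> next_to (parent X v) v" by auto
qed

lemma spanning_tree_ladder:
  assumes "0 < m"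
  shows "spanning_tree (verts (ladder m D h)) (edges (ladder m D h)) (ladder_tree m X)"
proof -
  \<comment> \<open>A middle vertex may have the parent \<open>v + 1\<close>, hence the summand 2.
    Vertex 1 keeps its number because it is itself the parent of 2.\<close>
  define rank where "rank v = (if v mod 3 = 1 \<and> v \<noteq> 1 then v + 2 else v)" for v :: nat
  have "is_tree {..<3 * m} (ladder_tree m X)"
    unfolding ladder_tree_def
  proof (rule is_tree_parents[where rank = rank])
    fix v assume "v \<in> {..<3 * m} - {0}"
    moreover from this have "rank (parent X v) < rank v"
      by (cases v rule: vertex_cases) (auto simp: rank_def)
    ultimately show "parent X v \<in> {..<3 * m} \<and> rank (parent X v) < rank v" using parent_cases by simp
  qed (use assms in auto)
  moreover have "ladder_tree m X \<subseteq> edges (ladder m D h)"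
  proof
    fix e assume "e \<in> ladder_tree m X"
    then obtain v where "v < 3 * m" "v \<noteq> 0" "e = {v, parent X v}" by (auto simp: ladder_tree_def)
    then show "e \<in> edges (ladder m D h)" using parent_cases[of v m X] by (simp add: in_edges_ladder)
  qed
  ultimately show ?thesis by (simp add: spanning_tree_def)
qed

lemma connected_graph_mono:
  assumes "connected_graph V F" "F \<subseteq> E"
  shows "connected_graph V E"
proof -
  have "(adjacency F)\<^sup>* \<subseteq> (adjacency E)\<^sup>*" by (rule rtrancl_mono) (use assms(2) in auto)
  then show ?thesis using assms(1) by (auto simp: connected_graph_def reach_def)
qed

lemma next_to_grid:
  assumes "i < 3" "j < 3"
  shows "next_to (3 * a + i) (3 * b + j) \<or> next_to (3 * b + j) (3 * a + i) \<longleftrightarrow>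
    \<bar>int i - int j\<bar> + \<bar>int a - int b\<bar> = 1"
proof -
  have "(3 * a + i) mod 3 = i" "(3 * b + j) mod 3 = j" using assms by simp_all
  then have eq: "next_to (3 * a + i) (3 * b + j) \<longleftrightarrow> 3 * b + j = 3 * a + i + 1 \<and> i \<noteq> 2 \<or> 3 * b + j = 3 * a + i + 3"
    "next_to (3 * b + j) (3 * a + i) \<longleftrightarrow> 3 * a + i = 3 * b + j + 1 \<and> j \<noteq> 2 \<or> 3 * a + i = 3 * b + j + 3"
    unfolding next_to_def by simp_all
  have "i = 0 \<or> i = 1 \<or> i = 2" "j = 0 \<or> j = 1 \<or> j = 2" using assms by auto
  then show ?thesis unfolding eq by (elim disjE; hypsubst; presburger)
qed

lemma ladder_instance:
  assumes "0 < m"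
  shows "ladder m D h \<in> {I \<in> ednr_instances. grid_of_height 3 (verts I) (edges I) \<and>
       (\<forall>e \<in> edges I. resistance I e \<in> {0, 1})}"
proof -
  let ?I = "ladder m D h" and ?\<phi> = "\<lambda>v :: nat. (v mod 3, v div 3)"
  have "ugraph (verts ?I) (edges ?I)"
    unfolding ugraph_def by (auto elim!: edges_ladderE simp: next_to_def card_insert_if)
  moreover have "connected_graph (verts ?I) (edges ?I)"
    using spanning_tree_ladder[OF assms, of D h "{}"] connected_graph_mono
    unfolding spanning_tree_def is_tree_def by blast
  ultimately have "?I \<in> ednr_instances"
    using assms by (auto simp: ednr_instances_def demand_ladder resistance_ladder)
  moreover have "graph_iso (verts ?I) (edges ?I) (grid_verts 3 m) (grid_edges 3 m)"
    unfolding graph_iso_def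
  proof (intro exI[of _ ?\<phi>] conjI ballI)
    show "bij_betw ?\<phi> (verts ?I) (grid_verts 3 m)"
      by (rule bij_betw_byWitness[where f' = "\<lambda>(r, c). 3 * c + r"]) (auto simp: grid_verts_def)
    fix u v assume uv: "u \<in> verts ?I" "v \<in> verts ?I"
    have mem: "{p, q} \<in> grid_edges 3 m \<longleftrightarrow> p \<in> grid_verts 3 m \<and> q \<in> grid_verts 3 m \<and>
        \<bar>int (fst p) - int (fst q)\<bar> + \<bar>int (snd p) - int (snd q)\<bar> = 1" for p q
      unfolding grid_edges_def by (cases p; cases q) (auto simp: doubleton_eq_iff abs_minus_commute)
    have "next_to u v \<or> next_to v u \<longleftrightarrow>
        \<bar>int (u mod 3) - int (v mod 3)\<bar> + \<bar>int (u div 3) - int (v div 3)\<bar> = 1"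
      using next_to_grid[of "u mod 3" "v mod 3" "u div 3" "v div 3"] by simp
    then show "{u, v} \<in> edges ?I \<longleftrightarrow> {?\<phi> u, ?\<phi> v} \<in> grid_edges 3 m"
      using uv by (auto simp: in_edges_ladder mem grid_verts_def)
  qed
  ultimately show ?thesis by (auto simp: grid_of_height_def resistance_ladder)
qed

section \<open>Loss of spanning trees of the ladder\<close>

lemma in_ladder_treeE:
  assumes "e \<in> ladder_tree m X"
  obtains "e = {0, 1}" | "e = {1, 2}"
  | c where "0 < c" "c \<in> X" "e = {3 * c, 3 * c + 1}"
  | c where "0 < c" "c \<notin> X" "e = {3 * c + 1, 3 * c + 2}"
  | c where "0 < c" "e = {3 * (c - 1) + 2, 3 * c + 2}"
  | c where "e = {3 * c, 3 * c + 3}"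
proof -
  obtain v where v: "v \<noteq> 0" "e = {v, parent X v}" using assms by (auto simp: ladder_tree_def)
  show ?thesis
  proof (cases v rule: vertex_cases)
    case (2 c)
    consider "c = 0" | "0 < c" "c \<in> X" | "0 < c" "c \<notin> X" by blast
    then show ?thesis
    proof cases
      case 1
      show ?thesis by (rule that(1)) (use v 1 2 in auto)
    next
      case 2
      show ?thesis by (rule that(3)[of c]) (use v 2 \<open>v = 3 * c + 1\<close> in auto)
    next
      case 3
      show ?thesis by (rule that(4)[of c]) (use v 3 \<open>v = 3 * c + 1\<close> in auto)
    qed
  next
    case (3 c)
    show ?thesis
    proof (cases "c = 0")
      case True
      show ?thesis by (rule that(2)) (use v 3 True in auto)
    next
      case False
      show ?thesis by (rule that(5)[of c]) (use v 3 False in auto)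
    qed
  next
    case (4 c)
    show ?thesis by (rule that(6)[of c]) (use v 4 in auto)
  qed (use v in simp)
qed

text \<open>It is enough that the two flows cover all demands: with
  \<open>2 * h \<le> s 1 + s 3\<close> and the loss bound, completing the squares shows that
  \<open>(s 1 - h)\<^sup>2 + (s 3 - h)\<^sup>2\<close> is at most 0.\<close>

lemma ladder_yes_imp_partition:
  assumes "0 < m" "sum D {..<m} = 2 * h" "ednr_yes (ladder m D h)"
  shows "\<exists>X \<subseteq> {..<m}. sum D X = h"
proof -
  let ?I = "ladder m D h"
  let ?V = "{..<3 * m}"
  obtain F where F: "F \<subseteq> edges ?I" "is_tree ?V F" and loss: "loss ?I F \<le> 2 * (of_nat h)\<^sup>2"
    using assms(3) by (auto simp: ednr_yes_def spanning_tree_def)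
  have finF: "finite F" using F(1) finite_edges_ladder finite_subset by blast
  let ?dn = "downstream ?I F"
  have dn: "?dn {0, x} = {v \<in> ?V. (x, v) \<in> (adjacency (F - {{0, x}}))\<^sup>*}" "0 \<notin> ?dn {0, x}"
    if "{0, x} \<in> F" for x
    using downstream_root_edge[of ?I F x] F(2) that assms(1) by simp_all
  \<comment> \<open>\<open>A x\<close> is empty when \<open>{0, x}\<close> is not in the tree, so a
    missing edge counts as flow 0 and both terms can be kept.\<close>
  define A where "A x = {c. {0, x} \<in> F \<and> 3 * c + 1 \<in> ?dn {0, x}}" for x
  have dn_sub: "?dn {0, x} \<subseteq> ?V" if "{0, x} \<in> F" for x unfolding dn(1)[OF that] by blast
  have A_sub: "A x \<subseteq> {..<m}" for x
  proof
    fix c assume "c \<in> A x"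
    then have "{0, x} \<in> F" "3 * c + 1 \<in> ?dn {0, x}" by (simp_all add: A_def)
    then have "3 * c + 1 \<in> ?V" using dn_sub by blast
    then show "c \<in> {..<m}" by simp
  qed
  define s where "s x = sum D (A x)" for x
  have flow: "sum (demand ?I) (?dn {0, x}) = of_nat (s x)" if "{0, x} \<in> F" for x
    using that by (simp add: sum_demand_ladder[OF dn_sub[OF that]] s_def A_def)
  have root_nbr: "z = 1 \<or> z = 3" if "{0, z} \<in> F" for z
  proof -
    have "{0, z} \<in> edges ?I" using that F(1) by blast
    then show ?thesis by (auto simp: in_edges_ladder next_to_def)
  qed
  \<comment> \<open>A walk enters a downstream set with an edge at the root, and edges avoiding the
    root cannot leave it again.\<close>
  have cover: "v = 0 \<or> (\<exists>x \<in> {1, 3}. {0, x} \<in> F \<and> v \<in> ?dn {0, x})" if "v \<in> ?V" for v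
  proof -
    have "(0, v) \<in> (adjacency F)\<^sup>*"
      using F(2) that assms(1) by (auto simp: is_tree_def connected_graph_def reach_def)
    then show ?thesis
    proof (induction rule: rtrancl_induct)
      case (step y z)
      then have yz: "{y, z} \<in> F" by simp
      then have z: "z \<in> ?V" using F(2) by (auto simp: is_tree_def ugraph_def)
      show ?case
      proof (cases "z = 0 \<or> y = 0")
        case True
        show ?thesis
        proof (cases "z = 0")
          case False
          then have "{0, z} \<in> F" using yz True by simp
          then have "z \<in> {1, 3}" "z \<in> ?dn {0, z}" using root_nbr[of z] z unfolding dn(1)[OF \<open>{0, z} \<in> F\<close>] by auto
          then show ?thesis using \<open>{0, z} \<in> F\<close> by blast
        qed simp
      next
        case False
        then obtain x where x: "x \<in> {1, 3}" "{0, x} \<in> F" "y \<in> ?dn {0, x}" using step.IH by blast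
        have "{y, z} \<noteq> {0, x}" using False by (auto simp: doubleton_eq_iff)
        then have "(y, z) \<in> adjacency (F - {{0, x}})" using yz by simp
        moreover have "(x, y) \<in> (adjacency (F - {{0, x}}))\<^sup>*" using x(3) unfolding dn(1)[OF x(2)] by simp
        ultimately have "(x, z) \<in> (adjacency (F - {{0, x}}))\<^sup>*" by (rule rtrancl_into_rtrancl[rotated])
        then have "z \<in> ?dn {0, x}" unfolding dn(1)[OF x(2)] using z by simp
        then show ?thesis using x by blast
      qed
    qed simp
  qed
  have "{..<m} \<subseteq> A 1 \<union> A 3"
  proof
    fix c assume "c \<in> {..<m}"
    then have "3 * c + 1 \<in> ?V" by simp
    from cover[OF this] show "c \<in> A 1 \<union> A 3" unfolding A_def by fastforce
  qed
  then have "sum D {..<m} \<le> sum D (A 1 \<union> A 3)"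
    using A_sub finite_subset[OF A_sub] by (intro sum_mono2) auto
  also have "\<dots> \<le> s 1 + s 3"
    using finite_subset[OF A_sub] by (simp add: s_def sum_Un_nat)
  finally have ge: "2 * h \<le> s 1 + s 3" using assms(2) by simp
  let ?g = "\<lambda>e. resistance ?I e * (sum (demand ?I) (?dn e))\<^sup>2"
  have g: "(if {0, x} \<in> F then ?g {0, x} else 0) = (of_nat (s x))\<^sup>2" if "x \<in> {1, 3}" for x
  proof (cases "{0, x} \<in> F")
    case True
    have "resistance ?I {0, x} = 1" using that by (auto simp: resistance_ladder)
    then show ?thesis using True flow[OF True] by simp
  qed (simp add: s_def A_def)
  have "(\<Sum>e \<in> {{0, 1}, {0, 3}} \<inter> F. ?g e) \<le> (\<Sum>e \<in> F. ?g e)"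
    using finF by (intro sum_mono2) (auto simp: resistance_ladder)
  also have "(\<Sum>e \<in> {{0, 1}, {0, 3}} \<inter> F. ?g e) =
      (\<Sum>e \<in> {{0, 1}, {0, 3}}. if e \<in> F then ?g e else 0)"
    by (rule sum.inter_restrict) simp
  also have "\<dots> = (of_nat (s 1))\<^sup>2 + (of_nat (s 3))\<^sup>2"
    using g[of 1] g[of 3] by (subst sum.insert) (auto simp: doubleton_eq_iff)
  finally have "(of_nat (s 1))\<^sup>2 + (of_nat (s 3))\<^sup>2 \<le> (2 * (of_nat h)\<^sup>2 :: rat)"
    using loss by (simp add: loss_def)
  then have "(of_nat ((s 1)\<^sup>2 + (s 3)\<^sup>2) :: rat) \<le> of_nat (2 * h\<^sup>2)" by simp
  then have "(s 1)\<^sup>2 + (s 3)\<^sup>2 \<le> 2 * h\<^sup>2" by (simp only: of_nat_le_iff)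
  then have "int ((s 1)\<^sup>2 + (s 3)\<^sup>2) \<le> int (2 * h\<^sup>2)" by (simp only: of_nat_le_iff)
  then have le: "(int (s 1))\<^sup>2 + (int (s 3))\<^sup>2 \<le> 2 * (int h)\<^sup>2" by simp
  have "int h * (2 * int h) \<le> int h * (int (s 1) + int (s 3))"
    using ge by (intro mult_left_mono) auto
  moreover have "(int (s 1) - int h)\<^sup>2 + (int (s 3) - int h)\<^sup>2 =
      (int (s 1))\<^sup>2 + (int (s 3))\<^sup>2 - 2 * (int h * (int (s 1) + int (s 3))) + 2 * (int h)\<^sup>2"
    by (simp add: power2_eq_square algebra_simps)
  moreover have "int h * (2 * int h) = 2 * (int h)\<^sup>2" by (simp add: power2_eq_square)
  ultimately have "(int (s 1) - int h)\<^sup>2 + (int (s 3) - int h)\<^sup>2 \<le> 0" using le by linarith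
  then have "int (s 1) - int h = 0" by (simp add: sum_power2_le_zero_iff)
  then have "sum D (A 1) = h" unfolding s_def[symmetric] by simp
  then show ?thesis using A_sub[of 1] by blast
qed

text \<open>The set \<open>S\<close> below is row 0 without the root together with the middle
  vertices fed by it; only the tree edge \<open>{0, 3}\<close> can cross its boundary. Vertex 1 is
  on the other side even for \<open>0 \<in> X\<close>, whence the condition
  \<open>D 0 = 0\<close>.\<close>

lemma partition_imp_ladder_yes:
  assumes "0 < m" "sum D {..<m} = 2 * h" "D 0 = 0" "X \<subseteq> {..<m}" "sum D X = h"
  shows "ednr_yes (ladder m D h)"
proof -
  let ?I = "ladder m D h" and ?F = "ladder_tree m X"
  let ?V = "{..<3 * m}"
  have tree: "spanning_tree ?V (edges ?I) ?F" using spanning_tree_ladder[OF assms(1)] by simp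
  then have F: "?F \<subseteq> edges ?I" "is_tree ?V ?F" by (auto simp: spanning_tree_def)
  let ?dn = "downstream ?I ?F"
  have dn: "?dn {0, x} = {v \<in> ?V. (x, v) \<in> (adjacency (?F - {{0, x}}))\<^sup>*}" if "{0, x} \<in> ?F" for x
    using downstream_root_edge[of ?I ?F x] F(2) that assms(1) by simp
  have dn_sub: "?dn {0, x} \<subseteq> ?V" if "{0, x} \<in> ?F" for x unfolding dn[OF that] by blast
  define S where "S = {v. v \<noteq> 0 \<and> (v mod 3 = 0 \<or> v mod 3 = 1 \<and> v \<noteq> 1 \<and> v div 3 \<in> X)}"
  have S_split: "e \<subseteq> S \<or> e \<inter> S = {}" if "e \<in> ?F" "e \<noteq> {0, 3}" for e
    using that(1)
  proof (cases rule: in_ladder_treeE)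
    case (6 c)
    then have "c \<noteq> 0" using that(2) by auto
    then show ?thesis using 6 by (simp add: S_def)
  qed (auto simp: S_def)
  have S_edge: "y \<in> S \<longleftrightarrow> z \<in> S" if "{y, z} \<in> ?F" "{y, z} \<noteq> {0, 3}" for y z
    using S_split[OF that] by auto
  have middle: "3 * c + 1 \<in> S \<longleftrightarrow> c \<in> X \<and> c \<noteq> 0" for c by (auto simp: S_def)
  have le3: "sum (demand ?I) (?dn {0, 3}) \<le> of_nat h" if "{0, 3} \<in> ?F"
  proof -
    have sub: "?dn {0, 3} \<subseteq> S"
    proof
      fix v assume "v \<in> ?dn {0, 3}"
      then have "(3, v) \<in> (adjacency (?F - {{0, 3}}))\<^sup>*" using dn[OF that] by simp
      then show "v \<in> S"
      proof (rule rtrancl_adjacency_closed)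
        show "3 \<in> S" by (simp add: S_def)
        fix y z assume "{y, z} \<in> ?F - {{0, 3}}" "y \<in> S"
        then show "z \<in> S" using S_edge[of y z] by simp
      qed
    qed
    have "{c. 3 * c + 1 \<in> ?dn {0, 3}} \<subseteq> X" using sub middle by blast
    then have "sum D {c. 3 * c + 1 \<in> ?dn {0, 3}} \<le> sum D X"
      using assms(4) finite_subset by (intro sum_mono2) auto
    then show ?thesis unfolding sum_demand_ladder[OF dn_sub[OF that]] of_nat_le_iff assms(5) .
  qed
  have le1: "sum (demand ?I) (?dn {0, 1}) \<le> of_nat h" if "{0, 1} \<in> ?F"
  proof -
    have sub: "?dn {0, 1} \<subseteq> - S"
    proof
      fix v assume "v \<in> ?dn {0, 1}"
      then have v: "(1, v) \<in> (adjacency (?F - {{0, 1}}))\<^sup>*" using dn[OF that] by simp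
      \<comment> \<open>The root is outside \<open>S\<close> too and must be excluded explicitly:
        its only possible edges are \<open>{0, 1}\<close>, which is deleted, and
        \<open>{0, 3}\<close>, which leads into \<open>S\<close>.\<close>
      have closed: "z \<in> - S - {0}" if yz: "{y, z} \<in> ?F - {{0, 1}}" "y \<in> - S - {0}" for y z
      proof -
        have "3 \<in> S" by (simp add: S_def)
        then have ne: "{y, z} \<noteq> {0, 3}" using yz(2) by (auto simp: doubleton_eq_iff)
        have "{y, z} \<in> edges ?I" using yz(1) F(1) by blast
        then have "z \<noteq> 0" using yz ne by (auto simp: in_edges_ladder next_to_def insert_commute)
        then show ?thesis using S_edge[OF _ ne] yz by auto
      qed
      have "1 \<in> - S - {0}" by (simp add: S_def)
      from rtrancl_adjacency_closed[OF v this closed] show "v \<in> - S" by simp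
    qed
    have "{c. 3 * c + 1 \<in> ?dn {0, 1}} \<subseteq> insert 0 ({..<m} - X)"
    proof
      fix c assume "c \<in> {c. 3 * c + 1 \<in> ?dn {0, 1}}"
      then have "3 * c + 1 \<in> ?dn {0, 1}" by simp
      moreover from this have "3 * c + 1 < 3 * m" unfolding dn[OF that] by simp
      ultimately show "c \<in> insert 0 ({..<m} - X)" using sub middle[of c] by auto
    qed
    then have "sum D {c. 3 * c + 1 \<in> ?dn {0, 1}} \<le> sum D (insert 0 ({..<m} - X))"
      by (intro sum_mono2) auto
    also have "\<dots> = sum D ({..<m} - X)" using assms(3) by (cases "0 \<in> {..<m} - X") (auto simp: insert_absorb)
    also have "\<dots> = h" using assms(2,4,5) finite_subset[OF assms(4)] by (simp add: sum_diff_nat)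
    finally show ?thesis unfolding sum_demand_ladder[OF dn_sub[OF that]] of_nat_le_iff .
  qed
  let ?g = "\<lambda>e. resistance ?I e * (sum (demand ?I) (?dn e))\<^sup>2"
  \<comment> \<open>Apart from the two root edges, resistance 1 occurs only between two middle
    vertices, and no edge of this tree is of that kind.\<close>
  have off_middle: "\<exists>u \<in> e. u mod 3 \<noteq> 1" if "e \<in> ?F" for e
    using that by (cases rule: in_ladder_treeE) simp_all
  have zero: "?g e = 0" if "e \<in> ?F" "e \<notin> {{0, 1}, {0, 3}}" for e
  proof -
    have "(3 * c + 4) mod 3 = 1" for c :: nat by presburger
    then show ?thesis using off_middle[OF that(1)] that(2) by (auto simp: resistance_ladder)
  qed
  have nonneg: "0 \<le> sum (demand ?I) A" for A by (rule sum_nonneg) (simp add: demand_ladder)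
  have "finite ?F" by (simp add: ladder_tree_def)
  then have "loss ?I ?F = (\<Sum>e \<in> {{0, 1}, {0, 3}} \<inter> ?F. ?g e)"
    unfolding loss_def by (intro sum.mono_neutral_right) (use zero in auto)
  also have "\<dots> = (\<Sum>e \<in> {{0, 1}, {0, 3}}. if e \<in> ?F then ?g e else 0)"
    by (rule sum.inter_restrict) simp
  also have "\<dots> = (if {0, 1} \<in> ?F then ?g {0, 1} else 0) + (if {0, 3} \<in> ?F then ?g {0, 3} else 0)"
    by (subst sum.insert) (auto simp: doubleton_eq_iff)
  also have "\<dots> \<le> (of_nat h)\<^sup>2 + (of_nat h)\<^sup>2"
    using le1 le3 nonneg by (intro add_mono) (auto simp: resistance_ladder intro!: power_mono)
  finally show ?thesis using tree unfolding ednr_yes_def by auto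
qed

section \<open>Tilings as partitions\<close>

text \<open>Digits up to \<open>2 * (b - 1)\<close> do not determine expansions in general. Here the
  lowest digit is congruent to \<open>b - 1\<close> modulo \<open>b\<close>, and the next such
  value, \<open>2 * b - 1\<close>, is already too large; so no carry occurs and the argument
  repeats.\<close>

lemma digits_unique:
  fixes s :: "nat \<Rightarrow> nat"
  assumes "0 < b" "\<And>k. k < n \<Longrightarrow> s k \<le> 2 * (b - 1)" "(\<Sum>k<n. s k * b ^ k) = b ^ n - 1"
  shows "k < n \<Longrightarrow> s k = b - 1"
  using assms
proof (induction n arbitrary: s k)
  case (Suc n)
  let ?r = "\<Sum>k<n. s (Suc k) * b ^ k"
  have split: "(\<Sum>k<Suc n. s k * b ^ k) = s 0 + b * ?r"
    by (subst sum.lessThan_Suc_shift) (simp add: sum_distrib_left ac_simps)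
  have pow: "1 \<le> b ^ n" using Suc.prems(2) by simp
  have eq: "s 0 + b * ?r = b * (b ^ n - 1) + (b - 1)"
    using Suc.prems(2,4) pow unfolding split by (simp add: diff_mult_distrib2)
  have "s 0 mod b = (s 0 + b * ?r) mod b" by simp
  also have "\<dots> = (b - 1) mod b" unfolding eq by (rule mod_mult_self4)
  also have "\<dots> = b - 1" using Suc.prems(2) by simp
  finally have m: "s 0 mod b = b - 1" .
  have s0: "s 0 = b - 1"
  proof (cases "s 0 < b")
    case False
    then have "(s 0 - b) mod b = b - 1" using m by (simp add: le_mod_geq)
    then have "b - 1 \<le> s 0 - b" by (metis mod_less_eq_dividend)
    then show ?thesis using Suc.prems(2) Suc.prems(3)[of 0] False by simp
  qed (use m in simp)
  then have "b * ?r = b * (b ^ n - 1)" using eq by linarith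
  then have "?r = b ^ n - 1" using Suc.prems(2) by simp
  then have "s (Suc j) = b - 1" if "j < n" for j
    using Suc.IH[of j "\<lambda>k. s (Suc k)"] Suc.prems(2,3) that by simp
  then show ?case using s0 Suc.prems(1) by (cases k) auto
qed simp

lemma sum_less_mult: "(\<Sum>i<n * k. f i) = (\<Sum>u<n. \<Sum>t<k. f (u * k + t))" for f :: "nat \<Rightarrow> nat"
proof -
  have "sum f {u * k..<u * k + k} = (\<Sum>t<k. f (u * k + t))" for u
    by (subst sum.atLeastLessThan_shift_0) (simp add: comp_def lessThan_atLeast0)
  then show ?thesis by (simp add: sum.nat_group[symmetric])
qed

lemma sum_lessThan_add: "(\<Sum>i<a + b. f i) = (\<Sum>i<a. f i) + (\<Sum>i<b. f (i + a))" for f :: "nat \<Rightarrow> nat"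
  by (induction b) (simp_all add: ac_simps)

text \<open>A tile lists its left, right, lower and upper colours. The rows of length
  \<open>W\<close> are strung together into one strip of \<open>N\<close> cells:
  \<open>u + W\<close> lies above \<open>u\<close>, and matching to the right continues across row
  ends. This leaves a single left and a single right boundary colour.\<close>

definition tiling :: "(nat \<times> nat \<times> nat \<times> nat) list \<Rightarrow> nat \<Rightarrow> nat \<Rightarrow> nat \<Rightarrow> nat \<Rightarrow> nat \<Rightarrow> (nat \<Rightarrow> nat) \<Rightarrow>
    (nat \<Rightarrow> nat \<times> nat \<times> nat \<times> nat) \<Rightarrow> bool" where
  "tiling tiles l0 r0 fin N W inp s \<longleftrightarrow>
     (\<forall>u<N. s u \<in> set tiles) \<and>
     fst (s 0) = l0 \<and> (\<forall>u. Suc u < N \<longrightarrow> fst (snd (s u)) = fst (s (Suc u))) \<and> fst (snd (s (N - 1))) = r0 \<and>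
     (\<forall>u<W. fst (snd (snd (s u))) = inp u) \<and>
     (\<forall>u. u + W < N \<longrightarrow> snd (snd (snd (s u))) = fst (snd (snd (s (u + W))))) \<and>
     (\<forall>u<N. N \<le> u + W \<longrightarrow> snd (snd (snd (s u))) = fin)"

text \<open>The tile \<open>(0, C, 0, C)\<close> contributes \<open>C\<close> on all four sides, so
  the sum over all tiles reaches \<open>C\<close> at every border and \<open>target\<close> never
  exceeds \<open>total\<close>. In the tilings used later 0 is not a colour, so it cannot be placed.
  The choice of \<open>\<beta>\<close> keeps the sum of all items below half of the base in each
  digit.\<close>

locale tile_numbers =
  fixes tiles :: "(nat \<times> nat \<times> nat \<times> nat) list" and C l0 r0 fin \<beta> :: nat
  assumes color_le: "(a, b, c, d) \<in> set tiles \<Longrightarrow> a \<le> C \<and> b \<le> C \<and> c \<le> C \<and> d \<le> C"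
    and boundary_le: "l0 \<le> C" "r0 \<le> C" "fin \<le> C"
    and dummy: "(0, C, 0, C) \<in> set tiles"
    and \<beta>: "2 * length tiles * C + length tiles + C + 2 \<le> 2 ^ (\<beta> - 1)" "0 < \<beta>"
begin

abbreviation "K \<equiv> length tiles"
abbreviation "tL t \<equiv> fst (tiles ! t)"
abbreviation "tR t \<equiv> fst (snd (tiles ! t))"
abbreviation "tD t \<equiv> fst (snd (snd (tiles ! t)))"
abbreviation "tU t \<equiv> snd (snd (snd (tiles ! t)))"
abbreviation g :: nat where "g \<equiv> 2 ^ \<beta> - 1"

definition "SL = (\<Sum>t<K. C - tL t)"
definition "SR = (\<Sum>t<K. tR t)"
definition "SD = (\<Sum>t<K. C - tD t)"
definition "SU = (\<Sum>t<K. tU t)"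

lemma tile_le: "t < K \<Longrightarrow> tL t \<le> C \<and> tR t \<le> C \<and> tD t \<le> C \<and> tU t \<le> C"
  using color_le[of "tL t" "tR t" "tD t" "tU t"] by simp

lemma sums_ge: "C \<le> SL" "C \<le> SR" "C \<le> SD" "C \<le> SU"
proof -
  obtain t where t: "t < K" "tiles ! t = (0, C, 0, C)" using dummy by (auto simp: in_set_conv_nth)
  have "f t \<le> (\<Sum>t<K. f t)" for f :: "nat \<Rightarrow> nat" using t(1) by (intro member_le_sum) auto
  from this[of "\<lambda>t. C - tL t"] this[of tR] this[of "\<lambda>t. C - tD t"] this[of tU]
  show "C \<le> SL" "C \<le> SR" "C \<le> SD" "C \<le> SU" using t(2) by (simp_all add: SL_def SR_def SD_def SU_def)
qed

lemma sums_le: "SL \<le> K * C" "SR \<le> K * C" "SD \<le> K * C" "SU \<le> K * C"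
proof -
  have "(\<Sum>t<K. f t) \<le> K * C" if "\<And>t. t < K \<Longrightarrow> f t \<le> C" for f :: "nat \<Rightarrow> nat"
    using sum_bounded_above[of "{..<K}" f C] that by simp
  then show "SL \<le> K * C" "SR \<le> K * C" "SD \<le> K * C" "SU \<le> K * C"
    using tile_le by (simp_all add: SL_def SR_def SD_def SU_def)
qed

lemma K_pos: "0 < K"
  using dummy by (cases tiles) auto

text \<open>Digit positions: \<open>N + 1\<close> vertical cell borders (crossed from left to right), then \<open>N + W\<close>
  horizontal ones, then \<open>N\<close> positions counting the tiles chosen for each cell. Choosing a tile adds
  \<open>R\<close> and \<open>U\<close> at two borders and \<open>C - L\<close> and \<open>C - D\<close> at the other two, so that a border has
  digit \<open>C\<close> iff the adjacent colours agree.\<close>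

definition item :: "nat \<Rightarrow> nat \<Rightarrow> nat \<Rightarrow> nat \<Rightarrow> nat \<Rightarrow> nat" where
  "item N W u t k = (if k = u then C - tL t else 0) + (if k = u + 1 then tR t else 0) +
     (if k = u + (N + 1) then C - tD t else 0) + (if k = u + (N + 1 + W) then tU t else 0) +
     (if k = u + (2 * N + W + 1) then 1 else 0)"

text \<open>At the boundary the contribution of the missing tile is known: the left neighbour of
  cell 0 would add \<open>l0\<close>, the right neighbour of the last cell \<open>C - r0\<close>,
  the row below the first \<open>inp\<close>, the row above the last \<open>C - fin\<close>. The
  digit is \<open>C\<close> minus that amount.\<close>

definition target :: "nat \<Rightarrow> nat \<Rightarrow> (nat \<Rightarrow> nat) \<Rightarrow> nat \<Rightarrow> nat" where
  "target N W inp k = (if k = 0 then C - l0 else if k < N then C else if k = N then r0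
     else if k < N + 1 + W then C - inp (k - (N + 1)) else if k < 2 * N + 1 then C
     else if k < 2 * N + W + 1 then fin else 1)"

definition total :: "nat \<Rightarrow> nat \<Rightarrow> nat \<Rightarrow> nat" where
  "total N W k = (if k = 0 then SL else if k < N then SL + SR else if k = N then SR
     else if k < N + 1 + W then SD else if k < 2 * N + 1 then SD + SU
     else if k < 2 * N + W + 1 then SU else K)"

definition chosen :: "nat \<Rightarrow> nat \<Rightarrow> (nat \<Rightarrow> nat \<Rightarrow> nat) \<Rightarrow> nat \<Rightarrow> nat" where
  "chosen N W c k = (\<Sum>u<N. \<Sum>t<K. c u t * item N W u t k)"

lemma sum_shifted_delta:
  fixes c :: "nat \<Rightarrow> nat \<Rightarrow> nat" and k p N :: nat
  shows "(\<Sum>u<N. \<Sum>t<K. c u t * (if k = u + p then f t else 0)) =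
     (if p \<le> k \<and> k < N + p then \<Sum>t<K. c (k - p) t * f t else 0)"
proof -
  have "(\<Sum>u<N. \<Sum>t<K. c u t * (if k = u + p then f t else 0)) =
      (\<Sum>u<N. if k = u + p then \<Sum>t<K. c u t * f t else 0)"
    by (intro sum.cong refl) auto
  also have "\<dots> = (\<Sum>u<N. if u = k - p then (if p \<le> k then \<Sum>t<K. c u t * f t else 0) else 0)"
    by (intro sum.cong refl) auto
  also have "\<dots> = (if p \<le> k \<and> k < N + p then \<Sum>t<K. c (k - p) t * f t else 0)"
    by (subst sum.delta) auto
  finally show ?thesis .
qed

lemma chosen_eq:
  "chosen N W c k =
     (if k < N then \<Sum>t<K. c k t * (C - tL t) else 0) +
     (if 1 \<le> k \<and> k < N + 1 then \<Sum>t<K. c (k - 1) t * tR t else 0) +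
     (if N + 1 \<le> k \<and> k < 2 * N + 1 then \<Sum>t<K. c (k - (N + 1)) t * (C - tD t) else 0) +
     (if N + 1 + W \<le> k \<and> k < 2 * N + W + 1 then \<Sum>t<K. c (k - (N + 1 + W)) t * tU t else 0) +
     (if 2 * N + W + 1 \<le> k \<and> k < 3 * N + W + 1 then \<Sum>t<K. c (k - (2 * N + W + 1)) t else 0)"
  using sum_shifted_delta[where c = c and k = k and N = N and p = 0 and f = "\<lambda>t. C - tL t"] sum_shifted_delta[where c = c and k = k and N = N and p = 1 and f = tR]
    sum_shifted_delta[where c = c and k = k and N = N and p = "N + 1" and f = "\<lambda>t. C - tD t"] sum_shifted_delta[where c = c and k = k and N = N and p = "N + 1 + W" and f = tU]
    sum_shifted_delta[where c = c and k = k and N = N and p = "2 * N + W + 1" and f = "\<lambda>t. 1"]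
  by (simp add: chosen_def item_def distrib_left sum.distrib cong: if_cong)

lemma chosen_all:
  assumes "0 < N" "W \<le> N" "k < 3 * N + W + 1"
  shows "chosen N W (\<lambda>_ _. 1) k = total N W k"
  using assms unfolding chosen_eq by (auto simp: total_def SL_def SR_def SD_def SU_def)

text \<open>Hypothesis \<open>c\<close> makes \<open>c u\<close> the indicator of
  \<open>s u\<close>, in a form that evaluates all five sums. A border then receives a colour from
  one side and \<open>C\<close> minus a colour from the other, which gives \<open>C\<close> iff they
  agree; the bounds by \<open>C\<close> make the truncated subtraction exact.\<close>

lemma chosen_tiling:
  assumes "0 < N" "0 < W" "W \<le> N" "\<And>u. inp u \<le> C"
    and s: "\<And>u. u < N \<Longrightarrow> s u < K"
    and c: "\<And>u f. u < N \<Longrightarrow> (\<Sum>t<K. c u t * f t) = f (s u)"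
  shows "(\<forall>k < 3 * N + W + 1. chosen N W c k = target N W inp k) \<longleftrightarrow>
    tiling tiles l0 r0 fin N W inp (\<lambda>u. tiles ! s u)"
proof -
  have c1: "(\<Sum>t<K. c u t) = 1" if "u < N" for u using c[OF that, of "\<lambda>_. 1"] by simp
  have chosen: "chosen N W c k =
     (if k < N then C - tL (s k) else 0) +
     (if 1 \<le> k \<and> k < N + 1 then tR (s (k - 1)) else 0) +
     (if N + 1 \<le> k \<and> k < 2 * N + 1 then C - tD (s (k - (N + 1))) else 0) +
     (if N + 1 + W \<le> k \<and> k < 2 * N + W + 1 then tU (s (k - (N + 1 + W))) else 0) +
     (if 2 * N + W + 1 \<le> k \<and> k < 3 * N + W + 1 then 1 else 0)" for k
    unfolding chosen_eq by (intro arg_cong2[of _ _ _ _ plus] if_cong refl c c1) auto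
  have le: "tL (s u) \<le> C" "tR (s u) \<le> C" "tD (s u) \<le> C" "tU (s u) \<le> C" if "u < N" for u
    using tile_le[OF s[OF that]] by auto
  show ?thesis
  proof
    assume *: "\<forall>k < 3 * N + W + 1. chosen N W c k = target N W inp k"
    have "tL (s 0) = l0"
      using *[rule_format, of 0] le(1)[of 0] assms(1) boundary_le by (simp add: chosen target_def)
    moreover have "tR (s u) = tL (s (Suc u))" if "Suc u < N" for u
      using *[rule_format, of "Suc u"] le(1)[of "Suc u"] that by (simp add: chosen target_def)
    moreover have "tR (s (N - 1)) = r0"
      using *[rule_format, of N] assms(1) by (simp add: chosen target_def)
    moreover have "tD (s u) = inp u" if "u < W" for u
      using *[rule_format, of "u + (N + 1)"] le(3)[of u] that assms(3) assms(4)[of u] by (simp add: chosen target_def)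
    moreover have "tU (s u) = tD (s (u + W))" if "u + W < N" for u
      using *[rule_format, of "u + (N + 1 + W)"] le(3)[of "u + W"] that assms(1)
      by (simp add: chosen target_def add.commute add.left_commute)
    moreover have "tU (s u) = fin" if "u < N" "N \<le> u + W" for u
      using *[rule_format, of "u + (N + 1 + W)"] that assms(1) by (simp add: chosen target_def)
    ultimately show "tiling tiles l0 r0 fin N W inp (\<lambda>u. tiles ! s u)"
      using s by (simp add: tiling_def)
  next
    assume t: "tiling tiles l0 r0 fin N W inp (\<lambda>u. tiles ! s u)"
    show "\<forall>k < 3 * N + W + 1. chosen N W c k = target N W inp k"
    proof (intro allI impI)
      fix k assume k: "k < 3 * N + W + 1"
      consider "k = 0" | u where "k = Suc u" "Suc u < N" | "k = N"
        | u where "k = u + (N + 1)" "u < W" | u where "k = u + (N + 1 + W)" "u + W < N"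
        | u where "k = u + (N + 1 + W)" "u < N" "N \<le> u + W" | "2 * N + W + 1 \<le> k"
      proof -
        consider "k = 0" | "0 < k" "k < N" | "k = N" | "N + 1 \<le> k" "k < N + 1 + W"
          | "N + 1 + W \<le> k" "k < 2 * N + 1" | "N + 1 + W \<le> k" "2 * N + 1 \<le> k" "k < 2 * N + W + 1"
          | "2 * N + W + 1 \<le> k"
          by linarith
        then show ?thesis
        proof cases
          case 2
          then show ?thesis using that(2)[of "k - 1"] by simp
        next
          case 4
          then show ?thesis using that(4)[of "k - (N + 1)"] by simp
        next
          case 5
          then show ?thesis using that(5)[of "k - (N + 1 + W)"] by simp
        next
          case 6
          then show ?thesis using that(6)[of "k - (N + 1 + W)"] by simp
        qed (use that(1,3,7) in simp_all)
      qed
      then show "chosen N W c k = target N W inp k"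
      proof cases
        case 1
        then show ?thesis using t assms(1) by (simp add: chosen target_def tiling_def)
      next
        case (2 u)
        then have "tR (s u) = tL (s (Suc u))" using t by (simp add: tiling_def)
        then show ?thesis using 2 le(1)[of "Suc u"] by (simp add: chosen target_def)
      next
        case 3
        then show ?thesis using t assms(1) by (simp add: chosen target_def tiling_def)
      next
        case (4 u)
        then show ?thesis using t assms(3) by (simp add: chosen target_def tiling_def)
      next
        case (5 u)
        then have "tU (s u) = tD (s (u + W))" using t by (simp add: tiling_def)
        then show ?thesis using 5 le(3)[of "u + W"] by (simp add: chosen target_def add.commute add.left_commute)
      next
        case (6 u)
        then show ?thesis using t by (simp add: chosen target_def tiling_def)
      next
        case 7
        then show ?thesis using k assms(1) by (simp add: chosen target_def)
      qed
    qed
  qed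
qed

text \<open>The last \<open>N\<close> digits, with target 1, force the 0/1 values \<open>c u\<close>
  to select exactly one tile per cell.\<close>

lemma tiling_iff_chosen:
  assumes "0 < N" "0 < W" "W \<le> N" "\<And>u. inp u \<le> C"
  shows "(\<exists>s. tiling tiles l0 r0 fin N W inp s) \<longleftrightarrow>
    (\<exists>c. (\<forall>u t. c u t \<le> 1) \<and> (\<forall>k < 3 * N + W + 1. chosen N W c k = target N W inp k))"
proof
  assume "\<exists>s. tiling tiles l0 r0 fin N W inp s"
  then obtain s where s: "tiling tiles l0 r0 fin N W inp s" by blast
  then have "\<forall>u. \<exists>t. u < N \<longrightarrow> t < K \<and> tiles ! t = s u" by (auto simp: tiling_def in_set_conv_nth)
  then obtain f where f: "\<And>u. u < N \<Longrightarrow> f u < K \<and> tiles ! f u = s u" by metis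
  have til: "tiling tiles l0 r0 fin N W inp (\<lambda>u. tiles ! f u)"
    using s f assms(1-3) by (simp add: tiling_def)
  have sums: "(\<Sum>t<K. of_bool (t = f u) * h t) = h (f u)" if "u < N" for u and h :: "nat \<Rightarrow> nat"
    using f[OF that] by (simp add: of_bool_def if_distrib[of "\<lambda>x. x * _"] cong: if_cong)
  have "(\<forall>k < 3 * N + W + 1. chosen N W (\<lambda>u t. of_bool (t = f u)) k = target N W inp k) \<longleftrightarrow>
      tiling tiles l0 r0 fin N W inp (\<lambda>u. tiles ! f u)"
    by (rule chosen_tiling[OF assms]) (simp_all add: f sums)
  with til have "\<forall>k < 3 * N + W + 1. chosen N W (\<lambda>u t. of_bool (t = f u)) k = target N W inp k" by simp
  then show "\<exists>c. (\<forall>u t. c u t \<le> 1) \<and> (\<forall>k < 3 * N + W + 1. chosen N W c k = target N W inp k)"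
    by (intro exI[of _ "\<lambda>u t. of_bool (t = f u)"]) auto
next
  assume "\<exists>c. (\<forall>u t. c u t \<le> 1) \<and> (\<forall>k < 3 * N + W + 1. chosen N W c k = target N W inp k)"
  then obtain c where c: "\<And>u t. c u t \<le> 1" "\<forall>k < 3 * N + W + 1. chosen N W c k = target N W inp k" by blast
  have "\<exists>t<K. \<forall>t'<K. c u t' = of_bool (t' = t)" if "u < N" for u
  proof -
    have one: "(\<Sum>t<K. c u t) = 1"
      using c(2)[rule_format, of "u + (2 * N + W + 1)"] that assms(1) by (simp add: chosen_eq target_def)
    then obtain t where t: "t < K" "c u t \<noteq> 0" by (metis lessThan_iff sum.neutral zero_neq_one)
    have "c u t = 1" using t(2) c(1)[of u t] by simp
    have "c u t + (\<Sum>t' \<in> {..<K} - {t}. c u t') = 1" using one t(1) by (simp add: sum.remove)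
    then have "\<forall>t' \<in> {..<K} - {t}. c u t' = 0" using \<open>c u t = 1\<close> by simp
    then show ?thesis using t(1) \<open>c u t = 1\<close> by (intro exI[of _ t]) auto
  qed
  then obtain f where f: "\<And>u. u < N \<Longrightarrow> f u < K \<and> (\<forall>t'<K. c u t' = of_bool (t' = f u))" by metis
  have sums: "(\<Sum>t<K. c u t * h t) = h (f u)" if "u < N" for u and h :: "nat \<Rightarrow> nat"
  proof -
    have "(\<Sum>t<K. c u t * h t) = (\<Sum>t<K. if t = f u then h t else 0)"
      using f[OF that] by (intro sum.cong) auto
    then show ?thesis using f[OF that] by simp
  qed
  have "(\<forall>k < 3 * N + W + 1. chosen N W c k = target N W inp k) \<longleftrightarrow>
      tiling tiles l0 r0 fin N W inp (\<lambda>u. tiles ! f u)"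
    by (rule chosen_tiling[OF assms]) (simp_all add: f sums)
  then have "tiling tiles l0 r0 fin N W inp (\<lambda>u. tiles ! f u)" using c(2) by simp
  then show "\<exists>s. tiling tiles l0 r0 fin N W inp s" by blast
qed

section \<open>The numbers as demands of the columns\<close>

definition half :: "nat \<Rightarrow> nat \<Rightarrow> nat" where
  "half N W = 2 ^ (\<beta> * (3 * N + W + 1)) - 1"

definition val :: "nat \<Rightarrow> nat \<Rightarrow> (nat \<Rightarrow> nat) \<Rightarrow> nat" where
  "val N W f = (\<Sum>k < 3 * N + W + 1. f k * (2 ^ \<beta>) ^ k)"

text \<open>Column 0 is the zero column required by the ladder, the next two balance the sums, and
  \<open>N * K\<close> more enumerate pairs of a cell and a tile.\<close>

definition cols :: "nat \<Rightarrow> nat" where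
  "cols N = N * K + 3"

text \<open>Columns 1 and 2 hold the complements of the target and of its counterpart, which makes both
  sides of a solution add up to the number \<open>half N W\<close> all of whose binary digits are 1.\<close>

definition column :: "nat \<Rightarrow> nat \<Rightarrow> (nat \<Rightarrow> nat) \<Rightarrow> nat \<Rightarrow> nat" where
  "column N W inp j = (if j = 0 then 0
     else if j = 1 then val N W (\<lambda>k. g - target N W inp k)
     else if j = 2 then val N W (\<lambda>k. g + target N W inp k - total N W k)
     else val N W (item N W ((j - 3) div K) ((j - 3) mod K)))"

lemma val_add: "val N W f + val N W h = val N W (\<lambda>k. f k + h k)"
  by (simp add: val_def sum.distrib distrib_right)

lemma val_mult: "a * val N W f = val N W (\<lambda>k. a * f k)"
  unfolding val_def sum_distrib_left by (simp only: mult.assoc)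

lemma val_sum: "(\<Sum>i\<in>A. val N W (f i)) = val N W (\<lambda>k. \<Sum>i\<in>A. f i k)"
  unfolding val_def by (subst sum.swap) (simp add: sum_distrib_right)

lemma val_cong: "(\<And>k. k < 3 * N + W + 1 \<Longrightarrow> f k = h k) \<Longrightarrow> val N W f = val N W h"
  unfolding val_def by (intro sum.cong) auto

lemma val_const_g: "val N W (\<lambda>_. g) = half N W"
proof -
  have geometric: "(\<Sum>k<n. (b - 1) * b ^ k) = b ^ n - 1" if "0 < b" for b n :: nat
  proof (induction n)
    case (Suc n)
    have "1 \<le> b ^ n" "b ^ n \<le> b * b ^ n" using that by simp_all
    then show ?case using Suc by (simp add: diff_mult_distrib)
  qed simp
  show ?thesis unfolding val_def half_def power_mult by (rule geometric) simp
qed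

lemma sum_columns:
  "(\<Sum>j < cols N. x j * column N W inp j) =
    val N W (\<lambda>k. x 1 * (g - target N W inp k) + x 2 * (g + target N W inp k - total N W k) +
      chosen N W (\<lambda>u t. x (u * K + t + 3)) k)"
proof -
  have "(\<Sum>j < cols N. x j * column N W inp j) = (\<Sum>j < 3. x j * column N W inp j) +
      (\<Sum>i < N * K. x (i + 3) * column N W inp (i + 3))"
    unfolding cols_def add.commute[of "N * K"] by (rule sum_lessThan_add)
  also have "(\<Sum>i < N * K. x (i + 3) * column N W inp (i + 3)) =
      (\<Sum>u<N. \<Sum>t<K. x (u * K + t + 3) * column N W inp (u * K + t + 3))"
    by (rule sum_less_mult)
  also have "\<dots> = (\<Sum>u<N. \<Sum>t<K. val N W (\<lambda>k. x (u * K + t + 3) * item N W u t k))"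
    using K_pos by (intro sum.cong refl) (simp add: column_def val_mult)
  also have "\<dots> = val N W (chosen N W (\<lambda>u t. x (u * K + t + 3)))"
    by (simp add: val_sum chosen_def[abs_def])
  also have "(\<Sum>j < 3. x j * column N W inp j) =
      val N W (\<lambda>k. x 1 * (g - target N W inp k) + x 2 * (g + target N W inp k - total N W k))"
    by (simp add: eval_nat_numeral column_def val_mult val_add)
  finally show ?thesis by (simp add: val_add)
qed

lemma target_le: "(\<And>u. inp u \<le> C) \<Longrightarrow> target N W inp k \<le> total N W k"
  using sums_ge boundary_le K_pos by (auto simp: target_def total_def Suc_le_eq intro: le_trans[OF diff_le_self])

lemma total_less: "total N W k + 1 < 2 ^ (\<beta> - 1)"
  using sums_le \<beta>(1) by (auto simp: total_def)

lemma pow_less_g: "2 ^ (\<beta> - 1) \<le> g"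
proof -
  obtain b where "\<beta> = Suc b" using \<beta>(2) by (cases \<beta>) auto
  moreover have "1 \<le> (2 :: nat) ^ b" by simp
  ultimately show ?thesis by simp
qed

lemma chosen_compl:
  assumes "0 < N" "W \<le> N" "k < 3 * N + W + 1" "\<And>u t. c u t \<le> 1"
  shows "chosen N W c k + chosen N W (\<lambda>u t. 1 - c u t) k = total N W k"
proof -
  have "chosen N W c k + chosen N W (\<lambda>u t. 1 - c u t) k = chosen N W (\<lambda>u t. c u t + (1 - c u t)) k"
    by (simp add: chosen_def sum.distrib distrib_right)
  also have "\<dots> = chosen N W (\<lambda>_ _. 1) k" using assms(4) by simp
  also have "\<dots> = total N W k" by (rule chosen_all[OF assms(1-3)])
  finally show ?thesis .
qed

lemma sum_all_columns:
  assumes "0 < N" "W \<le> N" "\<And>u. inp u \<le> C"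
  shows "(\<Sum>j < cols N. column N W inp j) = 2 * half N W"
proof -
  have "(\<Sum>j < cols N. column N W inp j) =
      val N W (\<lambda>k. g - target N W inp k + (g + target N W inp k - total N W k) + chosen N W (\<lambda>_ _. 1) k)"
    using sum_columns[where x = "\<lambda>_. 1" and N = N and W = W and inp = inp] by simp
  also have "\<dots> = val N W (\<lambda>k. 2 * g)"
  proof (rule val_cong)
    fix k assume k: "k < 3 * N + W + 1"
    have "chosen N W (\<lambda>_ _. 1) k = total N W k" by (rule chosen_all[OF assms(1,2) k])
    moreover have "target N W inp k \<le> total N W k" by (rule target_le) (rule assms(3))
    moreover have "total N W k < g" using total_less[of N W k] pow_less_g by linarith
    ultimately show "g - target N W inp k + (g + target N W inp k - total N W k) + chosen N W (\<lambda>_ _. 1) k = 2 * g"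
      by linarith
  qed
  finally have "(\<Sum>j < cols N. column N W inp j) = val N W (\<lambda>k. 2 * g)" .
  then show ?thesis using val_mult[of 2 N W "\<lambda>_. g"] unfolding val_const_g by simp
qed

text \<open>Both \<open>X\<close> and its complement have the sum \<open>half N W\<close>. The one
  containing column 1 describes a tiling by its items, the other one consists of the tiles not
  chosen.\<close>

theorem partition_iff_tiling:
  assumes "0 < N" "0 < W" "W \<le> N" "\<And>u. inp u \<le> C"
  shows "(\<exists>X \<subseteq> {..<cols N}. sum (column N W inp) X = half N W) \<longleftrightarrow>
    (\<exists>s. tiling tiles l0 r0 fin N W inp s)"
proof -
  let ?t = "target N W inp" and ?T = "total N W" and ?n = "3 * N + W + 1"
  have t_le: "?t k \<le> ?T k" for k by (rule target_le) (rule assms(4))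
  have T_less: "?T k < g" for k using total_less[of N W k] pow_less_g by linarith
  show ?thesis unfolding tiling_iff_chosen[OF assms]
  proof
    assume "\<exists>X \<subseteq> {..<cols N}. sum (column N W inp) X = half N W"
    then obtain X where X: "X \<subseteq> {..<cols N}" "sum (column N W inp) X = half N W" by blast
    define x :: "nat \<Rightarrow> nat" where "x j = of_bool (j \<in> X)" for j
    define c where "c u t = x (u * K + t + 3)" for u t
    have c: "c u t \<le> 1" for u t by (simp add: c_def x_def)
    have "sum (column N W inp) X = (\<Sum>j < cols N. x j * column N W inp j)"
      using X(1) by (simp add: x_def sum.inter_restrict[symmetric] of_bool_def if_distrib[of "\<lambda>x. x * _"] Int_absorb1 cong: if_cong)
    then have "val N W (\<lambda>k. x 1 * (g - ?t k) + x 2 * (g + ?t k - ?T k) + chosen N W c k) = half N W"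
      using X(2) unfolding sum_columns c_def[abs_def] by simp
    then have sum: "(\<Sum>k<?n. (x 1 * (g - ?t k) + x 2 * (g + ?t k - ?T k) + chosen N W c k) * (2 ^ \<beta>) ^ k) =
        (2 ^ \<beta>) ^ ?n - 1"
      by (simp only: val_def half_def power_mult)
    have x_le: "x j \<le> 1" for j by (simp add: x_def)
    have chosen_le: "chosen N W c k \<le> ?T k" if "k < ?n" for k
      using chosen_compl[where c = c, OF assms(1,3) that c] by linarith
    \<comment> \<open>The two balancing columns together give \<open>2 * g - total\<close> and the
      items at most \<open>total\<close>, so digits are at most \<open>2 * g\<close> and
      \<open>digits_unique\<close> applies.\<close>
    have digit: "x 1 * (g - ?t k) + x 2 * (g + ?t k - ?T k) + chosen N W c k = g" if "k < ?n" for k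
    proof (rule digits_unique[OF _ _ sum that])
      fix k assume k: "k < ?n"
      have "x 1 * (g - ?t k) \<le> g - ?t k" "x 2 * (g + ?t k - ?T k) \<le> g + ?t k - ?T k" using x_le by simp_all
      then show "x 1 * (g - ?t k) + x 2 * (g + ?t k - ?T k) + chosen N W c k \<le> 2 * (2 ^ \<beta> - 1)"
        using chosen_le[OF k] t_le[of k] T_less[of k] by linarith
    qed simp
    have x01: "x 1 = 0 \<or> x 1 = 1" "x 2 = 0 \<or> x 2 = 1" by (simp_all add: x_def)
    \<comment> \<open>With neither balancing column the digit is at most \<open>total\<close>, hence
      too small; with both it is at least \<open>2 * g - total\<close>, hence too large.\<close>
    consider "x 1 = 1" "x 2 = 0" | "x 1 = 0" "x 2 = 1"
    proof -
      have "\<not> (x 1 = 0 \<and> x 2 = 0)"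
      proof
        assume "x 1 = 0 \<and> x 2 = 0"
        then have "chosen N W c 0 = g" using digit[of 0] by simp
        then show False using chosen_le[of 0] T_less[of 0] by simp
      qed
      moreover have "\<not> (x 1 = 1 \<and> x 2 = 1)"
      proof
        assume "x 1 = 1 \<and> x 2 = 1"
        then have "g - ?t 0 + (g + ?t 0 - ?T 0) + chosen N W c 0 = g" using digit[of 0] by simp
        then show False using t_le[of 0] T_less[of 0] by linarith
      qed
      ultimately show ?thesis using x01 that by blast
    qed
    then show "\<exists>c. (\<forall>u t. c u t \<le> 1) \<and> (\<forall>k < ?n. chosen N W c k = ?t k)"
    proof cases
      case 1
      have "chosen N W c k = ?t k" if "k < ?n" for k
        using digit[OF that] 1 t_le[of k] T_less[of k] by simp
      then show ?thesis using c by blast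
    next
      case 2
      \<comment> \<open>Column 2 leaves \<open>total - target\<close> for the items in
        \<open>X\<close>, so the tiling is read off from the items outside.\<close>
      have "chosen N W (\<lambda>u t. 1 - c u t) k = ?t k" if "k < ?n" for k
        using digit[OF that] 2 t_le[of k] T_less[of k] chosen_compl[where c = c, OF assms(1,3) that c] by simp
      then show ?thesis by (intro exI[of _ "\<lambda>u t. 1 - c u t"]) simp
    qed
  next
    assume "\<exists>c. (\<forall>u t. c u t \<le> 1) \<and> (\<forall>k < ?n. chosen N W c k = ?t k)"
    then obtain c where c: "\<And>u t. c u t \<le> 1" "\<And>k. k < ?n \<Longrightarrow> chosen N W c k = ?t k" by blast
    define x where "x j = (if j < 3 then of_bool (j = 1) else c ((j - 3) div K) ((j - 3) mod K))" for j
    define X where "X = {j. j < cols N \<and> x j = 1}"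
    have x01: "x j = of_bool (x j = 1)" for j using c(1)[of "(j - 3) div K" "(j - 3) mod K"] by (auto simp: x_def)
    have eq: "chosen N W (\<lambda>u t. x (u * K + t + 3)) = chosen N W c"
      unfolding chosen_def[abs_def] using K_pos by (intro ext sum.cong refl) (simp add: x_def)
    have "sum (column N W inp) X = (\<Sum>j < cols N. of_bool (x j = 1) * column N W inp j)"
      unfolding X_def by (simp add: of_bool_def if_distrib[of "\<lambda>x. x * _"] sum.inter_filter[symmetric] cong: if_cong)
    also have "\<dots> = (\<Sum>j < cols N. x j * column N W inp j)" by (intro sum.cong refl arg_cong2[of _ _ _ _ times] x01[symmetric])
    also have "\<dots> = val N W (\<lambda>_. g)"
      unfolding sum_columns eq
    proof (rule val_cong)
      fix k assume "k < ?n"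
      then show "x 1 * (g - ?t k) + x 2 * (g + ?t k - ?T k) + chosen N W c k = g"
        using c(2)[of k] t_le[of k] T_less[of k] by (simp add: x_def)
    qed
    finally have "sum (column N W inp) X = half N W" by (simp only: val_const_g)
    then show "\<exists>X \<subseteq> {..<cols N}. sum (column N W inp) X = half N W" by (intro exI[of _ X]) (auto simp: X_def)
  qed
qed

end

section \<open>Nondeterministic computations as tilings\<close>

instance dir :: countable
  by countable_datatype

type_synonym rule = "nat \<times> nat list \<times> (nat \<times> (nat \<times> dir) list) option"
type_synonym cell = "(nat \<times> bool) list"
type_synonym tile = "rule \<times> rule \<times> cell option \<times> cell option \<times> cell option"

text \<open>Row \<open>t\<close> of the tiling describes the configuration after \<open>t\<close> steps: a cell lists, for each
  tape, the symbol at one position and whether the head is there. Rows are separated by \<open>None\<close>. A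
  tile sees a cell together with its two neighbours and the transition applied in its row; the
  separator carries the transitions of the two rows that it separates. The rules with target
  \<open>None\<close> apply to accepting halting configurations and turn the whole row into separators.\<close>

fun marked :: "cell option \<Rightarrow> nat \<Rightarrow> bool" where
  "marked None i = False"
| "marked (Some y) i = snd (y ! i)"

definition moved :: "(nat \<times> dir) list \<Rightarrow> cell option \<Rightarrow> cell \<Rightarrow> cell option \<Rightarrow> cell" where
  "moved as x y z = map (\<lambda>i. (if snd (y ! i) then fst (as ! i) else fst (y ! i),
     snd (y ! i) \<and> snd (as ! i) = Stay \<or> marked x i \<and> snd (as ! i) = Go_Right \<or>
     marked z i \<and> snd (as ! i) = Go_Left)) [0..<length y]"

text \<open>The windows of neighbouring tiles overlap in two cells. Their common border carries
  these cells, so that matching colours make the windows consistent, and the rule, so that a row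
  uses only one.\<close>

fun left :: "tile \<Rightarrow> rule \<times> cell option \<times> cell option" where
  "left (r, r', x, y, z) = (r, x, y)"

fun right :: "tile \<Rightarrow> rule \<times> cell option \<times> cell option" where
  "right (r, r', x, y, z) = (r', y, z)"

text \<open>The state travels upwards with every cell: the rule of the next row must start in the
  state that the current rule enters.\<close>

fun down :: "tile \<Rightarrow> (nat \<times> cell) option" where
  "down (r, r', x, y, z) = map_option (\<lambda>y. (fst r, y)) y"

fun up :: "tile \<Rightarrow> (nat \<times> cell) option" where
  "up (r, r', x, y, z) = (case y of None \<Rightarrow> None | Some y \<Rightarrow>
     map_option (\<lambda>(q', as). (q', moved as x y z)) (snd (snd r)))"

definition idle :: rule where
  "idle = (0, [], None)"

definition snapshot :: "tape list \<Rightarrow> int \<Rightarrow> cell" where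
  "snapshot ts p = map (\<lambda>(t, h). (t p, h = p)) ts"

text \<open>Cell \<open>j\<close> shows tape position \<open>j - T - 1\<close>: a separator at 0,
  then the positions from \<open>- T\<close> to \<open>T\<close>. Index \<open>2 * T + 2\<close>
  stands for the separator that begins the next row.\<close>

definition row :: "nat \<Rightarrow> tape list \<Rightarrow> nat \<Rightarrow> cell option" where
  "row T ts j = (if j = 0 \<or> 2 * T + 2 \<le> j then None else Some (snapshot ts (int j - int T - 1)))"

definition heads_within :: "tape list \<Rightarrow> nat \<Rightarrow> bool" where
  "heads_within ts n \<longleftrightarrow> (\<forall>x \<in> set ts. \<bar>snd x\<bar> \<le> int n)"

definition apply_actions :: "tape list \<Rightarrow> (nat \<times> dir) list \<Rightarrow> tape list" where
  "apply_actions = map2 (\<lambda>(t, h) (s, d). (t(h := s), h + shift d))"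

definition reads :: "tape list \<Rightarrow> nat list" where
  "reads = map (\<lambda>(t, h). t h)"

lemma step_iff:
  "((q, ts), (q', ts')) \<in> step M \<longleftrightarrow> (\<exists>as. (q, reads ts, q', as) \<in> transitions M \<and> ts' = apply_actions ts as)"
  by (simp add: step_def reads_def apply_actions_def)

text \<open>At the two separators the left side is false by definition, and the right side because
  no head has left the range from \<open>- T\<close> to \<open>T\<close>.\<close>

lemma marked_row:
  assumes "heads_within ts T" "i < length ts" "j \<le> 2 * T + 2"
  shows "marked (row T ts j) i \<longleftrightarrow> snd (ts ! i) = int j - int T - 1"
proof -
  have "\<bar>snd (ts ! i)\<bar> \<le> int T" using assms(1,2) by (simp add: heads_within_def)
  then show ?thesis using assms(2,3) by (cases "ts ! i") (auto simp: row_def snapshot_def)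
qed

lemma moved_snapshot:
  assumes "heads_within ts T" "0 < j" "j < 2 * T + 2" "length as = length ts"
  shows "moved as (row T ts (j - 1)) (snapshot ts (int j - int T - 1)) (row T ts (j + 1)) =
    snapshot (apply_actions ts as) (int j - int T - 1)"
proof (rule nth_equalityI)
  fix i assume "i < length (moved as (row T ts (j - 1)) (snapshot ts (int j - int T - 1)) (row T ts (j + 1)))"
  then have i: "i < length ts" by (simp add: moved_def snapshot_def)
  obtain t h s d where th: "ts ! i = (t, h)" "as ! i = (s, d)" by (cases "ts ! i"; cases "as ! i")
  have "marked (row T ts (j - 1)) i \<longleftrightarrow> h = int j - int T - 2" "marked (row T ts (j + 1)) i \<longleftrightarrow> h = int j - int T"
    using marked_row[OF assms(1) i, of "j - 1"] marked_row[OF assms(1) i, of "j + 1"] th assms(2,3)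
    by (auto simp: of_nat_diff)
  then show "moved as (row T ts (j - 1)) (snapshot ts (int j - int T - 1)) (row T ts (j + 1)) ! i =
      snapshot (apply_actions ts as) (int j - int T - 1) ! i"
    using i th assms(4) by (cases d) (auto simp: moved_def snapshot_def apply_actions_def)
qed (use assms(4) in \<open>simp add: moved_def snapshot_def apply_actions_def\<close>)

section \<open>The tiles of a fixed machine\<close>

locale ntm =
  fixes M :: tm
  assumes valid: "valid_tm M"
begin

definition symbols :: "nat set" where
  "symbols = {0, 1, 2} \<union> (\<Union>(q, xs, q', as) \<in> transitions M. fst ` set as)"

definition rules :: "rule set" where
  "rules = (\<lambda>(q, xs, q', as). (q, xs, Some (q', as))) ` transitions M \<union>
     {(1, xs, None) | xs. set xs \<subseteq> symbols \<and> length xs = num_tapes M \<and>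
        (\<nexists>q' as. (1, xs, q', as) \<in> transitions M)}"

definition cells :: "cell option set" where
  "cells = insert None (Some ` {y. set y \<subseteq> symbols \<times> UNIV \<and> length y = num_tapes M})"

text \<open>A tile checks only the symbols under the heads in its own cell. As every head is
  somewhere in the row, the row as a whole checks all symbols read by its rule.\<close>

definition tile_set :: "tile set" where
  "tile_set = {(r, r', x, y, z). r \<in> insert idle rules \<and> r' \<in> insert idle rules \<and>
     x \<in> cells \<and> y \<in> cells \<and> z \<in> cells \<and>
     (\<forall>c. y = Some c \<longrightarrow> r = r' \<and> r \<in> rules \<and>
        (\<forall>i < num_tapes M. snd (c ! i) \<longrightarrow> fst (c ! i) = fst (snd r) ! i))}"

lemma finite_symbols: "finite symbols"
proof -
  have "finite (transitions M)" using valid by (simp add: valid_tm_def)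
  then show ?thesis by (auto simp: symbols_def)
qed

lemma finite_tile_set: "finite tile_set"
proof -
  have "finite (transitions M)" using valid by (simp add: valid_tm_def)
  moreover have "{(1, xs, None) | xs. set xs \<subseteq> symbols \<and> length xs = num_tapes M \<and>
        (\<nexists>q' as. (1, xs, q', as) \<in> transitions M)} \<subseteq>
      (\<lambda>xs. (1 :: nat, xs, None :: (nat \<times> (nat \<times> dir) list) option)) ` {xs. set xs \<subseteq> symbols \<and> length xs = num_tapes M}"
    by auto
  then have "finite {(1 :: nat, xs, None :: (nat \<times> (nat \<times> dir) list) option) | xs. set xs \<subseteq> symbols \<and>
      length xs = num_tapes M \<and> (\<nexists>q' as. (1, xs, q', as) \<in> transitions M)}"
    by (rule finite_subset) (intro finite_imageI finite_lists_length_eq finite_symbols)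
  ultimately have r: "finite rules" by (simp add: rules_def)
  have "finite {y. set y \<subseteq> symbols \<times> (UNIV :: bool set) \<and> length y = num_tapes M}"
    by (intro finite_lists_length_eq finite_cartesian_product finite_symbols) simp
  then have c: "finite cells" by (simp add: cells_def)
  have "tile_set \<subseteq> insert idle rules \<times> insert idle rules \<times> cells \<times> cells \<times> cells"
    by (auto simp: tile_set_def)
  then show ?thesis using r c by (rule_tac finite_subset) auto
qed

definition initial_color :: "bool list \<Rightarrow> nat \<Rightarrow> nat \<Rightarrow> (nat \<times> cell) option" where
  "initial_color w T j = map_option (Pair 0) (row T (snd (initial M w)) j)"

definition accepting_tiling :: "bool list \<Rightarrow> nat \<Rightarrow> (nat \<Rightarrow> tile) \<Rightarrow> bool" where
  "accepting_tiling w T s \<longleftrightarrow> (let W = 2 * T + 2; N = T * W in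
     (\<forall>u<N. s u \<in> tile_set) \<and>
     left (s 0) = (idle, None, None) \<and> (\<forall>u. Suc u < N \<longrightarrow> right (s u) = left (s (Suc u))) \<and>
     right (s (N - 1)) = (idle, None, None) \<and>
     (\<forall>u<W. down (s u) = initial_color w T u) \<and>
     (\<forall>u. u + W < N \<longrightarrow> up (s u) = down (s (u + W))) \<and>
     (\<forall>u<N. N \<le> u + W \<longrightarrow> up (s u) = None))"

lemma run_invariant:
  assumes "(initial M w, (q, ts)) \<in> step M ^^ n"
  shows "length ts = num_tapes M \<and> heads_within ts n \<and> (\<forall>x \<in> set ts. range (fst x) \<subseteq> symbols)"
  using assms
proof (induction n arbitrary: q ts)
  case 0
  have "word_tape v i \<in> symbols" for v i by (simp add: word_tape_def symbols_def)
  then show ?case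
    using 0 valid by (auto simp: initial_def valid_tm_def heads_within_def)
next
  case (Suc n)
  then obtain q' ts' where s: "(initial M w, (q', ts')) \<in> step M ^^ n" "((q', ts'), (q, ts)) \<in> step M" by auto
  obtain as where as: "(q', reads ts', q, as) \<in> transitions M" "ts = apply_actions ts' as"
    using s(2) by (auto simp: step_iff)
  have len: "length as = num_tapes M" using valid as(1) by (auto simp: valid_tm_def)
  note IH = Suc.IH[OF s(1)]
  have "\<bar>snd x\<bar> \<le> int (Suc n) \<and> range (fst x) \<subseteq> symbols" if x: "x \<in> set ts" for x
  proof -
    obtain i where i: "i < num_tapes M" "x = ts ! i"
      using x IH len by (auto simp: in_set_conv_nth as(2) apply_actions_def)
    obtain t h where th: "ts' ! i = (t, h)" by (cases "ts' ! i")
    obtain a d where ad: "as ! i = (a, d)" by (cases "as ! i")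
    have xe: "x = (t(h := a), h + shift d)"
      using i IH len th ad by (simp add: as(2) apply_actions_def)
    have "(t, h) \<in> set ts'" using i IH th by (metis nth_mem)
    then have "\<bar>h\<bar> \<le> int n" "range t \<subseteq> symbols"
      using IH unfolding heads_within_def by (metis snd_conv, metis fst_conv)
    moreover have "a \<in> symbols"
    proof -
      have "a \<in> fst ` set as" using ad i len by (metis fst_conv image_eqI nth_mem)
      then show ?thesis using as(1) unfolding symbols_def by blast
    qed
    ultimately show ?thesis unfolding xe by (cases d) auto
  qed
  moreover have "length ts = num_tapes M" using IH len by (simp add: as(2) apply_actions_def)
  ultimately show ?case by (simp add: heads_within_def)
qed

section \<open>From tilings to accepting computations\<close>

lemma down_eq_SomeD:
  "down t = Some (q, c) \<Longrightarrow> \<exists>r r' x z. t = (r, r', x, Some c, z) \<and> fst r = q"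
  by (cases t) auto

lemma down_eq_NoneD: "down t = None \<Longrightarrow> \<exists>r r' x z. t = (r, r', x, None, z)"
  by (cases t) auto

lemma accepts_if_halting_rule:
  assumes "(initial M w, (1, ts)) \<in> step M ^^ n" "\<nexists>q' as. (1, reads ts, q', as) \<in> transitions M"
  shows "accepts M w"
proof -
  have "halted M (1, ts)" using assms(2) by (auto simp: halted_def step_def reads_def)
  then show ?thesis using assms(1) relpow_imp_rtrancl unfolding accepts_def by fastforce
qed

text \<open>The row applies a single rule, which reads the symbols actually scanned. If its target
  is \<open>None\<close>, the configuration reached is halting and accepting; otherwise the next row
  shows the successor configuration.\<close>

lemma accepting_tiling_step:
  assumes tiling: "accepting_tiling w T s" and t: "Suc t < T"
    and run: "(initial M w, (q, ts)) \<in> step M ^^ t"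
    and row_t: "\<And>j. j < 2 * T + 2 \<Longrightarrow> down (s (t * (2 * T + 2) + j)) = map_option (Pair q) (row T ts j)"
  shows "accepts M w \<or> (\<exists>q' ts'. (initial M w, (q', ts')) \<in> step M ^^ Suc t \<and>
    (\<forall>j < 2 * T + 2. down (s (Suc t * (2 * T + 2) + j)) = map_option (Pair q') (row T ts' j)))"
proof -
  define W where "W = 2 * T + 2"
  define u where "u j = t * W + j" for j
  have next_row: "u j + W < T * W" if "j < W" for j
  proof -
    have "Suc (Suc t) * W \<le> T * W" using t by (intro mult_le_mono1) simp
    then show ?thesis using that by (simp add: u_def)
  qed
  have tl: "s (u j) \<in> tile_set" if "j < W" for j
    using tiling next_row[OF that] by (simp add: accepting_tiling_def Let_def W_def)
  have lr: "right (s (u j)) = left (s (u (Suc j)))" if "j < W" for j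
    using tiling next_row[OF that] that by (simp add: accepting_tiling_def Let_def W_def u_def)
  have ud: "up (s (u j)) = down (s (Suc t * W + j))" if "j < W" for j
  proof -
    have eq: "u j + W = Suc t * W + j" by (simp add: u_def)
    have "up (s (u j)) = down (s (u j + W))"
      using tiling next_row[OF that] by (simp only: accepting_tiling_def Let_def W_def)
    then show ?thesis unfolding eq .
  qed
  note inv = run_invariant[OF run]
  have W0: "0 < W" "1 < W" "W = 2 * T + 2" by (simp_all add: W_def)
  have dn: "down (s (u j)) = map_option (Pair q) (row T ts j)" if "j < W" for j
    using row_t[of j] that by (simp add: u_def W_def)
  have sep: "\<exists>r r' x z. s (u 0) = (r, r', x, None, z)"
    using dn[of 0] W0 by (intro down_eq_NoneD) (simp add: row_def)
  \<comment> \<open>The last cell of the row needs a separator as right neighbour. This is the first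
    tile of the next row, which inherits \<open>None\<close> from the separator below it.\<close>
  have "down (s (Suc t * W)) = None" using ud[of 0] sep W0 by auto
  then have "\<exists>r r' x z. s (u W) = (r, r', x, None, z)" by (intro down_eq_NoneD) (simp add: u_def add.commute)
  define mid where "mid v = fst (snd (snd (snd (s v))))" for v
  have mid: "mid (u j) = row T ts j" if "j \<le> W" for j
  proof (cases "j < W")
    case True
    then show ?thesis
    proof (cases "row T ts j")
      case None
      then show ?thesis using down_eq_NoneD[of "s (u j)"] dn[OF True] by (auto simp: mid_def)
    next
      case (Some c)
      then show ?thesis using down_eq_SomeD[of "s (u j)" q c] dn[OF True] by (auto simp: mid_def)
    qed
  next
    case False
    then have "j = W" using that by simp
    then show ?thesis using \<open>\<exists>r r' x z. s (u W) = (r, r', x, None, z)\<close> W0 by (auto simp: mid_def row_def)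
  qed
  have shape: "\<exists>r. s (u j) = (r, r, row T ts (j - 1), Some (snapshot ts (int j - int T - 1)), row T ts (j + 1)) \<and>
      fst r = q \<and> r \<in> rules \<and>
      (\<forall>i < num_tapes M. snd (snapshot ts (int j - int T - 1) ! i) \<longrightarrow>
         fst (snapshot ts (int j - int T - 1) ! i) = fst (snd r) ! i)" if j: "0 < j" "j < W" for j
  proof -
    have "row T ts j = Some (snapshot ts (int j - int T - 1))" using j W0 by (simp add: row_def)
    then have "down (s (u j)) = Some (q, snapshot ts (int j - int T - 1))" using dn[OF j(2)] by simp
    from down_eq_SomeD[OF this] obtain r r' x z
      where r: "s (u j) = (r, r', x, Some (snapshot ts (int j - int T - 1)), z)" "fst r = q" by blast
    have "right (s (u (j - 1))) = left (s (u j))" using lr[of "j - 1"] j by simp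
    then have "x = mid (u (j - 1))" using r by (cases "s (u (j - 1))") (auto simp: mid_def)
    moreover have "right (s (u j)) = left (s (u (Suc j)))" using lr j by simp
    then have "z = mid (u (j + 1))" using r by (cases "s (u (j + 1))") (auto simp: mid_def)
    ultimately show ?thesis
      using r tl[OF j(2)] mid[of "j - 1"] mid[of "j + 1"] j by (auto simp: tile_set_def)
  qed
  obtain r where r: "fst (s (u 1)) = r" "fst r = q" "r \<in> rules"
    using shape[OF zero_less_one W0(2)] by (metis fst_conv)
  have same: "fst (s (u j)) = r" if "0 < j" "j < W" for j
    using that
  proof (induction j)
    case (Suc j)
    show ?case
    proof (cases "j = 0")
      case True
      then show ?thesis using r by simp
    next
      case False
      then have "fst (s (u j)) = r" using Suc by simp
      moreover have "right (s (u j)) = left (s (u (Suc j)))" using lr Suc.prems by simp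
      ultimately show ?thesis using shape[of j] shape[of "Suc j"] Suc.prems False by auto
    qed
  qed simp
  have within: "heads_within ts T" using inv t by (auto simp: heads_within_def)
  have len_xs: "length (fst (snd r)) = num_tapes M"
    using r(3) valid by (auto simp: rules_def valid_tm_def)
  have xs: "fst (snd r) = reads ts"
  proof (rule nth_equalityI)
    show "length (fst (snd r)) = length (reads ts)" using len_xs inv by (simp add: reads_def)
    fix i assume "i < length (fst (snd r))"
    then have i: "i < num_tapes M" "i < length ts" using len_xs inv by auto
    obtain p h where ph: "ts ! i = (p, h)" by (cases "ts ! i")
    have h: "\<bar>h\<bar> \<le> int T" using within i(2) ph by (metis heads_within_def nth_mem snd_conv)
    \<comment> \<open>The cell under the head of tape \<open>i\<close>; its tile compares the symbol
      with the rule.\<close>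
    define j where "j = nat (h + int T + 1)"
    have j: "0 < j" "j < W" "int j - int T - 1 = h" using h by (auto simp: j_def W_def)
    from shape[OF j(1,2)] same[OF j(1,2)]
    have "snd (snapshot ts h ! i) \<longrightarrow> fst (snapshot ts h ! i) = fst (snd r) ! i" using i(1) by (auto simp: j(3))
    then show "fst (snd r) ! i = reads ts ! i" using i(2) ph by (simp add: snapshot_def reads_def)
  qed
  show ?thesis
  proof (cases "snd (snd r)")
    case None
    then have "q = 1" "\<nexists>q' as. (1, reads ts, q', as) \<in> transitions M"
      using r(2,3) xs by (auto simp: rules_def)
    then show ?thesis using accepts_if_halting_rule run by blast
  next
    case (Some a)
    then obtain q' as where a: "snd (snd r) = Some (q', as)" by (cases a) auto
    have rr: "r = (q, reads ts, Some (q', as))" using r(2) xs a by (metis prod.collapse)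
    then have tr: "(q, reads ts, q', as) \<in> transitions M" using r(3) by (auto simp: rules_def)
    then have len: "length as = length ts" using valid inv by (auto simp: valid_tm_def)
    have "((q, ts), (q', apply_actions ts as)) \<in> step M" using tr by (auto simp: step_iff)
    then have run': "(initial M w, (q', apply_actions ts as)) \<in> step M ^^ Suc t"
      using run by auto
    have "down (s (Suc t * W + j)) = map_option (Pair q') (row T (apply_actions ts as) j)" if "j < W" for j
    proof (cases "j = 0")
      case True
      then show ?thesis using ud[of 0] sep W0 by (auto simp: row_def)
    next
      case False
      then have j: "0 < j" "j < W" using that by auto
      obtain r0 where r0: "s (u j) = (r0, r0, row T ts (j - 1), Some (snapshot ts (int j - int T - 1)), row T ts (j + 1))"
        using shape[OF j] by blast
      then have "r0 = r" using same[OF j] by simp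
      then have "up (s (u j)) = Some (q', snapshot (apply_actions ts as) (int j - int T - 1))"
        using r0 rr moved_snapshot[OF within j(1) _ len] j(2) by (simp add: W_def)
      then show ?thesis using ud[OF that] j by (simp add: row_def W_def)
    qed
    then show ?thesis using run' unfolding W_def by blast
  qed
qed

text \<open>Without acceptance every row shows a configuration, even the last one. Its last cell is
  then a genuine cell, whereas the right boundary colour demands a separator.\<close>

lemma accepting_tiling_imp_accepts:
  assumes tiling: "accepting_tiling w T s" and "0 < T"
  shows "accepts M w"
proof (rule ccontr)
  assume no: "\<not> accepts M w"
  define W where "W = 2 * T + 2"
  have rows: "\<exists>q ts. (initial M w, (q, ts)) \<in> step M ^^ t \<and>
      (\<forall>j < 2 * T + 2. down (s (t * (2 * T + 2) + j)) = map_option (Pair q) (row T ts j))" if "t < T" for t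
    using that
  proof (induction t)
    case 0
    have "initial M w = (0, snd (initial M w))" by (simp add: initial_def)
    then have "(initial M w, (0, snd (initial M w))) \<in> step M ^^ 0" by simp
    moreover have "\<forall>j < 2 * T + 2. down (s (0 * (2 * T + 2) + j)) = map_option (Pair 0) (row T (snd (initial M w)) j)"
      using tiling by (simp add: accepting_tiling_def Let_def initial_color_def)
    ultimately show ?case by blast
  next
    case (Suc t)
    then obtain q ts where "(initial M w, (q, ts)) \<in> step M ^^ t"
      "\<And>j. j < 2 * T + 2 \<Longrightarrow> down (s (t * (2 * T + 2) + j)) = map_option (Pair q) (row T ts j)" by auto
    from accepting_tiling_step[OF tiling Suc.prems this] no show ?case by blast
  qed
  have "0 < W" by (simp add: W_def)
  obtain q ts where "\<forall>j<W. down (s ((T - 1) * W + j)) = map_option (Pair q) (row T ts j)"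
    using rows[of "T - 1"] assms(2) unfolding W_def[symmetric] by auto
  from this[rule_format, of "W - 1"]
  have "down (s ((T - 1) * W + (W - 1))) = map_option (Pair q) (row T ts (W - 1))"
    using \<open>0 < W\<close> by simp
  moreover have "(T - 1) * W + (W - 1) = T * W - 1"
    using assms(2) by (cases T) (simp_all add: W_def)
  ultimately have "down (s (T * W - 1)) = Some (q, snapshot ts (int (W - 1) - int T - 1))"
    using assms(2) by (simp add: row_def W_def)
  then obtain r r' x z where "s (T * W - 1) = (r, r', x, Some (snapshot ts (int (W - 1) - int T - 1)), z)"
    using down_eq_SomeD by blast
  moreover have "right (s (T * W - 1)) = (idle, None, None)"
    using tiling by (simp add: accepting_tiling_def Let_def W_def)
  ultimately show False by simp
qed

section \<open>From accepting computations to tilings\<close>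

lemma row_in_cells:
  assumes "(initial M w, (q, ts)) \<in> step M ^^ n"
  shows "row T ts j \<in> cells"
proof -
  note inv = run_invariant[OF assms]
  have "set (snapshot ts p) \<subseteq> symbols \<times> UNIV" for p
  proof
    fix x assume "x \<in> set (snapshot ts p)"
    then obtain t h where th: "(t, h) \<in> set ts" "x = (t p, h = p)" by (auto simp: snapshot_def)
    then have "range t \<subseteq> symbols" using inv by (metis fst_conv)
    then show "x \<in> symbols \<times> UNIV" using th by blast
  qed
  then show ?thesis using inv by (simp add: row_def cells_def snapshot_def)
qed

text \<open>Rows 0 to \<open>n\<close> show the computation, and the halting rule in row
  \<open>n\<close> blanks everything above. The summand 2 guarantees at least one blank row, as the
  boundary colours made from \<open>idle\<close> and \<open>None\<close> require.\<close>

lemma accepts_imp_accepting_tiling: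
  assumes "accepts M w" "runs_in_time M t" "t (length w) + 2 \<le> T"
  shows "\<exists>s. accepting_tiling w T s"
proof -
  obtain c n where c: "(initial M w, c) \<in> step M ^^ n" "halted M c" "fst c = 1"
    using assms(1) rtrancl_imp_relpow unfolding accepts_def by metis
  have "n \<le> t (length w)" using assms(2) c(1) unfolding runs_in_time_def by blast
  then have nT: "n + 2 \<le> T" using assms(3) by linarith
  obtain f where f: "f 0 = initial M w" "f n = c" "\<And>i. i < n \<Longrightarrow> (f i, f (Suc i)) \<in> step M"
    using c(1) unfolding relpow_fun_conv by blast
  define q where "q i = fst (f i)" for i
  define ts where "ts i = snd (f i)" for i
  have run: "(initial M w, (q i, ts i)) \<in> step M ^^ i" if "i \<le> n" for i
    using that
  proof (induction i)
    case 0
    then show ?case using f(1) by (simp add: q_def ts_def)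
  next
    case (Suc i)
    then show ?case using f(3)[of i] by (auto simp: q_def ts_def)
  qed
  have "\<exists>as. (q i, reads (ts i), q (Suc i), as) \<in> transitions M \<and> ts (Suc i) = apply_actions (ts i) as" if "i < n" for i
    using f(3)[OF that] step_iff[of "q i" "ts i" "q (Suc i)" "ts (Suc i)" M] by (simp add: q_def ts_def)
  then obtain act where act: "\<And>i. i < n \<Longrightarrow> (q i, reads (ts i), q (Suc i), act i) \<in> transitions M \<and>
      ts (Suc i) = apply_actions (ts i) (act i)" by metis
  define r where "r i = (if i < n then (q i, reads (ts i), Some (q (Suc i), act i))
     else if i = n then (1, reads (ts n), None) else idle)" for i
  have qn: "q n = 1" using c(3) f(2) by (simp add: q_def)
  have stuck: "(1, reads (ts n), q', as) \<notin> transitions M" for q' as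
  proof
    assume "(1, reads (ts n), q', as) \<in> transitions M"
    then have "((q n, ts n), (q', apply_actions (ts n) as)) \<in> step M" using qn by (auto simp: step_iff)
    then show False using c(2) f(2) by (auto simp: halted_def q_def ts_def)
  qed
  have len: "length (ts i) = num_tapes M" and within: "heads_within (ts i) T" if "i \<le> n" for i
    using run_invariant[OF run[OF that]] that nT by (auto simp: heads_within_def)
  have r_rules: "r i \<in> rules" if "i \<le> n" for i
  proof (cases "i < n")
    case True
    then show ?thesis using act[OF True] by (force simp: r_def rules_def)
  next
    case False
    then have i: "i = n" using that by simp
    have "set (reads (ts n)) \<subseteq> symbols"
    proof
      fix x assume "x \<in> set (reads (ts n))"
      then obtain t h where th: "(t, h) \<in> set (ts n)" "x = t h" by (auto simp: reads_def)
      then have "range t \<subseteq> symbols" using run_invariant[OF run[of n]] by (metis fst_conv order_refl)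
      then show "x \<in> symbols" using th by blast
    qed
    then show ?thesis using i stuck len[of n] by (simp add: r_def rules_def reads_def)
  qed
  have r_idle: "r i \<in> insert idle rules" for i
    using r_rules[of i] by (cases "i \<le> n") (auto simp: r_def)
  have r_fst: "fst (r i) = q i" "fst (snd (r i)) = reads (ts i)" if "i \<le> n" for i
    using that qn by (auto simp: r_def)
  define W where "W = 2 * T + 2"
  define N where "N = T * W"
  have W0: "0 < W" "1 < W" by (simp_all add: W_def)
  define y where "y u = (if u div W \<le> n then row T (ts (u div W)) (u mod W) else None)" for u
  \<comment> \<open>A separator takes its left rule from the row of its predecessor
    \<open>u - 1\<close>; this is the change of rule at a row start and makes no difference inside
    blank rows.\<close>
  define s where "s u = (if y u = None then (if u = 0 then idle else r ((u - 1) div W)) else r (u div W),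
     r (u div W), if u = 0 then None else y (u - 1), y u, if Suc u < N then y (Suc u) else None)" for u
  have y_cells: "y u \<in> cells" for u
    using row_in_cells[OF run] by (simp add: y_def cells_def)
  have y_Some: "u div W \<le> n \<and> 0 < u mod W \<and> v = snapshot (ts (u div W)) (int (u mod W) - int T - 1)"
    if "y u = Some v" for u v
    using that by (auto simp: y_def row_def split: if_splits)
  have tiles: "s u \<in> tile_set" if "u < N" for u
  proof -
    have "r (u div W) \<in> rules \<and> (\<forall>i < num_tapes M. snd (v ! i) \<longrightarrow> fst (v ! i) = fst (snd (r (u div W))) ! i)"
      if v: "y u = Some v" for v
    proof -
      have "snd (v ! i) \<longrightarrow> fst (v ! i) = reads (ts (u div W)) ! i" if "i < num_tapes M" for i
        using y_Some[OF v] len[of "u div W"] that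
        by (cases "ts (u div W) ! i") (auto simp: snapshot_def reads_def)
      then show ?thesis using y_Some[OF v] r_rules r_fst by simp
    qed
    then show ?thesis using y_cells r_idle by (auto simp: s_def tile_set_def cells_def)
  qed
  have y0: "y 0 = None" by (simp add: y_def row_def)
  have lr: "right (s u) = left (s (Suc u))" if "Suc u < N" for u
  proof (cases "y (Suc u)")
    case None
    then show ?thesis using that by (simp add: s_def)
  next
    case (Some v)
    then have "0 < Suc u mod W" using y_Some by blast
    then have "Suc u div W = u div W" by (simp add: div_Suc split: if_splits)
    then show ?thesis using that Some by (simp add: s_def)
  qed
  have last_row: "y u = None \<and> r (u div W) = idle" if "u < N" "N \<le> u + W" for u
  proof -
    have "(T - 1) * W \<le> u" using that(2) by (simp add: N_def diff_mult_distrib)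
    then have "T - 1 \<le> u div W" using W0 by (simp add: less_eq_div_iff_mult_less_eq)
    then have "n < u div W" using nT by linarith
    then show ?thesis by (simp add: y_def r_def)
  qed
  have WN: "W \<le> N" using nT by (simp add: N_def)
  have first: "left (s 0) = (idle, None, None)" using y0 by (simp add: s_def)
  have last: "right (s (N - 1)) = (idle, None, None)"
    using last_row[of "N - 1"] WN W0 by (simp add: s_def)
  have init: "down (s u) = initial_color w T u" if "u < W" for u
  proof -
    have "initial M w = (0, snd (initial M w))" by (simp add: initial_def)
    then have "q 0 = 0" "ts 0 = snd (initial M w)" using f(1) by (metis fst_conv q_def, simp add: ts_def)
    moreover have "u div W = 0" "u mod W = u" using that by auto
    ultimately show ?thesis using r_fst(1)[of 0] by (cases "y u") (auto simp: s_def y_def initial_color_def)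
  qed
  have ud: "up (s u) = down (s (u + W))" if "u + W < N" for u
  proof -
    have dm: "(u + W) div W = Suc (u div W)" "(u + W) mod W = u mod W" using W0 by simp_all
    show ?thesis
    proof (cases "y u")
      case None
      then have "y (u + W) = None" using dm by (auto simp: y_def row_def split: if_splits)
      then show ?thesis using None by (simp add: s_def)
    next
      case (Some v)
      let ?t = "u div W" and ?j = "u mod W"
      note v = y_Some[OF Some]
      have "?j < W" using W0 by simp
      then have j: "0 < ?j" "?j < 2 * T + 2" using v W_def by linarith+
      have "u \<noteq> 0" using Some y0 by (metis option.distinct(1))
      show ?thesis
      proof (cases "?t = n")
        case True
        then have "y (u + W) = None" using dm by (simp add: y_def)
        then show ?thesis using Some True by (simp add: s_def r_def)
      next
        case False
        then have t: "?t < n" using v by simp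
        have "Suc u < N" using that W0 by linarith
        have u: "u = ?t * W + ?j" by simp
        have e: "u - 1 = ?t * W + (?j - 1)" using u j by linarith
        have dm': "(a * W + b) div W = a" "(a * W + b) mod W = b" if "b < W" for a b using that by simp_all
        have "?j - 1 < W" using \<open>?j < W\<close> by simp
        then have "(u - 1) div W = ?t" "(u - 1) mod W = ?j - 1"
          unfolding e by (rule dm')+
        then have x: "y (u - 1) = row T (ts ?t) (?j - 1)" using t by (simp add: y_def)
        have z: "y (Suc u) = row T (ts ?t) (?j + 1)"
        proof (cases "?j + 1 = W")
          case True
          then have "Suc u mod W = 0" by (simp add: mod_Suc)
          then show ?thesis using True by (simp add: y_def row_def W_def)
        next
          case False
          then have "Suc u mod W = ?j + 1" by (simp add: mod_Suc)
          moreover from this have "Suc u div W = ?t" by (simp add: div_Suc)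
          ultimately show ?thesis using t by (simp add: y_def)
        qed
        have "moved (act ?t) (row T (ts ?t) (?j - 1)) v (row T (ts ?t) (?j + 1)) =
            snapshot (ts (Suc ?t)) (int ?j - int T - 1)"
        proof -
          have "length (act ?t) = length (ts ?t)"
            using valid act[OF t] len[of ?t] t by (auto simp: valid_tm_def)
          then show ?thesis using moved_snapshot[OF within j] act[OF t] v t by simp
        qed
        then have "up (s u) = Some (q (Suc ?t), snapshot (ts (Suc ?t)) (int ?j - int T - 1))"
          using Some \<open>Suc u < N\<close> x z \<open>u \<noteq> 0\<close> t by (simp add: s_def r_def)
        moreover have "y (u + W) = Some (snapshot (ts (Suc ?t)) (int ?j - int T - 1))"
          using dm t j by (simp add: y_def row_def)
        then have "down (s (u + W)) = Some (q (Suc ?t), snapshot (ts (Suc ?t)) (int ?j - int T - 1))"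
          using dm t r_fst(1)[of "Suc ?t"] by (simp add: s_def)
        ultimately show ?thesis by simp
      qed
    qed
  qed
  have fin: "up (s u) = None" if "u < N" "N \<le> u + W" for u
    using last_row[OF that] by (simp add: s_def)
  have "accepting_tiling w T s"
    unfolding accepting_tiling_def Let_def W_def[symmetric] N_def[symmetric]
    using tiles first lr last init ud fin by blast
  then show ?thesis by blast
qed

end

text \<open>The input enters only through the colours of the first row: \<open>h\<close> for the
  separator, \<open>hc\<close> for tape position 0 (cell \<open>T + 1\<close>), where all heads
  start, and \<open>ic\<close> for the other positions.\<close>

definition input_row :: "nat \<Rightarrow> (nat \<Rightarrow> nat) \<Rightarrow> (nat \<Rightarrow> nat) \<Rightarrow> nat \<Rightarrow> bool list \<Rightarrow> nat \<Rightarrow> nat" where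
  "input_row h hc ic T w u = (if u = 0 then h else if u = T + 1 then hc (word_tape w 0)
     else ic (word_tape w (int u - int T - 1)))"

section \<open>Colours as natural numbers\<close>

context ntm
begin

text \<open>\<open>Suc\<close> reserves 0 for the left and lower sides of the additional tile
  \<open>(0, C, 0, C)\<close>.\<close>

definition color :: "'a :: countable \<Rightarrow> nat" where
  "color c = Suc (to_nat c)"

lemma color_eq_iff [simp]: "color a = color b \<longleftrightarrow> a = b"
  by (simp add: color_def)

definition coded :: "tile \<Rightarrow> nat \<times> nat \<times> nat \<times> nat" where
  "coded t = (color (left t), color (right t), color (down t), color (up t))"

definition start_cell :: "bool \<Rightarrow> nat \<Rightarrow> nat" where
  "start_cell b x = color (Some (0 :: nat, (x, b) # replicate (num_tapes M - 1) (0 :: nat, b)))"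

abbreviation "corner \<equiv> color (idle, None :: cell option, None :: cell option)"
abbreviation "sep \<equiv> color (None :: (nat \<times> cell) option)"
abbreviation "coded_tiling tiles w T \<equiv> tiling tiles corner corner sep (T * (2 * T + 2)) (2 * T + 2)
  (input_row sep (start_cell True) (start_cell False) T w)"

lemma color_initial_color:
  assumes "u < 2 * T + 2"
  shows "color (initial_color w T u) = input_row sep (start_cell True) (start_cell False) T w u"
proof (cases "u = 0")
  case True
  then show ?thesis by (simp add: initial_color_def row_def input_row_def)
next
  case False
  have "word_tape [] p = 0" for p by (simp add: word_tape_def)
  then have "snapshot (snd (initial M w)) p = (word_tape w p, p = 0) # replicate (num_tapes M - 1) (0, p = 0)" for p
    by (auto simp: snapshot_def initial_def)
  moreover have "int u - int T - 1 = 0 \<longleftrightarrow> u = T + 1" by linarith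
  ultimately show ?thesis
    using False assms by (simp add: initial_color_def row_def input_row_def start_cell_def)
qed

lemma tiling_coded:
  assumes "\<And>u. u < N \<Longrightarrow> t u = coded (s u)" "N = T * (2 * T + 2)" "0 < T"
    and "\<And>u. u < N \<Longrightarrow> s u \<in> tile_set" "coded ` tile_set \<subseteq> set tiles"
  shows "tiling tiles corner corner sep N (2 * T + 2)
    (input_row sep (start_cell True) (start_cell False) T w) t \<longleftrightarrow> accepting_tiling w T s"
proof -
  have "1 * (2 * T + 2) \<le> T * (2 * T + 2)" using assms(3) by (intro mult_le_mono1) simp
  then have N: "2 * T + 2 \<le> N" "0 < N" "N - 1 < N" using assms(2) by auto
  have in_tiles: "\<forall>u<N. t u \<in> set tiles" using assms(1,4,5) by auto
  have a: "(\<forall>u<2 * T + 2. fst (snd (snd (t u))) = input_row sep (start_cell True) (start_cell False) T w u) \<longleftrightarrow>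
      (\<forall>u<2 * T + 2. down (s u) = initial_color w T u)"
    using N(1) assms(1) by (simp add: color_initial_color[symmetric] coded_def)
  have b: "fst (t 0) = corner \<longleftrightarrow> left (s 0) = (idle, None, None)"
    "fst (snd (t (N - 1))) = corner \<longleftrightarrow> right (s (N - 1)) = (idle, None, None)"
    using N assms(1) by (simp_all add: coded_def)
  have c: "(\<forall>u. Suc u < N \<longrightarrow> fst (snd (t u)) = fst (t (Suc u))) \<longleftrightarrow>
      (\<forall>u. Suc u < N \<longrightarrow> right (s u) = left (s (Suc u)))"
    using assms(1) by (simp add: coded_def)
  have d: "(\<forall>u. u + (2 * T + 2) < N \<longrightarrow> snd (snd (snd (t u))) = fst (snd (snd (t (u + (2 * T + 2)))))) \<longleftrightarrow>
      (\<forall>u. u + (2 * T + 2) < N \<longrightarrow> up (s u) = down (s (u + (2 * T + 2))))"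
    using assms(1) by (simp add: coded_def)
  have e: "(\<forall>u<N. N \<le> u + (2 * T + 2) \<longrightarrow> snd (snd (snd (t u))) = sep) \<longleftrightarrow>
      (\<forall>u<N. N \<le> u + (2 * T + 2) \<longrightarrow> up (s u) = None)"
    using assms(1) by (simp add: coded_def)
  have s: "\<forall>u<N. s u \<in> tile_set" using assms(4) by blast
  show ?thesis
    unfolding tiling_def accepting_tiling_def Let_def assms(2)[symmetric] a b c d e
    using in_tiles s by blast
qed

text \<open>The additional tile cannot be placed: its left colour 0 would have to equal
  \<open>corner\<close> or the right colour of a tile, and all of these are positive.\<close>

lemma ex_tiles:
  "\<exists>tiles C. (\<forall>(a, b, c, d) \<in> set tiles. a \<le> C \<and> b \<le> C \<and> c \<le> C \<and> d \<le> C) \<and> corner \<le> C \<and> sep \<le> C \<and>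
     (\<forall>x b. x \<le> 2 \<longrightarrow> start_cell b x \<le> C) \<and> (0, C, 0, C) \<in> set tiles \<and>
     (\<forall>w T. 0 < T \<longrightarrow> (\<exists>s. coded_tiling tiles w T s) \<longleftrightarrow> (\<exists>s. accepting_tiling w T s))"
proof -
  obtain ts where ts: "set ts = coded ` tile_set" using finite_list finite_tile_set by (metis finite_imageI)
  define S where "S = (\<Union>(a, b, c, d) \<in> set ts. {a, b, c, d}) \<union> {corner, sep} \<union> case_prod start_cell ` (UNIV \<times> {..2})"
  have "finite S" by (auto simp: S_def)
  then obtain C where C: "\<And>x. x \<in> S \<Longrightarrow> x \<le> C" by (meson finite_nat_set_iff_bounded_le)
  define tiles where "tiles = (0, C, 0, C) # ts"
  have bound: "a \<le> C \<and> b \<le> C \<and> c \<le> C \<and> d \<le> C" if "(a, b, c, d) \<in> set tiles" for a b c d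
  proof (cases "(a, b, c, d) \<in> set ts")
    case True
    then have "{a, b, c, d} \<subseteq> S" unfolding S_def by blast
    then show ?thesis using C by blast
  qed (use that in \<open>auto simp: tiles_def\<close>)
  have corner: "corner \<le> C" "sep \<le> C" using C by (auto simp: S_def)
  have start: "start_cell b x \<le> C" if "x \<le> 2" for x b
    by (rule C) (use that in \<open>auto simp: S_def\<close>)
  have main: "(\<exists>s. coded_tiling tiles w T s) \<longleftrightarrow> (\<exists>s. accepting_tiling w T s)" if "0 < T" for w T
  proof
    let ?N = "T * (2 * T + 2)"
    have sub: "coded ` tile_set \<subseteq> set tiles" using ts by (auto simp: tiles_def)
    {
      assume "\<exists>s. accepting_tiling w T s"
      then obtain s where s: "accepting_tiling w T s" by blast
      then have "\<And>u. u < ?N \<Longrightarrow> s u \<in> tile_set" by (simp add: accepting_tiling_def Let_def)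
      from tiling_coded[where t = "\<lambda>u. coded (s u)" and s = s and w = w, OF refl refl that this sub] s
      show "\<exists>s. coded_tiling tiles w T s" by blast
    next
      assume "\<exists>s. coded_tiling tiles w T s"
      then obtain t where t: "coded_tiling tiles w T t" by blast
      have "0 < C" using corner(1) by (simp add: color_def)
      then have pos: "0 < fst (snd x)" if "x \<in> set tiles" for x
        using that ts by (auto simp: tiles_def coded_def color_def)
      have "t u \<in> set ts" if "u < ?N" for u
      proof (rule ccontr)
        assume "t u \<notin> set ts"
        then have "fst (t u) = 0" using t that by (auto simp: tiling_def tiles_def)
        moreover have "0 < fst (t u)"
        proof (cases u)
          case 0
          then show ?thesis using t by (simp add: tiling_def color_def)
        next
          case (Suc v)
          then have "fst (snd (t v)) = fst (t u)" "t v \<in> set tiles" using t that by (auto simp: tiling_def)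
          then show ?thesis using pos[of "t v"] by simp
        qed
        ultimately show False by simp
      qed
      then have "\<forall>u. \<exists>x. u < ?N \<longrightarrow> x \<in> tile_set \<and> t u = coded x" using ts by blast
      then obtain s where s: "\<And>u. u < ?N \<Longrightarrow> s u \<in> tile_set \<and> t u = coded (s u)" by metis
      have "coded_tiling tiles w T t \<longleftrightarrow> accepting_tiling w T s"
        by (rule tiling_coded[OF _ refl that _ sub]) (use s in auto)
      then show "\<exists>s. accepting_tiling w T s" using t by blast
    }
  qed
  show ?thesis
    by (intro exI[of _ tiles] exI[of _ C]) (use bound corner start main in \<open>auto simp: tiles_def\<close>)
qed

end

text \<open>Everything but \<open>w\<close> and \<open>T\<close> depends on \<open>A\<close> alone,
  so the printing program may contain it as constants.\<close>

theorem NP_imp_tiling: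
  assumes "A \<in> NP"
  obtains tiles C l0 fin hc ic and p :: "nat poly"
  where "\<And>a b c d. (a, b, c, d) \<in> set tiles \<Longrightarrow> a \<le> C \<and> b \<le> C \<and> c \<le> C \<and> d \<le> C"
    and "l0 \<le> C" "fin \<le> C" "\<And>x. x \<le> 2 \<Longrightarrow> hc x \<le> C" "\<And>x. x \<le> 2 \<Longrightarrow> ic x \<le> C" "(0, C, 0, C) \<in> set tiles"
    and "\<And>(w :: bool list) T. poly p (length w) + 2 \<le> T \<Longrightarrow>
      w \<in> A \<longleftrightarrow> (\<exists>s. tiling tiles l0 l0 fin (T * (2 * T + 2)) (2 * T + 2) (input_row fin hc ic T w) s)"
proof -
  obtain M and p :: "nat poly" where M: "valid_tm M" "runs_in_time M (poly p)" "A = {w. accepts M w}"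
    using assms by (auto simp: NP_def)
  interpret ntm M by unfold_locales (rule M(1))
  obtain tiles C where t: "\<forall>(a, b, c, d) \<in> set tiles. a \<le> C \<and> b \<le> C \<and> c \<le> C \<and> d \<le> C"
    "corner \<le> C" "sep \<le> C" "\<forall>x b. x \<le> 2 \<longrightarrow> start_cell b x \<le> C" "(0, C, 0, C) \<in> set tiles"
    "\<forall>w T. 0 < T \<longrightarrow> (\<exists>s. coded_tiling tiles w T s) \<longleftrightarrow> (\<exists>s. accepting_tiling w T s)"
    using ex_tiles by auto
  show thesis
  proof (rule that[of tiles C corner sep "start_cell True" "start_cell False" p])
    fix w :: "bool list" and T assume T: "poly p (length w) + 2 \<le> T"
    then have "0 < T" by simp
    moreover have "w \<in> A \<longleftrightarrow> (\<exists>s. accepting_tiling w T s)"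
      using accepting_tiling_imp_accepts \<open>0 < T\<close> accepts_imp_accepting_tiling[OF _ M(2) T] M(3) by blast
    ultimately show "w \<in> A \<longleftrightarrow> (\<exists>s. coded_tiling tiles w T s)" using t(6) by blast
  qed (use t in auto)
qed

section \<open>Compiling structured programs to Turing machines\<close>

datatype com =
    Skip
  | Op nat "nat option" dir
  | Seq com com
  | Cond nat nat com com
  | Until nat nat com

datatype instr = IOp nat "nat option" dir | IBr nat nat nat nat

fun csize :: "com \<Rightarrow> nat" where
  "csize Skip = 0"
| "csize (Op i s d) = 1"
| "csize (Seq a b) = csize a + csize b"
| "csize (Cond i s a b) = csize a + csize b + 2"
| "csize (Until i s a) = csize a + 2"

text \<open>Addresses are absolute, \<open>q\<close> being the first one. \<open>IBr 0 0 t t\<close>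
  is an unconditional jump, since both outcomes of the test agree.\<close>

fun assemble :: "nat \<Rightarrow> com \<Rightarrow> instr list" where
  "assemble q Skip = []"
| "assemble q (Op i s d) = [IOp i s d]"
| "assemble q (Seq a b) = assemble q a @ assemble (q + csize a) b"
| "assemble q (Cond i s a b) =
     IBr i s (q + 1) (q + csize a + 2) # assemble (q + 1) a @
     IBr 0 0 (q + csize a + 2 + csize b) (q + csize a + 2 + csize b) #
     assemble (q + csize a + 2) b"
| "assemble q (Until i s a) =
     IBr i s (q + csize a + 2) (q + 1) # assemble (q + 1) a @ [IBr 0 0 q q]"

lemma length_assemble [simp]: "length (assemble q c) = csize c"
  by (induction c arbitrary: q) auto

fun perform :: "instr \<Rightarrow> nat \<Rightarrow> nat list \<Rightarrow> nat \<times> (nat \<times> dir) list" where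
  "perform (IOp i s d) q xs =
     (q + 1, (map (\<lambda>x. (x, Stay)) xs)[i := (case s of None \<Rightarrow> xs ! i | Some y \<Rightarrow> y, d)])"
| "perform (IBr i s t t') q xs = (if xs ! i = s then t else t', map (\<lambda>x. (x, Stay)) xs)"

text \<open>The state is the program counter, and running past the end of \<open>P\<close> halts
  because no transition starts there. Restricting the scanned symbols to 0, 1, 2 keeps the
  transition set finite.\<close>

definition machine :: "nat \<Rightarrow> instr list \<Rightarrow> tm" where
  "machine k P = \<lparr>num_tapes = k, transitions =
     {(q, xs, q', as). q < length P \<and> length xs = k \<and> set xs \<subseteq> {0, 1, 2} \<and>
        (q', as) = perform (P ! q) q xs}\<rparr>"

lemma length_perform: "length (snd (perform a q xs)) = length xs"
  by (cases a) auto

lemma valid_machine: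
  assumes "0 < k"
  shows "valid_tm (machine k P)"
proof -
  have "transitions (machine k P) \<subseteq>
    (\<lambda>(q, xs). (q, xs, perform (P ! q) q xs)) ` ({..<length P} \<times> {xs. set xs \<subseteq> {0, 1, 2} \<and> length xs = k})"
    by (force simp: machine_def)
  moreover have "finite {xs. set xs \<subseteq> {0::nat, 1, 2} \<and> length xs = k}"
    by (rule finite_lists_length_eq) simp
  ultimately have "finite (transitions (machine k P))"
    by (meson finite_SigmaI finite_imageI finite_lessThan finite_subset)
  moreover have "length as = k" if "(q, xs, q', as) \<in> transitions (machine k P)" for q xs q' as
    using that length_perform[of "P ! q" q xs] by (simp add: machine_def) (metis snd_conv)
  ultimately show ?thesis
    using assms by (auto simp: valid_tm_def) (auto simp: machine_def)
qed

lemma deterministic_machine: "deterministic (machine k P)"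
proof -
  have "perform (P ! q) q xs = (q', as)" if "(q, xs, q', as) \<in> transitions (machine k P)" for q xs q' as
    using that unfolding machine_def by simp
  then show ?thesis unfolding deterministic_def by (metis Pair_inject)
qed

section \<open>Execution of structured commands\<close>

fun write_move :: "nat option \<Rightarrow> dir \<Rightarrow> tape \<Rightarrow> tape" where
  "write_move s d (t, h) = ((case s of None \<Rightarrow> t | Some y \<Rightarrow> t(h := y)), h + shift d)"

definition scan :: "tape \<Rightarrow> nat" where
  "scan = (\<lambda>(t, h). t h)"

definition ternary :: "nat \<Rightarrow> tape list \<Rightarrow> bool" where
  "ternary k ts \<longleftrightarrow> length ts = k \<and> (\<forall>x \<in> set ts. range (fst x) \<subseteq> {0, 1, 2})"

text \<open>The number counts machine steps exactly: a test costs one step, and so do the jump over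
  the second branch of \<open>Cond\<close> and the jump back to the test of
  \<open>Until\<close>.\<close>

inductive exec :: "com \<Rightarrow> tape list \<Rightarrow> nat \<Rightarrow> tape list \<Rightarrow> bool" where
  Skip: "exec Skip ts 0 ts"
| Op: "i < length ts \<Longrightarrow> set_option s \<subseteq> {0, 1, 2} \<Longrightarrow> exec (Op i s d) ts 1 (ts[i := write_move s d (ts ! i)])"
| Seq: "exec a ts n ts' \<Longrightarrow> exec b ts' n' ts'' \<Longrightarrow> exec (Seq a b) ts (n + n') ts''"
| Cond_eq: "i < length ts \<Longrightarrow> scan (ts ! i) = s \<Longrightarrow> exec a ts n ts' \<Longrightarrow> exec (Cond i s a b) ts (n + 2) ts'"
| Cond_neq: "i < length ts \<Longrightarrow> scan (ts ! i) \<noteq> s \<Longrightarrow> exec b ts n ts' \<Longrightarrow> exec (Cond i s a b) ts (n + 1) ts'"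
| Until_eq: "i < length ts \<Longrightarrow> scan (ts ! i) = s \<Longrightarrow> exec (Until i s a) ts 1 ts"
| Until_neq: "i < length ts \<Longrightarrow> scan (ts ! i) \<noteq> s \<Longrightarrow> exec a ts n ts' \<Longrightarrow> exec (Until i s a) ts' n' ts'' \<Longrightarrow>
    exec (Until i s a) ts (n + n' + 2) ts''"

lemma step_machine:
  assumes "ternary k ts" "q < length P" "(q', as) = perform (P ! q) q (map scan ts)"
  shows "((q, ts), (q', map2 (\<lambda>(t, h) (s, d). (t(h := s), h + shift d)) ts as)) \<in> step (machine k P)"
proof -
  have "set (map scan ts) \<subseteq> {0, 1, 2}" "length ts = k"
    using assms(1) by (auto simp: ternary_def scan_def split_beta image_subset_iff)
  then show ?thesis using assms(2,3) by (auto simp: step_def machine_def scan_def)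
qed

lemma map2_stay:
  "map2 (\<lambda>(t, h) (s, d). (t(h := s), h + shift d)) ts (map (\<lambda>x. (x, Stay)) (map scan ts)) = ts"
  by (induction ts) (auto simp: scan_def)

lemma step_IBr:
  assumes "ternary k ts" "q < length P" "P ! q = IBr i s t t'" "i < k"
  shows "((q, ts), (if scan (ts ! i) = s then t else t', ts)) \<in> step (machine k P)"
  using step_machine[OF assms(1,2), of "if scan (ts ! i) = s then t else t'" "map (\<lambda>x. (x, Stay)) (map scan ts)"]
    assms map2_stay[of ts] by (simp add: ternary_def)

lemma step_IOp:
  assumes "ternary k ts" "q < length P" "P ! q = IOp i s d" "i < k"
  shows "((q, ts), (q + 1, ts[i := write_move s d (ts ! i)])) \<in> step (machine k P)"
proof -
  let ?as = "(map (\<lambda>x. (x, Stay)) (map scan ts))[i := (case s of None \<Rightarrow> map scan ts ! i | Some y \<Rightarrow> y, d)]"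
  let ?f = "\<lambda>(t :: int \<Rightarrow> nat, h) (s, d). (t(h := s), h + shift d)"
  have k: "length ts = k" using assms(1) by (simp add: ternary_def)
  have "map2 ?f ts ?as = ts[i := write_move s d (ts ! i)]"
  proof (rule nth_equalityI)
    fix j assume "j < length (map2 ?f ts ?as)"
    then have j: "j < k" using k by simp
    obtain t h where th: "ts ! j = (t, h)" by fastforce
    show "map2 ?f ts ?as ! j = ts[i := write_move s d (ts ! i)] ! j"
      using j k th assms(4) by (cases "j = i") (auto simp: scan_def split: option.splits)
  qed (use k in simp)
  then show ?thesis
    using step_machine[OF assms(1,2), of "q + 1" ?as] assms(3) by simp
qed

lemma ternary_write_move:
  assumes "ternary k ts" "i < length ts" "set_option s \<subseteq> {0, 1, 2}"
  shows "ternary k (ts[i := write_move s d (ts ! i)])"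
proof -
  obtain t h where th: "ts ! i = (t, h)" by fastforce
  then have "(t, h) \<in> set ts" using assms(2) by (metis nth_mem)
  then have "range t \<subseteq> {0, 1, 2}" using assms(1) unfolding ternary_def by (metis fst_conv)
  then have *: "range (fst (write_move s d (ts ! i))) \<subseteq> {0, 1, 2}"
    using th assms(3) by (auto simp: image_subset_iff split: option.splits)
  show ?thesis unfolding ternary_def
  proof (intro conjI ballI)
    show "length (ts[i := write_move s d (ts ! i)]) = k" using assms by (simp add: ternary_def)
    fix x assume "x \<in> set (ts[i := write_move s d (ts ! i)])"
    then have "x = write_move s d (ts ! i) \<or> x \<in> set ts"
      by (metis insertE set_update_subset_insert subsetD)
    then show "range (fst x) \<subseteq> {0, 1, 2}"
    proof
      assume "x = write_move s d (ts ! i)"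
      then show ?thesis using * by simp
    next
      assume "x \<in> set ts"
      then show ?thesis using assms(1) by (simp add: ternary_def)
    qed
  qed
qed

lemma relpow_trans:
  assumes "(a, b) \<in> R" "(b, c) \<in> R ^^ n" "(c, d) \<in> R ^^ m"
  shows "(a, d) \<in> R ^^ (Suc (n + m))"
  using assms by (metis relpow_Suc_I2 relpow_add relcomp.relcompI)

lemma exec_assemble:
  assumes "exec c ts n ts'" "ternary k ts" "P = xs @ assemble (length xs) c @ ys" "q = length xs" "0 < k"
  shows "((q, ts), (q + csize c, ts')) \<in> step (machine k P) ^^ n \<and> ternary k ts'"
  using assms
proof (induction arbitrary: q xs ys rule: exec.induct)
  case (Skip ts)
  then show ?case by simp
next
  case (Op i ts s d)
  then have "P ! q = IOp i s d" "q < length P" "i < k" by (auto simp: nth_append ternary_def)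
  then show ?case using step_IOp[of k ts q P i s d] ternary_write_move[of k ts i s d] Op by simp
next
  case (Seq a ts n ts' b n' ts'')
  let ?q = "q + csize a"
  have 1: "((q, ts), (?q, ts')) \<in> step (machine k P) ^^ n \<and> ternary k ts'"
    by (rule Seq.IH(1)[where ys = "assemble (q + csize a) b @ ys" and xs = xs]) (use Seq.prems in auto)
  have "((?q, ts'), (?q + csize b, ts'')) \<in> step (machine k P) ^^ n' \<and> ternary k ts''"
    by (rule Seq.IH(2)[where xs = "xs @ assemble q a" and ys = ys]) (use Seq.prems 1 in auto)
  then show ?case using 1 by (auto simp: relpow_add add.assoc)
next
  case (Cond_eq i ts s a n ts' b)
  let ?e = "q + csize a + 2 + csize b"
  have k: "i < k" using Cond_eq.hyps(1) Cond_eq.prems(1) by (simp add: ternary_def)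
  have P: "P ! q = IBr i s (q + 1) (q + csize a + 2)" "q < length P"
    "P ! (q + 1 + csize a) = IBr 0 0 ?e ?e" "q + 1 + csize a < length P"
    using Cond_eq.prems by (auto simp: nth_append)
  have 0: "((q, ts), (q + 1, ts)) \<in> step (machine k P)"
    using step_IBr[OF Cond_eq.prems(1) P(2,1) k] Cond_eq.hyps by simp
  have 1: "((q + 1, ts), (q + 1 + csize a, ts')) \<in> step (machine k P) ^^ n \<and> ternary k ts'"
    by (rule Cond_eq.IH[where xs = "xs @ [IBr i s (q + 1) (q + csize a + 2)]" and
      ys = "IBr 0 0 ?e ?e # assemble (q + csize a + 2) b @ ys"]) (use Cond_eq.prems in auto)
  have "((q + 1 + csize a, ts'), (?e, ts')) \<in> step (machine k P) ^^ 1"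
    using step_IBr[OF conjunct2[OF 1] P(4,3)] Cond_eq.prems by (simp split: if_splits)
  from relpow_trans[OF 0 conjunct1[OF 1] this] 1 show ?case by (simp add: ac_simps)
next
  case (Cond_neq i ts s b n ts' a)
  let ?e = "q + csize a + 2 + csize b"
  have k: "i < k" using Cond_neq.hyps(1) Cond_neq.prems(1) by (simp add: ternary_def)
  have P: "P ! q = IBr i s (q + 1) (q + csize a + 2)" "q < length P"
    using Cond_neq.prems by (auto simp: nth_append)
  have 0: "((q, ts), (q + csize a + 2, ts)) \<in> step (machine k P)"
    using step_IBr[OF Cond_neq.prems(1) P(2,1) k] Cond_neq.hyps by simp
  have 1: "((q + csize a + 2, ts), (?e, ts')) \<in> step (machine k P) ^^ n \<and> ternary k ts'"
    by (rule Cond_neq.IH[where xs = "xs @ IBr i s (q + 1) (q + csize a + 2) # assemble (q + 1) a @ [IBr 0 0 ?e ?e]" and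
      ys = ys]) (use Cond_neq.prems in auto)
  from relpow_trans[OF 0 conjunct1[OF 1], of _ 0] 1 show ?case by (simp add: ac_simps)
next
  case (Until_eq i ts s a)
  have k: "i < k" using Until_eq.hyps(1) Until_eq.prems(1) by (simp add: ternary_def)
  have P: "P ! q = IBr i s (q + csize a + 2) (q + 1)" "q < length P"
    using Until_eq.prems by (auto simp: nth_append)
  show ?case using step_IBr[OF Until_eq.prems(1) P(2,1) k] Until_eq by (simp add: ac_simps)
next
  case (Until_neq i ts s a n ts' n' ts'')
  have k: "i < k" using Until_neq.hyps(1) Until_neq.prems(1) by (simp add: ternary_def)
  have P: "P ! q = IBr i s (q + csize a + 2) (q + 1)" "q < length P"
    "P ! (q + 1 + csize a) = IBr 0 0 q q" "q + 1 + csize a < length P"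
    using Until_neq.prems by (auto simp: nth_append)
  have 0: "((q, ts), (q + 1, ts)) \<in> step (machine k P)"
    using step_IBr[OF Until_neq.prems(1) P(2,1) k] Until_neq.hyps by simp
  have 1: "((q + 1, ts), (q + 1 + csize a, ts')) \<in> step (machine k P) ^^ n \<and> ternary k ts'"
    by (rule Until_neq.IH(1)[where xs = "xs @ [IBr i s (q + csize a + 2) (q + 1)]" and
      ys = "IBr 0 0 q q # ys"]) (use Until_neq.prems in auto)
  have 2: "((q + 1 + csize a, ts'), (q, ts')) \<in> step (machine k P)"
    using step_IBr[OF conjunct2[OF 1] P(4,3)] Until_neq.prems by (simp split: if_splits)
  have 3: "((q, ts'), (q + csize (Until i s a), ts'')) \<in> step (machine k P) ^^ n' \<and> ternary k ts''"
    by (rule Until_neq.IH(2)[where xs = xs and ys = ys]) (use Until_neq.prems 1 in auto)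
  have "((q + 1 + csize a, ts'), (q + csize (Until i s a), ts'')) \<in> step (machine k P) ^^ Suc n'"
    using 2 3 relpow_Suc_I2 by metis
  from relpow_trans[OF 0 conjunct1[OF 1] this] 3 show ?case by (simp add: ac_simps)
qed

definition runs :: "com \<Rightarrow> nat \<Rightarrow> tape list \<Rightarrow> tape list \<Rightarrow> bool" where
  "runs c t ts ts' \<longleftrightarrow> (\<exists>n \<le> t. exec c ts n ts')"

lemma runs_mono: "runs c t ts ts' \<Longrightarrow> t \<le> t' \<Longrightarrow> runs c t' ts ts'"
  by (meson le_trans runs_def)

lemma runs_Skip: "runs Skip 0 ts ts"
  by (auto simp: runs_def intro: exec.Skip)

lemma runs_Seq: "runs a t ts ts' \<Longrightarrow> runs b t' ts' ts'' \<Longrightarrow> runs (Seq a b) (t + t') ts ts''"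
  unfolding runs_def
  by (elim exE conjE, rule exI, rule conjI[rotated], erule (1) exec.Seq, simp)

lemma runs_Cond_eq:
  "i < length ts \<Longrightarrow> scan (ts ! i) = s \<Longrightarrow> runs a t ts ts' \<Longrightarrow> runs (Cond i s a b) (t + 2) ts ts'"
  unfolding runs_def
  by (elim exE conjE, rule exI, rule conjI[rotated], erule (2) exec.Cond_eq, simp)

lemma runs_Cond_neq:
  "i < length ts \<Longrightarrow> scan (ts ! i) \<noteq> s \<Longrightarrow> runs b t ts ts' \<Longrightarrow> runs (Cond i s a b) (t + 1) ts ts'"
  unfolding runs_def
  by (elim exE conjE, rule exI, rule conjI[rotated], erule (2) exec.Cond_neq, simp)

lemma runs_Until_neq:
  assumes "i < length ts" "scan (ts ! i) \<noteq> s" "runs a t ts ts'" "runs (Until i s a) t' ts' ts''"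
  shows "runs (Until i s a) (t + t' + 2) ts ts''"
proof -
  obtain n n' where "n \<le> t" "n' \<le> t'" "exec a ts n ts'" "exec (Until i s a) ts' n' ts''"
    using assms by (auto simp: runs_def)
  then have "exec (Until i s a) ts (n + n' + 2) ts''" "n + n' + 2 \<le> t + t' + 2"
    using assms exec.Until_neq by auto
  then show ?thesis unfolding runs_def by blast
qed

lemma runs_Until_eq: "i < length ts \<Longrightarrow> scan (ts ! i) = s \<Longrightarrow> runs (Until i s a) 1 ts ts"
  unfolding runs_def using exec.Until_eq by blast

lemma runs_Until:
  assumes "\<And>j. j < n \<Longrightarrow> scan (S j ! i) \<noteq> s \<and> runs a t (S j) (S (Suc j))"
    and "scan (S n ! i) = s" and "\<And>j. i < length (S j)"
  shows "runs (Until i s a) (n * (t + 2) + 1) (S 0) (S n)"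
proof -
  have "runs (Until i s a) ((n - m) * (t + 2) + 1) (S m) (S n)" if "m \<le> n" for m
    using that
  proof (induction m rule: inc_induct)
    case base
    then show ?case using runs_Until_eq[of i "S n" s a] assms by simp
  next
    case (step m)
    have "runs (Until i s a) (t + ((n - Suc m) * (t + 2) + 1) + 2) (S m) (S n)"
      by (rule runs_Until_neq) (use assms step in auto)
    moreover obtain r where "n = m + Suc r" using step.hyps(2) less_imp_Suc_add by auto
    then have "t + ((n - Suc m) * (t + 2) + 1) + 2 = (n - m) * (t + 2) + 1" by simp
    ultimately show ?case by simp
  qed
  from this[of 0] show ?thesis by simp
qed

text \<open>A counter is the head position on a tape whose only mark is at position 0.\<close>

definition tapes :: "nat \<Rightarrow> bool list \<Rightarrow> int \<Rightarrow> (nat \<Rightarrow> nat) \<Rightarrow> bool list \<Rightarrow> tape list" where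
  "tapes k w h f out = (word_tape w, h) # map (\<lambda>i. (word_tape [False], int (f i))) [0..<k] @
     [(word_tape out, int (length out))]"

lemma length_tapes [simp]: "length (tapes k w h f out) = k + 2"
  by (simp add: tapes_def)

lemma nth_tapes:
  "tapes k w h f out ! 0 = (word_tape w, h)"
  "i < k \<Longrightarrow> tapes k w h f out ! Suc i = (word_tape [False], int (f i))"
  "tapes k w h f out ! Suc k = (word_tape out, int (length out))"
  by (auto simp: tapes_def nth_append)

lemma scan_input [simp]: "scan (tapes k w h f out ! 0) = word_tape w h"
  by (simp add: scan_def nth_tapes)

lemma scan_counter [simp]: "i < k \<Longrightarrow> scan (tapes k w h f out ! Suc i) = Suc 0 \<longleftrightarrow> f i = 0"
  by (simp add: scan_def nth_tapes word_tape_def)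

section \<open>Commands on counters\<close>

abbreviation Inc :: "nat \<Rightarrow> com" where
  "Inc i \<equiv> Op (Suc i) None Go_Right"

abbreviation Dec :: "nat \<Rightarrow> com" where
  "Dec i \<equiv> Op (Suc i) None Go_Left"

abbreviation Out :: "nat \<Rightarrow> bool \<Rightarrow> com" where
  "Out k b \<equiv> Op (Suc k) (Some (if b then 2 else 1)) Go_Right"

text \<open>Symbol 1 marks position 0, so the loop stops when counter \<open>i\<close> is 0. Since
  it is lowered before the body, the body sees the number of rounds still to come.\<close>

abbreviation Repeat :: "nat \<Rightarrow> com \<Rightarrow> com" where
  "Repeat i c \<equiv> Until (Suc i) (Suc 0) (Seq (Dec i) c)"

lemma runs_Op:
  "i < length ts \<Longrightarrow> set_option s \<subseteq> {0, 1, 2} \<Longrightarrow> ts' = ts[i := write_move s d (ts ! i)] \<Longrightarrow> runs (Op i s d) 1 ts ts'"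
  unfolding runs_def using exec.Op by blast

lemma tapes_update:
  assumes "i < k"
  shows "(tapes k w h f out)[Suc i := (word_tape [False], int v)] = tapes k w h (f(i := v)) out"
proof -
  have "(map (\<lambda>i. (word_tape [False], int (f i))) [0..<k])[i := (word_tape [False], int v)] =
      map (\<lambda>j. (word_tape [False], int ((f(i := v)) j))) [0..<k]"
    using assms by (intro nth_equalityI) (simp_all add: nth_list_update)
  then show ?thesis using assms by (simp add: tapes_def list_update_append)
qed

lemma runs_Inc: "i < k \<Longrightarrow> runs (Inc i) 1 (tapes k w h f out) (tapes k w h (f(i := Suc (f i))) out)"
  by (rule runs_Op) (simp_all add: nth_tapes tapes_update[symmetric] add.commute)

lemma runs_Dec:
  "i < k \<Longrightarrow> 0 < f i \<Longrightarrow> runs (Dec i) 1 (tapes k w h f out) (tapes k w h (f(i := f i - 1)) out)"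
  by (rule runs_Op) (simp_all add: nth_tapes tapes_update[symmetric] of_nat_diff)

lemma runs_In:
  "runs (Op 0 None d) 1 (tapes k w h f out) (tapes k w (h + shift d) f out)"
  by (rule runs_Op) (auto simp: tapes_def)

lemma word_tape_snoc: "(word_tape out)(int (length out) := if b then 2 else 1) = word_tape (out @ [b])"
  by (auto simp: fun_eq_iff word_tape_def nth_append)

lemma runs_Out: "runs (Out k b) 1 (tapes k w h f out) (tapes k w h f (out @ [b]))"
    by (rule runs_Op) (simp, simp, simp only: nth_tapes, simp add: word_tape_snoc[symmetric] tapes_def list_update_append)

lemma runs_Repeat:
  assumes "i < k"
    and "\<And>j. j < n \<Longrightarrow> f j i = n - j \<and> runs c t (tapes k w (h j) ((f j)(i := n - Suc j)) (out j))
           (tapes k w (h (Suc j)) (f (Suc j)) (out (Suc j)))"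
    and "f n i = 0"
  shows "runs (Repeat i c) (n * (t + 3) + 1) (tapes k w (h 0) (f 0) (out 0)) (tapes k w (h n) (f n) (out n))"
proof -
  let ?S = "\<lambda>j. tapes k w (h j) (f j) (out j)"
  have "scan (?S j ! Suc i) \<noteq> Suc 0 \<and> runs (Seq (Dec i) c) (t + 1) (?S j) (?S (Suc j))" if "j < n" for j
  proof -
    have f: "f j i = n - j" using assms(2)[OF that] by simp
    then have "runs (Dec i) 1 (?S j) (tapes k w (h j) ((f j)(i := n - Suc j)) (out j))"
      using runs_Dec[of i k "f j" w "h j" "out j"] that assms(1) by simp
    from runs_Seq[OF this conjunct2[OF assms(2)[OF that]]] show ?thesis using f that assms(1) by simp
  qed
  from runs_Until[of n ?S "Suc i" "Suc 0" "Seq (Dec i) c" "t + 1", OF this] show ?thesis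
    using assms by (simp add: ac_simps eval_nat_numeral)
qed

definition Clear :: "nat \<Rightarrow> com" where
  "Clear i = Repeat i Skip"

lemma runs_Clear:
  assumes "i < k"
  shows "runs (Clear i) (3 * f i + 1) (tapes k w h f out) (tapes k w h (f(i := 0)) out)"
proof -
  have "runs (Repeat i Skip) (f i * (0 + 3) + 1) (tapes k w h (f(i := f i - 0)) out)
      (tapes k w h (f(i := f i - f i)) out)"
    by (rule runs_Repeat[where h = "\<lambda>_. h" and out = "\<lambda>_. out" and f = "\<lambda>j. f(i := f i - j)"])
      (use assms runs_Skip in auto)
  then show ?thesis by (simp add: Clear_def mult.commute)
qed

text \<open>A head position can be read only by counting it down, so the scratch counter
  \<open>s\<close> keeps the value and gives it back. The value is added to \<open>t\<close> rather
  than assigned, so that repeated copying multiplies.\<close>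

definition Copy :: "nat \<Rightarrow> nat \<Rightarrow> nat \<Rightarrow> com" where
  "Copy i t s = Seq (Repeat i (Seq (Inc s) (Inc t))) (Repeat s (Inc i))"

lemma runs_Copy:
  assumes "i < k" "t < k" "s < k" "i \<noteq> t" "i \<noteq> s" "s \<noteq> t" "f s = 0"
  shows "runs (Copy i t s) (9 * f i + 2) (tapes k w h f out) (tapes k w h (f(t := f t + f i)) out)"
proof -
  let ?g = "\<lambda>j. f(i := f i - j, s := j, t := f t + j)"
  let ?T = "\<lambda>f. tapes k w h f out"
  have "runs (Repeat i (Seq (Inc s) (Inc t))) (f i * (2 + 3) + 1) (?T (?g 0)) (?T (?g (f i)))"
  proof (rule runs_Repeat[where h = "\<lambda>_. h" and out = "\<lambda>_. out" and f = ?g], goal_cases)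
    case (2 j)
    have "runs (Seq (Inc s) (Inc t)) (1 + 1) (?T ((?g j)(i := f i - Suc j))) (?T (?g (Suc j)))"
    proof (rule runs_Seq)
      show "runs (Inc s) 1 (?T ((?g j)(i := f i - Suc j))) (?T ((?g j)(i := f i - Suc j, s := Suc j)))"
        using runs_Inc[of s k w h "(?g j)(i := f i - Suc j)" out] assms by simp
      have "((?g j)(i := f i - Suc j, s := Suc j))(t := Suc (f t + j)) = ?g (Suc j)"
        using assms by auto
      then show "runs (Inc t) 1 (?T ((?g j)(i := f i - Suc j, s := Suc j))) (?T (?g (Suc j)))"
        using runs_Inc[of t k w h "(?g j)(i := f i - Suc j, s := Suc j)" out] assms by simp
    qed
    then show ?case using assms 2 by (simp add: numeral_2_eq_2)
  qed (use assms in auto)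
  moreover have "?g 0 = f" using assms by auto
  ultimately have 1: "runs (Repeat i (Seq (Inc s) (Inc t))) (f i * (2 + 3) + 1) (?T f) (?T (?g (f i)))" by simp
  let ?g' = "\<lambda>j. f(i := j, s := f i - j, t := f t + f i)"
  have "runs (Repeat s (Inc i)) (f i * (1 + 3) + 1) (?T (?g' 0)) (?T (?g' (f i)))"
  proof (rule runs_Repeat[where h = "\<lambda>_. h" and out = "\<lambda>_. out" and f = ?g'], goal_cases)
    case (2 j)
    have "(?g' j)(s := f i - Suc j, i := Suc j) = ?g' (Suc j)" using assms by auto
    then show ?case using runs_Inc[of i k w h "(?g' j)(s := f i - Suc j)" out] assms by simp
  qed (use assms in auto)
  moreover have "?g' 0 = ?g (f i)" "?g' (f i) = f(t := f t + f i)" using assms by auto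
  ultimately have 2: "runs (Repeat s (Inc i)) (f i * (1 + 3) + 1) (?T (?g (f i))) (?T (f(t := f t + f i)))" by simp
  show ?thesis unfolding Copy_def using runs_Seq[OF 1 2] by (simp add: ac_simps)
qed

fun Outs :: "nat \<Rightarrow> bool list \<Rightarrow> com" where
  "Outs k [] = Skip"
| "Outs k (b # bs) = Seq (Out k b) (Outs k bs)"

lemma runs_Outs: "runs (Outs k bs) (length bs) (tapes k w h f out) (tapes k w h f (out @ bs))"
proof (induction bs arbitrary: out)
  case Nil
  then show ?case using runs_Skip by simp
next
  case (Cons b bs)
  from runs_Seq[OF runs_Out Cons.IH] show ?case by simp
qed

fun Incs :: "nat \<Rightarrow> nat \<Rightarrow> com" where
  "Incs i 0 = Skip"
| "Incs i (Suc n) = Seq (Inc i) (Incs i n)"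

lemma runs_Incs: "i < k \<Longrightarrow> runs (Incs i n) n (tapes k w h f out) (tapes k w h (f(i := f i + n)) out)"
proof (induction n arbitrary: f)
  case 0
  then show ?case using runs_Skip by simp
next
  case (Suc n)
  from runs_Seq[OF runs_Inc[OF Suc.prems, of w h f out] Suc.IH[OF Suc.prems, of "f(i := Suc (f i))"]]
  show ?case by (simp del: fun_upd_apply add: fun_upd_same)
qed

section \<open>A loop language with polynomial running time\<close>

text \<open>Variables are bound once and addressed by their place in the environment. Loop counts
  are fixed on entry and values grow only through \<open>Bind\<close>, so programs take polynomial
  time by construction. \<open>For\<close> binds the index and the number of remaining rounds, which
  supplies differences without subtraction.\<close>

datatype prog =
    Emit "bool list"
  | Then prog prog
  | For nat prog
  | IfZero nat prog prog
  | EmitIn nat "bool list" "bool list" "bool list"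
  | Bind nat nat nat prog
  | Bin nat

fun printed :: "bool list \<Rightarrow> prog \<Rightarrow> nat list \<Rightarrow> bool list" where
  "printed w (Emit s) env = s"
| "printed w (Then p q) env = printed w p env @ printed w q env"
| "printed w (For i p) env =
     concat (map (\<lambda>x. printed w p (env @ [x, env ! i - Suc x])) [0..<env ! i])"
| "printed w (IfZero i p q) env = (if env ! i = 0 then printed w p env else printed w q env)"
| "printed w (EmitIn i a b c) env = (let s = word_tape w (int (env ! i)) in
     if s = 0 then a else if s = 1 then b else c)"
| "printed w (Bind i j n p) env = printed w p (env @ [env ! i * env ! j + n])"
| "printed w (Bin i) env = enc_nat (env ! i)"

fun scoped :: "nat \<Rightarrow> prog \<Rightarrow> bool" where
  "scoped d (Emit s) \<longleftrightarrow> True"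
| "scoped d (Then p q) \<longleftrightarrow> scoped d p \<and> scoped d q"
| "scoped d (For i p) \<longleftrightarrow> i < d \<and> scoped (d + 2) p"
| "scoped d (IfZero i p q) \<longleftrightarrow> i < d \<and> scoped d p \<and> scoped d q"
| "scoped d (EmitIn i a b c) \<longleftrightarrow> i < d"
| "scoped d (Bind i j n p) \<longleftrightarrow> i < d \<and> j < d \<and> scoped (d + 1) p"
| "scoped d (Bin i) \<longleftrightarrow> i < d"

fun width :: "nat \<Rightarrow> prog \<Rightarrow> nat" where
  "width d (Emit s) = d"
| "width d (Then p q) = max (width d p) (width d q)"
| "width d (For i p) = max (d + 3) (width (d + 2) p)"
| "width d (IfZero i p q) = max (width d p) (width d q)"
| "width d (EmitIn i a b c) = d + 3"
| "width d (Bind i j n p) = max (d + 3) (width (d + 1) p)"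
| "width d (Bin i) = d + 3"

text \<open>Counters from \<open>d\<close> on hold newly bound values and scratch.
  \<open>Bind\<close> multiplies by repeated copying, \<open>EmitIn\<close> walks the input head to
  a position and back, and \<open>Bin\<close> prints bits by repeated halving.\<close>

fun translate :: "nat \<Rightarrow> nat \<Rightarrow> prog \<Rightarrow> com" where
  "translate k d (Emit s) = Outs k s"
| "translate k d (Then p q) = Seq (translate k d p) (translate k d q)"
| "translate k d (For i p) = Seq (Copy i (d + 1) d)
     (Seq (Repeat (d + 1) (Seq (translate k (d + 2) p) (Inc d))) (Clear d))"
| "translate k d (IfZero i p q) = Cond (Suc i) (Suc 0) (translate k d p) (translate k d q)"
| "translate k d (EmitIn i a b c) = Seq (Copy i d (d + 1))
     (Seq (Repeat d (Seq (Inc (d + 1)) (Op 0 None Go_Right)))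
       (Seq (Cond 0 0 (Outs k a) (Cond 0 1 (Outs k b) (Outs k c)))
         (Repeat (d + 1) (Op 0 None Go_Left))))"
| "translate k d (Bind i j n p) = Seq (Copy i (d + 1) (d + 2))
     (Seq (Repeat (d + 1) (Copy j d (d + 2)))
       (Seq (Incs d n) (Seq (translate k (d + 1) p) (Clear d))))"
| "translate k d (Bin i) = Seq (Copy i d (d + 1))
     (Seq (Until (Suc d) (Suc 0)
         (Seq (Repeat d (Cond (Suc d) (Suc 0) (Inc (d + 2)) (Seq (Dec d) (Inc (d + 1)))))
           (Seq (Out k True)
             (Seq (Cond (Suc (d + 2)) (Suc 0) (Out k False) (Seq (Dec (d + 2)) (Out k True)))
               (Repeat (d + 1) (Inc d))))))
       (Out k False))"

text \<open>\<open>poly (cost p) B\<close> bounds the running time when all variables in scope are at most \<open>B\<close>.\<close>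

fun cost :: "prog \<Rightarrow> nat poly" where
  "cost (Emit s) = [:length s:]"
| "cost (Then p q) = cost p + cost q"
| "cost (For i p) = [:0, 1:] * cost p + [:4, 16:]"
| "cost (IfZero i p q) = cost p + cost q + 2"
| "cost (EmitIn i a b c) = [:length a + length b + length c + 10, 20:]"
| "cost (Bind i j n p) = [:4 * n + 5, 14, 12:] + pcompose (cost p) [:n, 1, 1:]"
| "cost (Bin i) = [:6, 21, 11:]"

text \<open>Counters outside the environment are 0, the invariant that makes them usable as
  scratch.\<close>

definition counters :: "nat list \<Rightarrow> nat \<Rightarrow> nat" where
  "counters env = (\<lambda>i. if i < length env then env ! i else 0)"

lemma counters_nth [simp]: "i < length env \<Longrightarrow> counters env i = env ! i"
  by (simp add: counters_def)

lemma counters_outside [simp]: "length env \<le> i \<Longrightarrow> counters env i = 0"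
  by (simp add: counters_def)

lemma counters_snoc: "counters (env @ [x]) = (counters env)(length env := x)"
  by (auto simp: counters_def nth_append fun_eq_iff)

lemma counters_snoc2: "counters (env @ [x, y]) = (counters env)(length env := x, Suc (length env) := y)"
  using counters_snoc[of "env @ [x]" y] by (simp add: counters_snoc)

lemma enc_nat_0 [simp]: "enc_nat 0 = [False]"
  by (simp add: enc_nat_def floorlog_def)

lemma enc_nat_rec: "0 < n \<Longrightarrow> enc_nat n = True # odd n # enc_nat (n div 2)"
proof -
  assume n: "0 < n"
  have "floorlog 2 n = Suc (floorlog 2 (n div 2))"
    using n compute_floorlog[of 2 n] by simp
  moreover have "[0..<Suc m] = 0 # map Suc [0..<m]" for m
    by (metis map_Suc_upt upt_conv_Cons zero_less_Suc)
  ultimately show ?thesis by (simp add: enc_nat_def comp_def bit_Suc bit_0)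
qed

text \<open>\<open>Repeat\<close> removes one unit and the body a second one, adding 1 to the half;
  if no second unit is left, the body records remainder 1 instead.\<close>

lemma runs_halve:
  assumes "d + 2 < k" "f d = v" "f (d + 1) = 0" "f (d + 2) = 0"
  shows "runs (Repeat d (Cond (Suc d) (Suc 0) (Inc (d + 2)) (Seq (Dec d) (Inc (d + 1))))) (7 * v + 1)
    (tapes k w h f out) (tapes k w h (f(d := 0, d + 1 := v div 2, d + 2 := v mod 2)) out)"
proof -
  let ?c = "Cond (Suc d) (Suc 0) (Inc (d + 2)) (Seq (Dec d) (Inc (d + 1)))"
  have "runs (Repeat d ?c) (7 * v + 1) (tapes k w h (f(d := v, d + 1 := y)) out)
      (tapes k w h (f(d := 0, d + 1 := y + v div 2, d + 2 := v mod 2)) out)" for v y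
  proof (induction v arbitrary: y rule: less_induct)
    case (less v)
    let ?T = "\<lambda>f. tapes k w h f out"
    let ?f = "f(d := v, d + 1 := y)"
    consider "v = 0" | "v = 1" | "2 \<le> v" by linarith
    then show ?case
    proof cases
      case 1
      have eq: "f(d := 0, d + 1 := y + v div 2, d + 2 := v mod 2) = ?f"
        using 1 assms by (auto simp: fun_eq_iff)
      have "runs (Repeat d ?c) 1 (?T ?f) (?T ?f)"
        by (rule runs_Until_eq) (use assms 1 in auto)
      then show ?thesis unfolding eq by (rule runs_mono) simp
    next
      case 2
      have d: "runs (Dec d) 1 (?T ?f) (?T (?f(d := 0)))"
        using runs_Dec[of d k ?f w h out] assms 2 by simp
      have i: "runs (Inc (d + 2)) 1 (?T (?f(d := 0))) (?T (?f(d := 0, d + 2 := 1)))"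
        using runs_Inc[of "d + 2" k w h "?f(d := 0)" out] assms by simp
      have c: "runs ?c (1 + 2) (?T (?f(d := 0))) (?T (?f(d := 0, d + 2 := 1)))"
        by (rule runs_Cond_eq[OF _ _ i]) (use assms in auto)
      have u: "runs (Repeat d ?c) 1 (?T (?f(d := 0, d + 2 := 1))) (?T (?f(d := 0, d + 2 := 1)))"
        by (rule runs_Until_eq) (use assms in auto)
      have r: "runs (Repeat d ?c) (1 + (1 + 2) + 1 + 2) (?T ?f) (?T (?f(d := 0, d + 2 := 1)))"
        by (rule runs_Until_neq[OF _ _ runs_Seq[OF d c] u]) (use assms 2 in auto)
      have eq: "f(d := 0, d + 1 := y + v div 2, d + 2 := v mod 2) = ?f(d := 0, d + 2 := 1)"
        using 2 by (auto simp: fun_eq_iff)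
      show ?thesis unfolding eq by (rule runs_mono[OF r]) (use 2 in simp)
    next
      case 3
      have d: "runs (Dec d) 1 (?T ?f) (?T (?f(d := v - 1)))"
        using runs_Dec[of d k ?f w h out] assms 3 by simp
      have d': "runs (Dec d) 1 (?T (?f(d := v - 1))) (?T (?f(d := v - 2)))"
        using runs_Dec[of d k "?f(d := v - 1)" w h out] assms 3 by (simp add: numeral_2_eq_2)
      have eq: "?f(d := v - 2, d + 1 := Suc y) = f(d := v - 2, d + 1 := Suc y)"
        by (auto simp: fun_eq_iff)
      have i: "runs (Inc (d + 1)) 1 (?T (?f(d := v - 2))) (?T (f(d := v - 2, d + 1 := Suc y)))"
        using runs_Inc[of "d + 1" k w h "?f(d := v - 2)" out] assms eq by simp
      have c: "runs ?c (1 + 1 + 1) (?T (?f(d := v - 1))) (?T (f(d := v - 2, d + 1 := Suc y)))"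
        by (rule runs_Cond_neq[OF _ _ runs_Seq[OF d' i]]) (use assms 3 in auto)
      have "runs (Repeat d ?c) (7 * (v - 2) + 1) (?T (f(d := v - 2, d + 1 := Suc y)))
          (?T (f(d := 0, d + 1 := Suc y + (v - 2) div 2, d + 2 := (v - 2) mod 2)))"
        by (rule less) (use 3 in simp)
      from runs_Until_neq[OF _ _ runs_Seq[OF d c] this]
      have r: "runs (Repeat d ?c) (1 + (1 + 1 + 1) + (7 * (v - 2) + 1) + 2) (?T ?f)
          (?T (f(d := 0, d + 1 := Suc y + (v - 2) div 2, d + 2 := (v - 2) mod 2)))"
        using assms 3 by simp
      have eq: "Suc y + (v - 2) div 2 = y + v div 2" "(v - 2) mod 2 = v mod 2"
        using 3 by (auto simp: le_div_geq le_mod_geq)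
      show ?thesis by (rule runs_mono[OF r[unfolded eq]]) (use 3 in simp)
    qed
  qed
  from this[of v 0] show ?thesis
    using assms by (simp add: fun_upd_idem)
qed

text \<open>The bound is crude: at most \<open>v\<close> halvings of linear cost. The final
  \<open>False\<close> of the code is printed after the loop, hence the prefix \<open>s\<close> in
  the induction.\<close>

lemma runs_Bin_loop:
  assumes "d + 2 < k" "f d = 0" "f (d + 1) = 0" "f (d + 2) = 0"
  defines "c \<equiv> Seq (Repeat d (Cond (Suc d) (Suc 0) (Inc (d + 2)) (Seq (Dec d) (Inc (d + 1)))))
    (Seq (Out k True)
      (Seq (Cond (Suc (d + 2)) (Suc 0) (Out k False) (Seq (Dec (d + 2)) (Out k True)))
        (Repeat (d + 1) (Inc d))))"
  shows "runs (Seq (Until (Suc d) (Suc 0) c) (Out k False)) (v * (11 * v + 12) + 3)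
    (tapes k w h (f(d := v)) out) (tapes k w h f (out @ enc_nat v))"
proof -
  have "\<exists>s. enc_nat v = s @ [False] \<and> runs (Until (Suc d) (Suc 0) c) (v * (11 * v + 12) + 2)
    (tapes k w h (f(d := v)) out) (tapes k w h f (out @ s))" for v
  proof (induction v arbitrary: out rule: less_induct)
    case (less v)
    show ?case
    proof (cases "v = 0")
      case True
      have "runs (Until (Suc d) (Suc 0) c) 2 (tapes k w h f out) (tapes k w h f out)"
        by (rule runs_mono[OF runs_Until_eq]) (use assms in auto)
      then show ?thesis using True assms(2) by (simp add: fun_upd_idem numeral_2_eq_2)
    next
      case False
      let ?f = "f(d + 1 := v div 2)"
      let ?o = "out @ [True]"
      have upd: "f(d := v, d := 0, d + 1 := v div 2, d + 2 := v mod 2) = ?f(d + 2 := v mod 2)"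
        using assms by (auto simp: fun_eq_iff)
      have 1: "runs (Repeat d (Cond (Suc d) (Suc 0) (Inc (d + 2)) (Seq (Dec d) (Inc (d + 1))))) (7 * v + 1)
        (tapes k w h (f(d := v)) out) (tapes k w h (?f(d + 2 := v mod 2)) out)"
        using runs_halve[of d k "f(d := v)" v w h out] assms upd by simp
      have 2: "runs (Out k True) 1 (tapes k w h (?f(d + 2 := v mod 2)) out) (tapes k w h (?f(d + 2 := v mod 2)) ?o)"
        by (rule runs_Out)
      have 3: "runs (Cond (Suc (d + 2)) (Suc 0) (Out k False) (Seq (Dec (d + 2)) (Out k True))) 3
        (tapes k w h (?f(d + 2 := v mod 2)) ?o) (tapes k w h ?f (?o @ [odd v]))"
      proof (cases "odd v")
        case True
        have "?f(d + 2 := 0) = ?f" using assms by (auto simp: fun_eq_iff)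
        then have "runs (Dec (d + 2)) 1 (tapes k w h (?f(d + 2 := v mod 2)) ?o) (tapes k w h ?f ?o)"
          using runs_Dec[of "d + 2" k "?f(d + 2 := v mod 2)" w h ?o] assms True
          by (simp add: odd_iff_mod_2_eq_one)
        from runs_Seq[OF this runs_Out[of k True]]
        have r: "runs (Seq (Dec (d + 2)) (Out k True)) (1 + 1) (tapes k w h (?f(d + 2 := v mod 2)) ?o)
          (tapes k w h ?f (?o @ [odd v]))" using True by simp
        show ?thesis
          by (rule runs_mono[OF runs_Cond_neq[OF _ _ r]])
            (use assms(1) True in \<open>auto simp: odd_iff_mod_2_eq_one\<close>)
      next
        case False
        then have "?f(d + 2 := v mod 2) = ?f" using assms by (auto simp: fun_eq_iff)
        then have r: "runs (Out k False) 1 (tapes k w h (?f(d + 2 := v mod 2)) ?o) (tapes k w h ?f (?o @ [odd v]))"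
          using False runs_Out[of k False w h ?f ?o] by simp
        show ?thesis
          by (rule runs_mono[OF runs_Cond_eq[OF _ _ r]]) (use assms(1) False in auto)
      qed
      have 4: "runs (Repeat (d + 1) (Inc d)) ((v div 2) * (1 + 3) + 1)
        (tapes k w h ?f (?o @ [odd v])) (tapes k w h (f(d := v div 2)) (?o @ [odd v]))"
      proof -
        let ?g = "\<lambda>j. f(d := j, d + 1 := v div 2 - j)"
        have "runs (Repeat (d + 1) (Inc d)) ((v div 2) * (1 + 3) + 1)
          (tapes k w h (?g 0) (?o @ [odd v])) (tapes k w h (?g (v div 2)) (?o @ [odd v]))"
        proof (rule runs_Repeat[where f = ?g and h = "\<lambda>_. h" and out = "\<lambda>_. ?o @ [odd v]"], goal_cases)
          case (2 j)
          have "(?g j)(d + 1 := v div 2 - Suc j, d := Suc j) = ?g (Suc j)" by (auto simp: fun_eq_iff)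
          then show ?case
            using runs_Inc[of d k w h "(?g j)(d + 1 := v div 2 - Suc j)" "?o @ [odd v]"] assms by simp
        qed (use assms in auto)
        moreover have "?g 0 = ?f" "?g (v div 2) = f(d := v div 2)" using assms by (auto simp: fun_eq_iff)
        ultimately show ?thesis by simp
      qed
      have body: "runs c (7 * v + 1 + (1 + (3 + ((v div 2) * (1 + 3) + 1))))
        (tapes k w h (f(d := v)) out) (tapes k w h (f(d := v div 2)) (?o @ [odd v]))"
        unfolding c_def by (rule runs_Seq[OF 1 runs_Seq[OF 2 runs_Seq[OF 3 4]]])
      have "v div 2 < v" using False by simp
      from less[OF this, of "?o @ [odd v]"] obtain s where s: "enc_nat (v div 2) = s @ [False]"
        "runs (Until (Suc d) (Suc 0) c) (v div 2 * (11 * (v div 2) + 12) + 2)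
           (tapes k w h (f(d := v div 2)) (?o @ [odd v])) (tapes k w h f ((?o @ [odd v]) @ s))"
        by blast
      let ?t = "7 * v + 1 + (1 + (3 + ((v div 2) * (1 + 3) + 1))) + (v div 2 * (11 * (v div 2) + 12) + 2) + 2"
      have r: "runs (Until (Suc d) (Suc 0) c) ?t (tapes k w h (f(d := v)) out) (tapes k w h f ((?o @ [odd v]) @ s))"
        by (rule runs_Until_neq[OF _ _ body s(2)]) (use assms(1) False in auto)
      have le: "?t \<le> v * (11 * v + 12) + 2"
      proof -
        obtain u where u: "v = Suc u" using False by (cases v) auto
        then have le: "v div 2 \<le> u" by simp
        have "v div 2 * (11 * (v div 2) + 12) \<le> u * (11 * v + 12)"
          by (rule mult_le_mono[OF le]) (use le u in simp)
        moreover have "v * (11 * v + 12) = u * (11 * v + 12) + (11 * v + 12)" using u by simp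
        moreover have "(v div 2) * (1 + 3) \<le> 2 * v" by simp
        moreover have "1 \<le> v" using u by simp
        ultimately show ?thesis by linarith
      qed
      have "runs (Until (Suc d) (Suc 0) c) (v * (11 * v + 12) + 2)
          (tapes k w h (f(d := v)) out) (tapes k w h f (out @ True # odd v # s))"
        using runs_mono[OF r le] by simp
      moreover have "enc_nat v = (True # odd v # s) @ [False]" using enc_nat_rec[of v] False s(1) by simp
      ultimately show ?thesis by blast
    qed
  qed
  then obtain s where s: "enc_nat v = s @ [False]" "runs (Until (Suc d) (Suc 0) c) (v * (11 * v + 12) + 2)
    (tapes k w h (f(d := v)) out) (tapes k w h f (out @ s))" by blast
  show ?thesis using runs_Seq[OF s(2) runs_Out[of k False]] s(1) by (simp add: numeral_3_eq_3)
qed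

section \<open>Correctness and running time of the translation\<close>

lemma le_width: "d \<le> width d p"
  by (induction p arbitrary: d) (auto simp: le_max_iff_disj intro: order_trans[rotated])

text \<open>Restoring the counters and the input head lets programs be composed and iterated.
  \<open>B\<close> is arbitrary in the induction because \<open>Bind\<close> passes to
  \<open>B * B + B + n\<close>, the substitution made by \<open>pcompose\<close> in
  \<open>cost\<close>.\<close>

lemma runs_translate:
  assumes "scoped (length env) p" "width (length env) p \<le> k" "\<forall>x\<in>set env. x \<le> B"
  shows "runs (translate k (length env) p) (poly (cost p) B)
    (tapes k w 0 (counters env) out) (tapes k w 0 (counters env) (out @ printed w p env))"
  using assms
proof (induction p arbitrary: env B out)
  case (Emit s)
  then show ?case using runs_Outs by simp
next
  case (Then p q)
  have "runs (translate k (length env) p) (poly (cost p) B)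
      (tapes k w 0 (counters env) out) (tapes k w 0 (counters env) (out @ printed w p env))"
    by (rule Then.IH(1)) (use Then.prems in auto)
  moreover have "runs (translate k (length env) q) (poly (cost q) B)
      (tapes k w 0 (counters env) (out @ printed w p env))
      (tapes k w 0 (counters env) ((out @ printed w p env) @ printed w q env))"
    by (rule Then.IH(2)) (use Then.prems in auto)
  ultimately show ?case using runs_Seq by fastforce
next
  case (For i p)
  let ?d = "length env" and ?f = "counters env" and ?N = "env ! i" and ?c = "poly (cost p) B"
  let ?o = "\<lambda>x. printed w p (env @ [x, ?N - Suc x])"
  let ?O = "\<lambda>x. out @ concat (map ?o [0..<x])"
  let ?g = "\<lambda>x. ?f(?d := x, ?d + 1 := ?N - x)"
  have i: "i < ?d" and k: "?d + 2 < k" and N: "?N \<le> B" using For.prems by auto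
  have "?f(?d + 1 := ?f (?d + 1) + ?f i) = ?g 0" using i by (auto simp: fun_eq_iff)
  then have 1: "runs (Copy i (?d + 1) ?d) (9 * ?N + 2) (tapes k w 0 ?f out) (tapes k w 0 (?g 0) (?O 0))"
    using runs_Copy[of i k "?d + 1" ?d ?f w 0 out] i k by simp
  have 2: "runs (Repeat (?d + 1) (Seq (translate k (?d + 2) p) (Inc ?d))) (?N * (?c + 1 + 3) + 1)
      (tapes k w 0 (?g 0) (?O 0)) (tapes k w 0 (?g ?N) (?O ?N))"
  proof (rule runs_Repeat[where f = ?g and h = "\<lambda>_. 0" and out = ?O], goal_cases)
    case (2 x)
    have le: "x \<le> B" "?N - Suc x \<le> B" using N 2 by linarith+
    have eq: "(?g x)(?d + 1 := ?N - Suc x) = counters (env @ [x, ?N - Suc x])"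
      by (simp add: counters_snoc2)
    have "runs (translate k (length (env @ [x, ?N - Suc x])) p) ?c
        (tapes k w 0 (counters (env @ [x, ?N - Suc x])) (?O x))
        (tapes k w 0 (counters (env @ [x, ?N - Suc x])) (?O x @ ?o x))"
      by (rule For.IH) (use For.prems le in auto)
    then have t: "runs (translate k (?d + 2) p) ?c (tapes k w 0 ((?g x)(?d + 1 := ?N - Suc x)) (?O x))
        (tapes k w 0 ((?g x)(?d + 1 := ?N - Suc x)) (?O (Suc x)))"
      unfolding eq by simp
    have "(?g x)(?d + 1 := ?N - Suc x, ?d := Suc x) = ?g (Suc x)" by (auto simp: fun_eq_iff)
    then have "runs (Inc ?d) 1 (tapes k w 0 ((?g x)(?d + 1 := ?N - Suc x)) (?O (Suc x)))
        (tapes k w 0 (?g (Suc x)) (?O (Suc x)))"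
      using runs_Inc[of ?d k w 0 "(?g x)(?d + 1 := ?N - Suc x)" "?O (Suc x)"] k by simp
    from runs_Seq[OF t this] show ?case by simp
  qed (use k in auto)
  have "(?g ?N)(?d := 0) = ?f" by (auto simp: fun_eq_iff)
  then have 3: "runs (Clear ?d) (3 * ?N + 1) (tapes k w 0 (?g ?N) (?O ?N)) (tapes k w 0 ?f (?O ?N))"
    using runs_Clear[of ?d k "?g ?N" w 0 "?O ?N"] k by simp
  have le: "9 * ?N + 2 + (?N * (?c + 1 + 3) + 1 + (3 * ?N + 1)) \<le> poly (cost (For i p)) B"
    using add_mono[OF mult_le_mono1[OF N, of ?c] mult_le_mono1[OF N, of 16]] by (simp add: algebra_simps)
  show ?case using runs_mono[OF runs_Seq[OF 1 runs_Seq[OF 2 3]] le] by simp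
next
  case (IfZero i p q)
  let ?T = "\<lambda>out. tapes k w 0 (counters env) out"
  have i: "i < k"
    using IfZero.prems le_width[of "length env" p] by simp
  show ?case
  proof (cases "env ! i = 0")
    case True
    have p: "runs (translate k (length env) p) (poly (cost p) B) (?T out) (?T (out @ printed w p env))"
      by (rule IfZero.IH(1)) (use IfZero.prems in auto)
    have "runs (translate k (length env) (IfZero i p q)) (poly (cost p) B + 2) (?T out) (?T (out @ printed w p env))"
      unfolding translate.simps by (rule runs_Cond_eq[OF _ _ p]) (use i True IfZero.prems in auto)
    then show ?thesis using True runs_mono by simp
  next
    case False
    have q: "runs (translate k (length env) q) (poly (cost q) B) (?T out) (?T (out @ printed w q env))"
      by (rule IfZero.IH(2)) (use IfZero.prems in auto)
    have "runs (translate k (length env) (IfZero i p q)) (poly (cost q) B + 1) (?T out) (?T (out @ printed w q env))"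
      unfolding translate.simps by (rule runs_Cond_neq[OF _ _ q]) (use i False IfZero.prems in auto)
    then show ?thesis using False runs_mono by simp
  qed
next
  case (EmitIn i a b c)
  let ?d = "length env" and ?f = "counters env" and ?N = "env ! i"
  have i: "i < ?d" and k: "?d + 2 < k" and N: "?N \<le> B" using EmitIn.prems by auto
  let ?g = "\<lambda>x. ?f(?d := ?N - x, ?d + 1 := x)"
  let ?s = "printed w (EmitIn i a b c) env"
  have "?f(?d := ?f ?d + ?f i) = ?g 0" using i by (auto simp: fun_eq_iff)
  then have 1: "runs (Copy i ?d (?d + 1)) (9 * ?N + 2) (tapes k w 0 ?f out) (tapes k w (int 0) (?g 0) out)"
    using runs_Copy[of i k ?d "?d + 1" ?f w 0 out] i k by simp
  have 2: "runs (Repeat ?d (Seq (Inc (?d + 1)) (Op 0 None Go_Right))) (?N * (1 + 1 + 3) + 1)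
      (tapes k w (int 0) (?g 0) out) (tapes k w (int ?N) (?g ?N) out)"
  proof (rule runs_Repeat[where f = ?g and h = int and out = "\<lambda>_. out"], goal_cases)
    case (2 x)
    have "(?g x)(?d := ?N - Suc x, ?d + 1 := Suc x) = ?g (Suc x)" by (auto simp: fun_eq_iff)
    then have a: "runs (Inc (?d + 1)) 1 (tapes k w (int x) ((?g x)(?d := ?N - Suc x)) out)
        (tapes k w (int x) (?g (Suc x)) out)"
      using runs_Inc[of "?d + 1" k w "int x" "(?g x)(?d := ?N - Suc x)" out] k by simp
    have b: "runs (Op 0 None Go_Right) 1 (tapes k w (int x) (?g (Suc x)) out)
        (tapes k w (int (Suc x)) (?g (Suc x)) out)"
      using runs_In[of Go_Right k w "int x" "?g (Suc x)" out] by (simp add: add.commute)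
    show ?case using runs_Seq[OF a b] by simp
  qed (use k in auto)
  have 3: "runs (Cond 0 0 (Outs k a) (Cond 0 1 (Outs k b) (Outs k c))) (length a + length b + length c + 4)
      (tapes k w (int ?N) (?g ?N) out) (tapes k w (int ?N) (?g ?N) (out @ ?s))"
  proof -
    let ?ts = "tapes k w (int ?N) (?g ?N) out"
    consider (0) "word_tape w (int ?N) = 0" | (1) "word_tape w (int ?N) = 1"
      | (2) "word_tape w (int ?N) \<noteq> 0" "word_tape w (int ?N) \<noteq> 1" by blast
    then show ?thesis
    proof cases
      case 0
      then show ?thesis using runs_mono[OF runs_Cond_eq[of 0 ?ts 0, OF _ _ runs_Outs]] by simp
    next
      case 1
      have "runs (Cond 0 1 (Outs k b) (Outs k c)) (length b + 2) ?ts (tapes k w (int ?N) (?g ?N) (out @ b))"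
        by (rule runs_Cond_eq[OF _ _ runs_Outs]) (use 1 in auto)
      from runs_mono[OF runs_Cond_neq[of 0 ?ts 0, OF _ _ this]] show ?thesis using 1 by simp
    next
      case 2
      have "runs (Cond 0 1 (Outs k b) (Outs k c)) (length c + 1) ?ts (tapes k w (int ?N) (?g ?N) (out @ c))"
        by (rule runs_Cond_neq[OF _ _ runs_Outs]) (use 2 in auto)
      from runs_mono[OF runs_Cond_neq[of 0 ?ts 0, OF _ _ this]] show ?thesis using 2 by (simp add: Let_def)
    qed
  qed
  let ?g' = "\<lambda>x. ?f(?d + 1 := ?N - x)"
  have 4: "runs (Repeat (?d + 1) (Op 0 None Go_Left)) (?N * (1 + 3) + 1)
      (tapes k w (int ?N - int 0) (?g' 0) (out @ ?s)) (tapes k w (int ?N - int ?N) (?g' ?N) (out @ ?s))"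
  proof (rule runs_Repeat[where f = ?g' and h = "\<lambda>x. int ?N - int x" and out = "\<lambda>_. out @ ?s"], goal_cases)
    case (2 x)
    then show ?case
      using runs_In[of Go_Left k w "int ?N - int x" "?g' (Suc x)" "out @ ?s"] by (simp add: algebra_simps)
  qed (use k in auto)
  have eq: "?g' 0 = ?g ?N" "?g' ?N = ?f" by (auto simp: fun_eq_iff)
  have 5: "runs (Repeat (?d + 1) (Op 0 None Go_Left)) (?N * (1 + 3) + 1)
      (tapes k w (int ?N) (?g ?N) (out @ ?s)) (tapes k w 0 ?f (out @ ?s))"
    using 4 unfolding eq by simp
  have le: "9 * ?N + 2 + (?N * (1 + 1 + 3) + 1 + ((length a + length b + length c + 4) + (?N * (1 + 3) + 1)))
      \<le> poly (cost (EmitIn i a b c)) B"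
    using N by simp
  show ?case unfolding translate.simps by (rule runs_mono[OF runs_Seq[OF 1 runs_Seq[OF 2 runs_Seq[OF 3 5]]] le])
next
  case (Bind i j n p)
  let ?d = "length env" and ?f = "counters env" and ?N = "env ! i" and ?M = "env ! j"
  let ?v = "?N * ?M + n"
  let ?B = "B * B + B + n"
  have i: "i < ?d" "j < ?d" and k: "?d + 2 < k" and N: "?N \<le> B" "?M \<le> B" using Bind.prems by auto
  let ?g = "\<lambda>x. ?f(?d := x * ?M, ?d + 1 := ?N - x)"
  have "?f(?d + 1 := ?f (?d + 1) + ?f i) = ?g 0" using i by (auto simp: fun_eq_iff)
  then have 1: "runs (Copy i (?d + 1) (?d + 2)) (9 * ?N + 2) (tapes k w 0 ?f out) (tapes k w 0 (?g 0) out)"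
    using runs_Copy[of i k "?d + 1" "?d + 2" ?f w 0 out] i k by simp
  have 2: "runs (Repeat (?d + 1) (Copy j ?d (?d + 2))) (?N * (9 * ?M + 2 + 3) + 1)
      (tapes k w 0 (?g 0) out) (tapes k w 0 (?g ?N) out)"
  proof (rule runs_Repeat[where f = ?g and h = "\<lambda>_. 0" and out = "\<lambda>_. out"], goal_cases)
    case (2 x)
    let ?h = "(?g x)(?d + 1 := ?N - Suc x)"
    have "?h(?d := ?h ?d + ?h j) = ?g (Suc x)" using i by (auto simp: fun_eq_iff)
    moreover have "?h j = ?M" using i by simp
    ultimately show ?case using runs_Copy[of j k ?d "?d + 2" ?h w 0 out] i k by simp
  qed (use k in auto)
  have "(?g ?N)(?d := (?g ?N) ?d + n) = counters (env @ [?v])" by (auto simp: fun_eq_iff counters_snoc)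
  then have 3: "runs (Incs ?d n) n (tapes k w 0 (?g ?N) out) (tapes k w 0 (counters (env @ [?v])) out)"
    using runs_Incs[of ?d k n w 0 "?g ?N" out] k by simp
  let ?s = "printed w (Bind i j n p) env"
  have v: "?v \<le> B * B + n" using N by (simp add: mult_le_mono)
  have "runs (translate k (length (env @ [?v])) p) (poly (cost p) ?B) (tapes k w 0 (counters (env @ [?v])) out)
      (tapes k w 0 (counters (env @ [?v])) (out @ printed w p (env @ [?v])))"
    by (rule Bind.IH) (use Bind.prems v in \<open>auto intro: order_trans\<close>)
  then have 4: "runs (translate k (?d + 1) p) (poly (cost p) ?B) (tapes k w 0 (counters (env @ [?v])) out)
      (tapes k w 0 (counters (env @ [?v])) (out @ ?s))" by simp
  have eq: "(counters (env @ [?v]))(?d := 0) = ?f" by (auto simp: fun_eq_iff counters_snoc)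
  have 5: "runs (Clear ?d) (3 * ?v + 1) (tapes k w 0 (counters (env @ [?v])) (out @ ?s)) (tapes k w 0 ?f (out @ ?s))"
    using runs_Clear[of ?d k "counters (env @ [?v])" w 0 "out @ ?s"] k unfolding eq by simp
  have "?N * ?M \<le> B * B" using N by (simp add: mult_le_mono)
  then have le: "9 * ?N + 2 + (?N * (9 * ?M + 2 + 3) + 1 + (n + (poly (cost p) ?B + (3 * ?v + 1))))
      \<le> poly (cost (Bind i j n p)) B"
    using N by (simp add: poly_pcompose algebra_simps)
  show ?case unfolding translate.simps
    by (rule runs_mono[OF runs_Seq[OF 1 runs_Seq[OF 2 runs_Seq[OF 3 runs_Seq[OF 4 5]]]] le])
next
  case (Bin i)
  let ?d = "length env" and ?f = "counters env" and ?N = "env ! i"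
  have i: "i < ?d" and k: "?d + 2 < k" and N: "?N \<le> B" using Bin.prems by auto
  have 1: "runs (Copy i ?d (?d + 1)) (9 * ?N + 2) (tapes k w 0 ?f out) (tapes k w 0 (?f(?d := ?N)) out)"
    using runs_Copy[of i k ?d "?d + 1" ?f w 0 out] i k by simp
  have "?N * ?N \<le> B * B" using N by (simp add: mult_le_mono)
  then have le: "9 * ?N + 2 + (?N * (11 * ?N + 12) + 3) \<le> poly (cost (Bin i)) B"
    using N by (simp add: algebra_simps)
  show ?case unfolding translate.simps printed.simps
    by (rule runs_mono[OF runs_Seq[OF 1 runs_Bin_loop] le]) (use k in auto)
qed

text \<open>Marking position 0 turns the blank tapes 1 to \<open>k\<close> into counters of value 0,
  while the output tape \<open>k + 1\<close> stays blank.\<close>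

fun Marks :: "nat \<Rightarrow> com" where
  "Marks 0 = Skip"
| "Marks (Suc i) = Seq (Op (Suc i) (Some 1) Stay) (Marks i)"

lemma runs_Marks:
  "runs (Marks k) k ((word_tape w, 0) # replicate (k + 1) (word_tape [], 0)) (tapes k w 0 (\<lambda>_. 0) [])"
proof -
  let ?T = "\<lambda>m. (word_tape w, 0 :: int) # map (\<lambda>i. (if m \<le> i then word_tape [False] else word_tape [], 0)) [0..<k] @
    [(word_tape [], 0)]"
  have "runs (Marks m) m (?T m) (?T 0)" if "m \<le> k" for m
    using that
  proof (induction m)
    case 0
    then show ?case using runs_Skip by simp
  next
    case (Suc m)
    have mark: "(word_tape [])(0 := Suc 0) = word_tape [False]" by (auto simp: word_tape_def fun_eq_iff)
    have "(map (\<lambda>i. (if Suc m \<le> i then word_tape [False] else word_tape [], 0 :: int)) [0..<k])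
        [m := (word_tape [False], 0)] =
      map (\<lambda>i. (if m \<le> i then word_tape [False] else word_tape [], 0)) [0..<k]"
      using Suc.prems by (intro nth_equalityI) (auto simp: nth_list_update)
    then have "runs (Op (Suc m) (Some 1) Stay) 1 (?T (Suc m)) (?T m)"
      using Suc.prems mark by (intro runs_Op) (simp_all add: list_update_append nth_append)
    from runs_Seq[OF this Suc.IH] show ?case using Suc.prems by simp
  qed
  from this[of k] have "runs (Marks k) k (?T k) (?T 0)" by simp
  moreover have "map (\<lambda>i. (if k \<le> i then word_tape [False] else word_tape [], 0 :: int)) [0..<k] =
      replicate k (word_tape [], 0)"
    by (intro nth_equalityI) auto
  then have "?T k = (word_tape w, 0) # replicate (k + 1) (word_tape [], 0)"
    by (simp only: replicate_append_same[symmetric] Suc_eq_plus1[symmetric] replicate_Suc)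
  moreover have "?T 0 = tapes k w 0 (\<lambda>_. 0) []" by (simp add: tapes_def)
  ultimately show ?thesis by simp
qed

text \<open>The input head runs to the first blank while counters 0 and 1 count its steps; counter 1
  is then spent on the way back. So the program starts with the variables \<open>length w\<close>
  and \<open>0\<close>, the latter being the source of all constants.\<close>

definition whole :: "nat \<Rightarrow> prog \<Rightarrow> com" where
  "whole k p = Seq (Marks k) (Seq (Until 0 0 (Seq (Inc 0) (Seq (Inc 1) (Op 0 None Go_Right))))
     (Seq (Repeat 1 (Op 0 None Go_Left)) (translate k 2 p)))"

lemma runs_whole:
  assumes "scoped 2 p" "width 2 p \<le> k"
  shows "runs (whole k p) (k + 9 * length w + 2 + poly (cost p) (length w))
    ((word_tape w, 0) # replicate (k + 1) (word_tape [], 0))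
    (tapes k w 0 (counters [length w, 0]) (printed w p [length w, 0]))"
proof -
  let ?n = "length w"
  have k: "2 \<le> k" using assms(2) le_width[of 2 p] by simp
  let ?f = "\<lambda>j. (\<lambda>_ :: nat. 0 :: nat)(0 := j, 1 := j)"
  let ?S = "\<lambda>j. tapes k w (int j) (?f j) []"
  have 2: "runs (Until 0 0 (Seq (Inc 0) (Seq (Inc 1) (Op 0 None Go_Right)))) (?n * (1 + (1 + 1) + 2) + 1)
    (?S 0) (?S ?n)"
  proof (rule runs_Until[where S = ?S], goal_cases)
    case (1 j)
    have a: "runs (Inc 0) 1 (?S j) (tapes k w (int j) ((?f j)(0 := Suc j)) [])"
      using runs_Inc[of 0 k w "int j" "?f j" "[]"] k by simp
    have "(?f j)(0 := Suc j, 1 := Suc j) = ?f (Suc j)" by (auto simp: fun_eq_iff)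
    then have b: "runs (Inc 1) 1 (tapes k w (int j) ((?f j)(0 := Suc j)) []) (tapes k w (int j) (?f (Suc j)) [])"
      using runs_Inc[of 1 k w "int j" "(?f j)(0 := Suc j)" "[]"] k by simp
    have c: "runs (Op 0 None Go_Right) 1 (tapes k w (int j) (?f (Suc j)) []) (?S (Suc j))"
      using runs_In[of Go_Right k w "int j" "?f (Suc j)" "[]"] by (simp add: add.commute)
    show ?case using runs_Seq[OF a runs_Seq[OF b c]] 1 by (simp add: word_tape_def)
  qed (auto simp: word_tape_def)
  let ?g = "\<lambda>j. (\<lambda>_ :: nat. 0 :: nat)(0 := ?n, 1 := ?n - j)"
  have 3: "runs (Repeat 1 (Op 0 None Go_Left)) (?n * (1 + 3) + 1)
      (tapes k w (int ?n - int 0) (?g 0) []) (tapes k w (int ?n - int ?n) (?g ?n) [])"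
  proof (rule runs_Repeat[where f = ?g and h = "\<lambda>x. int ?n - int x" and out = "\<lambda>_. []"], goal_cases)
    case (2 x)
    then show ?case
      using runs_In[of Go_Left k w "int ?n - int x" "?g (Suc x)" "[]"] by (simp add: algebra_simps)
  qed (use k in auto)
  have eq: "?g ?n = counters [?n, 0]" "?f 0 = (\<lambda>_. 0)"
    by (auto simp: fun_eq_iff counters_def less_Suc_eq)
  have "runs (Repeat 1 (Op 0 None Go_Left)) (?n * (1 + 3) + 1) (?S ?n) (tapes k w 0 (counters [?n, 0]) [])"
    using 3 unfolding eq by simp
  moreover have "runs (translate k 2 p) (poly (cost p) ?n) (tapes k w 0 (counters [?n, 0]) [])
      (tapes k w 0 (counters [?n, 0]) (printed w p [?n, 0]))"
    using runs_translate[of "[?n, 0]" p k ?n w "[]"] assms by (simp add: numeral_2_eq_2)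
  moreover have "runs (Marks k) k ((word_tape w, 0) # replicate (k + 1) (word_tape [], 0)) (?S 0)"
    using runs_Marks[of k w] unfolding eq by simp
  ultimately have "runs (whole k p) (k + ((?n * (1 + (1 + 1) + 2) + 1) + ((?n * (1 + 3) + 1) + poly (cost p) ?n)))
    ((word_tape w, 0) # replicate (k + 1) (word_tape [], 0))
    (tapes k w 0 (counters [?n, 0]) (printed w p [?n, 0]))"
    unfolding whole_def using 2 by (intro runs_Seq) simp_all
  then show ?thesis by (rule runs_mono) simp
qed

section \<open>From programs to polynomial-time computable functions\<close>

lemma single_valued_step: "deterministic M \<Longrightarrow> single_valued (step M)"
  unfolding single_valued_def step_def deterministic_def by fastforce

lemma single_valued_relpow: "single_valued (R :: 'a rel) \<Longrightarrow> single_valued (R ^^ n)"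
  by (induction n) (auto intro: single_valued_relcomp)

text \<open>By determinism every run is a prefix of the halting one. This extends the bound on the
  complete run to all partial runs, as \<open>runs_in_time\<close> demands.\<close>

lemma relpow_le_if_halts:
  fixes R :: "'a rel"
  assumes "single_valued R" "(a, b) \<in> R ^^ n" "b \<notin> Domain R" "(a, c) \<in> R ^^ m"
  shows "m \<le> n"
proof (rule ccontr)
  assume "\<not> m \<le> n"
  then obtain l where "m = n + Suc l" using less_imp_Suc_add by (metis add_Suc_right not_le)
  then have "(a, c) \<in> R ^^ n O R ^^ Suc l" using assms(4) by (simp only: relpow_add)
  then obtain e where e: "(a, e) \<in> R ^^ n" "(e, c) \<in> R ^^ Suc l" by blast
  obtain e' where "(e, e') \<in> R" using relpow_Suc_D2[OF e(2)] by blast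
  moreover have "e = b" using single_valued_relpow[OF assms(1), of n] e(1) assms(2) by (metis single_valuedD)
  ultimately show False using assms(3) by blast
qed

theorem polytime_computable_printed:
  assumes "scoped 2 p"
  shows "polytime_computable (\<lambda>w. printed w p [length w, 0])"
proof -
  define k where "k = width 2 p"
  define P where "P = assemble 0 (whole k p)"
  let ?M = "machine (k + 2) P"
  let ?t = "[:k + 2, 9:] + cost p"
  have run: "\<exists>n \<le> poly ?t (length w). \<exists>c. (initial ?M w, c) \<in> step ?M ^^ n \<and> c \<notin> Domain (step ?M) \<and>
      fst (last (snd c)) = word_tape (printed w p [length w, 0])" for w
  proof -
    let ?ts = "(word_tape w, 0) # replicate (k + 1) (word_tape [], 0)"
    let ?ts' = "tapes k w 0 (counters [length w, 0]) (printed w p [length w, 0])"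
    obtain n where n: "n \<le> k + 9 * length w + 2 + poly (cost p) (length w)" "exec (whole k p) ?ts n ?ts'"
      using runs_whole[OF assms, of k w] unfolding k_def runs_def by blast
    have "ternary (k + 2) ?ts"
      by (auto simp: ternary_def word_tape_def)
    then have "((0, ?ts), (csize (whole k p), ?ts')) \<in> step ?M ^^ n"
      using exec_assemble[OF n(2), of "k + 2" P "[]" "[]" 0] by (simp add: P_def)
    moreover have "(length P, ts) \<notin> Domain (step ?M)" for ts
      by (auto simp: step_def machine_def)
    moreover have "initial ?M w = (0, ?ts)" by (simp add: initial_def machine_def)
    moreover have "fst (last ?ts') = word_tape (printed w p [length w, 0])" by (simp add: tapes_def)
    ultimately show ?thesis using n(1) unfolding P_def
      by (intro exI[of _ n] conjI exI[of _ "(csize (whole k p), ?ts')"]) auto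
  qed
  have time: "runs_in_time ?M (poly ?t)"
    unfolding runs_in_time_def
  proof (intro allI impI)
    fix w m c assume "(initial ?M w, c) \<in> step ?M ^^ m"
    moreover obtain n c' where n: "n \<le> poly ?t (length w)" "(initial ?M w, c') \<in> step ?M ^^ n"
      "c' \<notin> Domain (step ?M)" using run[of w] by blast
    ultimately have "m \<le> n"
      using relpow_le_if_halts[OF single_valued_step[OF deterministic_machine]] by blast
    then show "m \<le> poly ?t (length w)" using n(1) by (rule le_trans)
  qed
  have out: "\<exists>c. (initial ?M w, c) \<in> (step ?M)\<^sup>* \<and> halted ?M c \<and>
      fst (last (snd c)) = word_tape (printed w p [length w, 0])" for w
    using run[of w] relpow_imp_rtrancl unfolding halted_def by blast
  show ?thesis
    unfolding polytime_computable_def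
  proof (intro exI[of _ ?M] exI[of _ ?t] conjI allI)
    show "valid_tm ?M" by (rule valid_machine) simp
  qed (rule deterministic_machine time out)+
qed

section \<open>Printing the instance\<close>

text \<open>A block of exactly \<open>n\<close> bits in the format of \<open>enc_nat\<close>, padded
  with leading zeros and without an end mark.\<close>

fun dig :: "nat \<Rightarrow> nat \<Rightarrow> bool list" where
  "dig 0 d = []"
| "dig (Suc n) d = True # odd d # dig n (d div 2)"

lemma enc_nat_add_power:
  assumes "d < 2 ^ n" "0 < r"
  shows "enc_nat (d + 2 ^ n * r) = dig n d @ enc_nat r"
  using assms(1)
proof (induction n arbitrary: d)
  case (Suc n)
  have "(d + 2 ^ Suc n * r) div 2 = d div 2 + 2 ^ n * r" by simp
  moreover have "odd (d + 2 ^ Suc n * r) \<longleftrightarrow> odd d" by simp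
  moreover have "0 < d + 2 ^ Suc n * r" using assms(2) by simp
  ultimately show ?case using Suc.IH[of "d div 2"] Suc.prems enc_nat_rec[of "d + 2 ^ Suc n * r"] by simp
qed simp

lemma enc_nat_digits:
  assumes "\<And>k. k < n \<Longrightarrow> f k < 2 ^ b" "0 < r"
  shows "enc_nat ((\<Sum>k<n. f k * (2 ^ b) ^ k) + (2 ^ b) ^ n * r) = concat (map (\<lambda>k. dig b (f k)) [0..<n]) @ enc_nat r"
  using assms
proof (induction n arbitrary: r)
  case (Suc n)
  have eq: "(\<Sum>k<Suc n. f k * (2 ^ b) ^ k) + (2 ^ b) ^ Suc n * r =
      (\<Sum>k<n. f k * (2 ^ b) ^ k) + (2 ^ b) ^ n * (f n + 2 ^ b * r)"
    by (simp add: algebra_simps)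
  have "enc_nat (f n + 2 ^ b * r) = dig b (f n) @ enc_nat r"
    by (rule enc_nat_add_power) (use Suc.prems in auto)
  then show ?case unfolding eq using Suc.IH[of "f n + 2 ^ b * r"] Suc.prems by simp
qed simp

lemma enc_nat_top_digit:
  assumes "2 ^ n \<le> d" "d < 2 ^ Suc n"
  shows "enc_nat d = dig (Suc n) d @ [False]"
  using assms
proof (induction n arbitrary: d)
  case 0
  then have "d = 1" by simp
  then show ?case by (simp add: enc_nat_rec)
next
  case (Suc n)
  have "2 ^ n \<le> d div 2" "d div 2 < 2 ^ Suc n" "0 < d" using Suc.prems by auto
  then show ?case using Suc.IH[of "d div 2"] enc_nat_rec[of d] by simp
qed

text \<open>\<open>enc_nat\<close> omits leading zeros, so printing whole blocks is correct only if
  the highest digit has its top bit set.\<close>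

lemma enc_nat_full_digits:
  assumes "\<And>k. k < Suc n \<Longrightarrow> f k < 2 ^ b" "2 ^ (b - 1) \<le> f n" "0 < b"
  shows "enc_nat (\<Sum>k<Suc n. f k * (2 ^ b) ^ k) = concat (map (\<lambda>k. dig b (f k)) [0..<Suc n]) @ [False]"
proof -
  obtain c where b: "b = Suc c" using assms(3) by (cases b) auto
  have "enc_nat (f n) = dig b (f n) @ [False]"
    using enc_nat_top_digit[of c "f n"] assms(1)[of n] assms(2) by (simp add: b)
  moreover have "0 < f n" using assms(2) by (meson less_le_trans zero_less_numeral zero_less_power)
  ultimately show ?thesis
    using enc_nat_digits[of n f b "f n"] assms(1) by (simp add: mult.commute)
qed

lemma dig_zero: "dig n 0 = concat (replicate n [True, False])"
  by (induction n) auto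

lemma enc_nat_ones: "enc_nat (2 ^ n - 1) = concat (replicate n [True, True]) @ [False]"
proof (induction n)
  case (Suc n)
  have "(2 ^ Suc n - 1) div 2 = (2 ^ n - 1 :: nat)" "odd (2 ^ Suc n - 1 :: nat)" by simp_all
  moreover have "(1 :: nat) < 2 ^ Suc n" by (rule one_less_power) simp_all
  then have "(0 :: nat) < 2 ^ Suc n - 1" by linarith
  ultimately show ?case using enc_nat_rec[of "2 ^ Suc n - 1"] Suc by simp
qed simp

text \<open>The number equals \<open>2 + 2 ^ (n + 2) * (2 ^ (n - 1) - 1)\<close>: its low
  \<open>n + 2\<close> bits form 2, and \<open>n - 1\<close> ones follow. It is the loss bound of
  the instance, which can thus be printed without squaring.\<close>

lemma enc_nat_twice_square_ones:
  assumes "2 \<le> n"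
  shows "enc_nat (2 * (2 ^ n - 1)\<^sup>2) =
    [True, False, True, True] @ concat (replicate n [True, False]) @ concat (replicate (n - 1) [True, True]) @ [False]"
proof -
  obtain j where n: "n = Suc (Suc j)" using assms by (metis Suc_le_D numeral_2_eq_2 Suc_le_mono)
  \<comment> \<open>With \<open>x = 2 ^ (n - 2)\<close> the identity becomes one of integer
    polynomials, free of truncated subtraction.\<close>
  define x :: int where "x = 2 ^ j"
  have x: "1 \<le> x" by (simp add: x_def)
  have "int (2 * (2 ^ n - 1)\<^sup>2) = 2 * (4 * x - 1)\<^sup>2" by (simp add: n x_def of_nat_diff)
  also have "\<dots> = 2 + 16 * x * (2 * x - 1)" by (simp add: power2_eq_square algebra_simps)
  also have "\<dots> = int (2 + 2 ^ (n + 2) * (2 ^ (n - 1) - 1))" by (simp add: n x_def of_nat_diff)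
  finally have eq: "2 * (2 ^ n - 1)\<^sup>2 = 2 + 2 ^ (n + 2) * (2 ^ (n - 1) - 1 :: nat)" by (simp only: of_nat_eq_iff)
  have "(1 :: nat) < 2 ^ (n - 1)" by (rule one_less_power) (simp_all add: n)
  then have "0 < (2 ^ (n - 1) - 1 :: nat)" by linarith
  moreover have "(2 :: nat) < 2 ^ (n + 2)" using power_strict_increasing[of 1 "n + 2" "2 :: nat"] by simp
  ultimately have "enc_nat (2 * (2 ^ n - 1)\<^sup>2) = dig (n + 2) 2 @ enc_nat (2 ^ (n - 1) - 1)"
    unfolding eq by (intro enc_nat_add_power)
  moreover have "dig (n + 2) 2 = [True, False, True, True] @ dig n 0" by (simp add: numeral_2_eq_2)
  ultimately show ?thesis by (simp only: enc_nat_ones dig_zero append_assoc)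
qed

section \<open>Codes of loops over index ranges, and the adjacency matrix\<close>

lemma concat_map_upt_add:
  "concat (map f [0..<a + b]) = concat (map f [0..<a]) @ concat (map (\<lambda>i. f (a + i)) [0..<b])"
  by (induction b) simp_all

lemma concat_map_upt_mult:
  "concat (map f [0..<n * k]) = concat (map (\<lambda>u. concat (map (\<lambda>t. f (u * k + t)) [0..<k])) [0..<n])"
proof (induction n)
  case (Suc n)
  then show ?case by (simp add: add.commute[of k] concat_map_upt_add)
qed simp

lemma concat_replicate_commute: "concat (replicate n s) @ s = s @ concat (replicate n s)"
  by (induction n) simp_all

lemma concat_map_upt_const: "(\<And>i. i < n \<Longrightarrow> f i = s) \<Longrightarrow> concat (map f [0..<n]) = concat (replicate n s)"
  by (induction n) (simp_all add: concat_replicate_commute)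

lemma concat_replicate_concat: "concat (replicate n (concat (replicate k s))) = concat (replicate (k * n) s)"
  by (induction n) (simp_all add: replicate_add)

lemma concat_map_upt_3:
  "concat (map f [0..<3 * m]) = concat (map (\<lambda>c. f (3 * c) @ f (3 * c + 1) @ f (3 * c + 2)) [0..<m])"
  using concat_map_upt_mult[of f m 3] by (simp add: mult.commute eval_nat_numeral)

lemma enc_rat_of_nat: "enc_rat (of_nat n) = False # enc_nat n @ [True, True, False]"
proof -
  have "quotient_of (of_nat n) = (int n, 1)" using quotient_of_rat_of_int[of "int n"] by simp
  moreover have "enc_nat 1 = [True, True, False]" by (simp add: enc_nat_rec)
  ultimately show ?thesis by (simp add: enc_rat_def)
qed

abbreviation Thens :: "prog list \<Rightarrow> prog" where
  "Thens ps \<equiv> foldr Then ps (Emit [])"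

lemma printed_Thens: "printed w (Thens ps) env = concat (map (\<lambda>p. printed w p env) ps)"
  by (induction ps) auto

lemma scoped_Thens: "scoped d (Thens ps) \<longleftrightarrow> (\<forall>p \<in> set ps. scoped d p)"
  by (induction ps) auto

definition rat0 :: "bool list" where
  "rat0 = enc_rat 0"

definition rat1 :: "bool list" where
  "rat1 = enc_rat 1"

text \<open>The rows of the adjacency matrix for the three vertices of a column: \<open>i\<close> and \<open>i + 1\<close> hold the
  numbers of columns before and after it.\<close>

definition matrix_prog :: "nat \<Rightarrow> prog" where
  "matrix_prog i = Thens
     [IfZero i (Emit (True # rat1)) (Emit (True # rat0)), Emit [False],
      For (i + 1) (IfZero (i + 2)
        (IfZero i (Emit (True # rat1 @ [False, False])) (Emit (True # rat0 @ [False, False])))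
        (Emit [False, False, False])),
      Emit (True # rat0),
      For (i + 1) (IfZero (i + 2) (Emit (False # True # rat1 @ [False])) (Emit [False, False, False])),
      For (i + 1) (IfZero (i + 2) (Emit (False # False # True # rat0)) (Emit [False, False, False]))]"

definition edge_code :: "ednr \<Rightarrow> nat \<Rightarrow> nat \<Rightarrow> bool list" where
  "edge_code I u v = (if {u, v} \<in> edges I then True # enc_rat (resistance I {u, v}) else [False])"

lemma upt_columns:
  assumes "c < m"
  shows "concat (map f [3 * (c + 1)..<3 * m]) =
    concat (map (\<lambda>y. f (3 * (c + 1 + y)) @ f (3 * (c + 1 + y) + 1) @ f (3 * (c + 1 + y) + 2)) [0..<m - Suc c])"
proof -
  have "3 * m = 3 * (m - Suc c) + 3 * (c + 1)" using assms by simp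
  then have "[3 * (c + 1)..<3 * m] = map (\<lambda>i. i + 3 * (c + 1)) [0..<3 * (m - Suc c)]"
    using map_add_upt[of "3 * (c + 1)" "3 * (m - Suc c)"] by simp
  then have "concat (map f [3 * (c + 1)..<3 * m]) = concat (map (\<lambda>i. f (i + 3 * (c + 1))) [0..<3 * (m - Suc c)])"
    by (simp add: comp_def)
  also have "\<dots> = concat (map (\<lambda>y. f (3 * (c + 1 + y)) @ f (3 * (c + 1 + y) + 1) @ f (3 * (c + 1 + y) + 2)) [0..<m - Suc c])"
    unfolding concat_map_upt_3 by (simp add: algebra_simps)
  finally show ?thesis .
qed

lemma mod_3_cases: "(3 * c :: nat) mod 3 = 0" "(3 * c + 1 :: nat) mod 3 = 1" "(3 * c + 2 :: nat) mod 3 = 2"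
  by presburger+

lemma mod_3_distinct:
  "3 * a = 3 * b + 1 \<longleftrightarrow> False" "3 * a = 3 * b + 4 \<longleftrightarrow> False" "3 * a + 2 = 3 * b + 1 \<longleftrightarrow> False"
  "3 * a + 2 = 3 * b + 4 \<longleftrightarrow> False" "3 * a = 2 \<longleftrightarrow> False" for a b :: nat
  by presburger+

lemma edge_code_ladder:
  fixes c m D h
  defines "I \<equiv> ladder m D h"
  assumes "c < m"
  shows "edge_code I (3 * c) (3 * c + 1) = True # (if c = 0 then rat1 else rat0)"
    "edge_code I (3 * c) (3 * c + 2) = [False]"
    "edge_code I (3 * c + 1) (3 * c + 2) = True # rat0"
    "y < m - Suc c \<Longrightarrow> edge_code I (3 * c) (3 * (c + 1 + y)) = (if y = 0 then True # (if c = 0 then rat1 else rat0) else [False])"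
    "edge_code I (3 * c) (3 * (c + 1 + y) + 1) = [False]"
    "edge_code I (3 * c) (3 * (c + 1 + y) + 2) = [False]"
    "edge_code I (3 * c + 1) (3 * (c + 1 + y)) = [False]"
    "y < m - Suc c \<Longrightarrow> edge_code I (3 * c + 1) (3 * (c + 1 + y) + 1) = (if y = 0 then True # rat1 else [False])"
    "edge_code I (3 * c + 1) (3 * (c + 1 + y) + 2) = [False]"
    "edge_code I (3 * c + 2) (3 * (c + 1 + y)) = [False]"
    "edge_code I (3 * c + 2) (3 * (c + 1 + y) + 1) = [False]"
    "y < m - Suc c \<Longrightarrow> edge_code I (3 * c + 2) (3 * (c + 1 + y) + 2) = (if y = 0 then True # rat0 else [False])"
  using assms(2) mod_3_distinct mod_3_cases[of c]
  by (auto simp: edge_code_def I_def in_edges_ladder next_to_def resistance_ladder rat0_def rat1_def doubleton_eq_iff)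

lemma printed_matrix_prog:
  assumes "i < length env" "length env = d" "env ! i = m"
  shows "printed w (For i (matrix_prog d)) env =
    concat (map (\<lambda>u. concat (map (edge_code (ladder m D h) u) [Suc u..<3 * m])) [0..<3 * m])"
proof -
  let ?I = "ladder m D h"
  have col: "printed w (matrix_prog d) (env @ [c, m - Suc c]) =
      concat (map (edge_code ?I (3 * c)) [Suc (3 * c)..<3 * m]) @
      concat (map (edge_code ?I (3 * c + 1)) [Suc (3 * c + 1)..<3 * m]) @
      concat (map (edge_code ?I (3 * c + 2)) [Suc (3 * c + 2)..<3 * m])" if c: "c < m" for c
  proof -
    let ?env = "env @ [c, m - Suc c]"
    have lookup: "?env ! d = c" "?env ! Suc d = m - Suc c"
      using assms(2) by (simp_all add: nth_append)
    have le: "3 * c + 3 \<le> 3 * m" using c by simp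
    have e3: "3 * (c + 1) = Suc (Suc (Suc (3 * c)))" by simp
    have u: "[Suc (3 * c)..<3 * m] = (3 * c + 1) # (3 * c + 2) # [3 * (c + 1)..<3 * m]"
      "[Suc (3 * c + 1)..<3 * m] = (3 * c + 2) # [3 * (c + 1)..<3 * m]"
      "[Suc (3 * c + 2)..<3 * m] = [3 * (c + 1)..<3 * m]"
      unfolding e3 using le by (simp_all add: upt_conv_Cons)
    note e = edge_code_ladder[OF c, where D = D and h = h]
    have r0: "concat (map (edge_code ?I (3 * c)) [3 * (c + 1)..<3 * m]) =
        concat (map (\<lambda>y. (if y = 0 then True # (if c = 0 then rat1 else rat0) else [False]) @ [False] @ [False]) [0..<m - Suc c])"
      unfolding upt_columns[OF c] by (intro arg_cong[of _ _ concat] map_cong refl) (simp only: e atLeast0LessThan atLeastLessThan_upt[symmetric] lessThan_iff)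
    have r1: "concat (map (edge_code ?I (3 * c + 1)) [3 * (c + 1)..<3 * m]) =
        concat (map (\<lambda>y. [False] @ (if y = 0 then True # rat1 else [False]) @ [False]) [0..<m - Suc c])"
      unfolding upt_columns[OF c] by (intro arg_cong[of _ _ concat] map_cong refl) (simp only: e atLeast0LessThan atLeastLessThan_upt[symmetric] lessThan_iff)
    have r2: "concat (map (edge_code ?I (3 * c + 2)) [3 * (c + 1)..<3 * m]) =
        concat (map (\<lambda>y. [False] @ [False] @ (if y = 0 then True # rat0 else [False])) [0..<m - Suc c])"
      unfolding upt_columns[OF c] by (intro arg_cong[of _ _ concat] map_cong refl) (simp only: e atLeast0LessThan atLeastLessThan_upt[symmetric] lessThan_iff)
    have q0: "printed w (For (d + 1) (IfZero (d + 2)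
        (IfZero d (Emit (True # rat1 @ [False, False])) (Emit (True # rat0 @ [False, False])))
        (Emit [False, False, False]))) ?env =
      concat (map (\<lambda>y. (if y = 0 then True # (if c = 0 then rat1 else rat0) else [False]) @ [False] @ [False]) [0..<m - Suc c])"
      by (auto simp: nth_append assms(2) intro!: arg_cong[of _ _ concat] map_cong)
    have q1: "printed w (For (d + 1) (IfZero (d + 2) (Emit (False # True # rat1 @ [False])) (Emit [False, False, False]))) ?env =
      concat (map (\<lambda>y. [False] @ (if y = 0 then True # rat1 else [False]) @ [False]) [0..<m - Suc c])"
      by (auto simp: nth_append assms(2) intro!: arg_cong[of _ _ concat] map_cong)
    have q2: "printed w (For (d + 1) (IfZero (d + 2) (Emit (False # False # True # rat0)) (Emit [False, False, False]))) ?env =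
      concat (map (\<lambda>y. [False] @ [False] @ (if y = 0 then True # rat0 else [False])) [0..<m - Suc c])"
      by (auto simp: nth_append assms(2) intro!: arg_cong[of _ _ concat] map_cong)
    have lhs: "printed w (matrix_prog d) ?env =
        (True # (if c = 0 then rat1 else rat0)) @ [False] @
        concat (map (\<lambda>y. (if y = 0 then True # (if c = 0 then rat1 else rat0) else [False]) @ [False] @ [False]) [0..<m - Suc c]) @
        (True # rat0) @
        concat (map (\<lambda>y. [False] @ (if y = 0 then True # rat1 else [False]) @ [False]) [0..<m - Suc c]) @
        concat (map (\<lambda>y. [False] @ [False] @ (if y = 0 then True # rat0 else [False])) [0..<m - Suc c])"
      unfolding matrix_prog_def printed_Thens list.map q0 q1 q2 using lookup(1) by simp
    show ?thesis unfolding lhs u r0[symmetric] r1[symmetric] r2[symmetric]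
      using e(1,2,3) by simp
  qed
  show ?thesis
    unfolding printed.simps assms(3) concat_map_upt_3
    by (intro arg_cong[of _ _ concat] map_cong refl) (simp add: col)
qed

section \<open>Programs for the demands\<close>

locale reduction = tile_numbers +
  fixes hc ic :: "nat \<Rightarrow> nat"
  assumes input_colors: "x \<le> 2 \<Longrightarrow> hc x \<le> C" "x \<le> 2 \<Longrightarrow> ic x \<le> C"
begin

abbreviation Dg :: "nat \<Rightarrow> prog" where
  "Dg d \<equiv> Emit (dig \<beta> d)"

text \<open>The blocks of \<open>item\<close> come in the order of positions and end with the
  counting digit 1 of the cell, above which nothing is printed. A gap of \<open>N - 1\<close> zero
  blocks is split into \<open>N - Suc u\<close> and \<open>u\<close> rounds. The final triples
  \<open>True, True, False\<close> are that last 1 with the end mark, and the denominator;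
  \<open>rat0\<close> is the demand in rows 0 and 2.\<close>

definition item_prog :: "nat \<Rightarrow> nat \<Rightarrow> nat \<Rightarrow> prog" where
  "item_prog iW1 d t = Thens
     [Emit (rat0 @ [False]),
      For d (Dg 0), Dg (C - tL t), Dg (tR t), For (d + 1) (Dg 0),
      For d (Dg 0), Dg (C - tD t), For iW1 (Dg 0), Dg (tU t), For (d + 1) (Dg 0),
      For d (Dg 0), Emit ([True, True, False, True, True, False] @ rat0)]"

text \<open>One scheme serves both balancing columns, with \<open>din\<close> giving the digit for
  an input colour. The first row consists of its separator \<open>fin\<close>, \<open>T\<close>
  blank cells left of the input, and \<open>T + 1\<close> cells whose colour depends on the input
  symbol at the loop index, index 0 being the cell with the heads.\<close>

definition complement_prog ::
    "nat \<Rightarrow> nat \<Rightarrow> nat \<Rightarrow> nat \<Rightarrow> nat \<Rightarrow> nat \<Rightarrow> nat \<Rightarrow> nat \<Rightarrow> nat \<Rightarrow> (nat \<Rightarrow> nat) \<Rightarrow> nat \<Rightarrow> nat \<Rightarrow> nat \<Rightarrow> prog" where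
  "complement_prog iN iT iT1 iNW iW d h0 h hN din v fi ce = Thens
     [Emit (rat0 @ [False]),
      For iN (IfZero d (Dg h0) (Dg h)), Dg hN,
      Dg (din fin), For iT (Dg (din (ic 0))),
      For iT1 (IfZero d
        (EmitIn d (dig \<beta> (din (hc 0))) (dig \<beta> (din (hc 1))) (dig \<beta> (din (hc 2))))
        (EmitIn d (dig \<beta> (din (ic 0))) (dig \<beta> (din (ic 1))) (dig \<beta> (din (ic 2))))),
      For iNW (Dg v), For iW (Dg fi),
      For iN (Dg ce), Emit ([False, True, True, False] @ rat0)]"

lemma item_less: "t < K \<Longrightarrow> item N W u t k < 2 ^ \<beta>"
proof -
  assume t: "t < K"
  have "item N W u t k \<le> 4 * C + 1" using tile_le[OF t] unfolding item_def by auto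
  moreover have "C \<le> K * C" using K_pos by (simp add: Suc_le_eq)
  then have "3 * C + 3 \<le> 2 ^ (\<beta> - 1)" using \<beta>(1) K_pos by linarith
  moreover have "(2 :: nat) ^ \<beta> = 2 * 2 ^ (\<beta> - 1)" using \<beta>(2) by (cases \<beta>) auto
  ultimately show ?thesis by linarith
qed

lemma enc_nat_item:
  assumes "u < N" "0 < W" "t < K"
  shows "enc_nat (val N W (item N W u t)) =
    concat (map (\<lambda>k. dig \<beta> (item N W u t k)) [0..<2 * N + W + 1 + u]) @ [True, True, False]"
proof -
  let ?k = "2 * N + W + 1 + u"
  have split: "3 * N + W + 1 = ?k + (N - u)" using assms(1) by simp
  have "(\<Sum>i<N - u. item N W u t (i + ?k) * (2 ^ \<beta>) ^ (i + ?k)) =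
      (\<Sum>i<N - u. if i = 0 then (2 ^ \<beta>) ^ ?k else 0)"
    using assms by (intro sum.cong refl) (auto simp: item_def)
  also have "\<dots> = (2 ^ \<beta>) ^ ?k" using assms(1) by simp
  finally have "val N W (item N W u t) = (\<Sum>k<?k. item N W u t k * (2 ^ \<beta>) ^ k) + (2 ^ \<beta>) ^ ?k * 1"
    unfolding val_def split sum_lessThan_add by simp
  moreover have "enc_nat 1 = [True, True, False]" by (simp add: enc_nat_rec)
  ultimately show ?thesis using enc_nat_digits[of ?k "item N W u t" \<beta> 1] item_less[OF assms(3)] by simp
qed

lemma printed_item_prog:
  assumes "u < N" "0 < W" "t < K" "env ! d = u" "env ! Suc d = N - Suc u" "env ! iW1 = W - 1"
  shows "printed w (item_prog iW1 d t) env = rat0 @ enc_rat (of_nat (val N W (item N W u t))) @ rat0"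
proof -
  let ?f = "\<lambda>k. dig \<beta> (item N W u t k)" and ?Z = "\<lambda>n. concat (replicate n (dig \<beta> 0))"
  define a where "a = N - Suc u"
  define b where "b = W - 1"
  have N: "N = a + Suc u" and W: "W = Suc b" using assms(1,2) by (auto simp: a_def b_def)
  \<comment> \<open>The summands are the lengths of the segments in printing order, so that
    \<open>concat_map_upt_add\<close> cuts the code at all their ends.\<close>
  have k: "2 * N + W + 1 + u = u + (1 + (1 + (a + (u + (1 + (b + (1 + (a + u))))))))" by (simp add: N W)
  have 1: "concat (map ?f [0..<u]) = ?Z u"
    by (rule concat_map_upt_const) (simp add: item_def N W)
  have 2: "concat (map (\<lambda>i. ?f (u + i)) [0..<1]) = dig \<beta> (C - tL t)" by (simp add: item_def N W)
  have 3: "concat (map (\<lambda>i. ?f (u + (1 + i))) [0..<1]) = dig \<beta> (tR t)" by (simp add: item_def N W)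
  have 4: "concat (map (\<lambda>i. ?f (u + (1 + (1 + i)))) [0..<a]) = ?Z a"
    by (rule concat_map_upt_const) (simp add: item_def N W)
  have 5: "concat (map (\<lambda>i. ?f (u + (1 + (1 + (a + i))))) [0..<u]) = ?Z u"
    by (rule concat_map_upt_const) (simp add: item_def N W)
  have 6: "concat (map (\<lambda>i. ?f (u + (1 + (1 + (a + (u + i)))))) [0..<1]) = dig \<beta> (C - tD t)" by (simp add: item_def N W)
  have 7: "concat (map (\<lambda>i. ?f (u + (1 + (1 + (a + (u + (1 + i))))))) [0..<b]) = ?Z b"
    by (rule concat_map_upt_const) (simp add: item_def N W)
  have 8: "concat (map (\<lambda>i. ?f (u + (1 + (1 + (a + (u + (1 + (b + i)))))))) [0..<1]) = dig \<beta> (tU t)" by (simp add: item_def N W)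
  have 9: "concat (map (\<lambda>i. ?f (u + (1 + (1 + (a + (u + (1 + (b + (1 + i))))))))) [0..<a]) = ?Z a"
    by (rule concat_map_upt_const) (simp add: item_def N W)
  have 10: "concat (map (\<lambda>i. ?f (u + (1 + (1 + (a + (u + (1 + (b + (1 + (a + i)))))))))) [0..<u]) = ?Z u"
    by (rule concat_map_upt_const) (simp add: item_def N W)
  have "enc_nat (val N W (item N W u t)) = ?Z u @ dig \<beta> (C - tL t) @ dig \<beta> (tR t) @ ?Z a @ ?Z u @
      dig \<beta> (C - tD t) @ ?Z b @ dig \<beta> (tU t) @ ?Z a @ ?Z u @ [True, True, False]"
    unfolding enc_nat_item[OF assms(1-3)] k concat_map_upt_add 1 2 3 4 5 6 7 8 9 10 by simp
  then show ?thesis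
    using assms(4-6) by (simp add: item_prog_def enc_rat_of_nat map_replicate_const a_def b_def)
qed

lemma printed_complement_prog:
  assumes dims: "W = 2 * T + 2" "N = W * T" "0 < T"
    and inp: "inp = input_row fin hc ic T w"
    and f: "f = (\<lambda>k. if k = 0 then h0 else if k < N then h else if k = N then hN
      else if k < N + 1 + W then din (inp (k - (N + 1))) else if k < 2 * N + 1 then v
      else if k < 2 * N + W + 1 then fi else ce)"
    and less: "\<And>k. f k < 2 ^ \<beta>" and top: "2 ^ (\<beta> - 1) \<le> ce"
    and env: "length env = d" "env ! iN = N" "env ! iT = T" "env ! iT1 = T + 1" "env ! iNW = N - W" "env ! iW = W"
  shows "printed w (complement_prog iN iT iT1 iNW iW d h0 h hN din v fi ce) env =
    rat0 @ enc_rat (of_nat (val N W f)) @ rat0"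
proof -
  let ?f = "\<lambda>k. dig \<beta> (f k)"
  let ?in = "IfZero d
        (EmitIn d (dig \<beta> (din (hc 0))) (dig \<beta> (din (hc 1))) (dig \<beta> (din (hc 2))))
        (EmitIn d (dig \<beta> (din (ic 0))) (dig \<beta> (din (ic 1))) (dig \<beta> (din (ic 2))))"
  have WN: "W \<le> N" using dims by simp
  define b where "b = N - W"
  have N: "N = W + b" "0 < N" "0 < W" using WN dims by (auto simp: b_def)
  have sym: "word_tape w p = 0 \<or> word_tape w p = 1 \<or> word_tape w p = 2" for p by (simp add: word_tape_def)
  have "f (3 * N + W) = ce" using N by (simp add: f)
  then have enc: "enc_nat (val N W f) = concat (map ?f [0..<3 * N + W + 1]) @ [False]"
    using enc_nat_full_digits[of "3 * N + W" f \<beta>] less top \<beta>(2) by (simp add: val_def)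
  define T1 where "T1 = T + 1"
  have k: "3 * N + W + 1 = N + (1 + (1 + (T + (T1 + (b + (W + N))))))" using N(1) dims(1) by (simp add: T1_def)
  have 1: "concat (map ?f [0..<N]) = concat (map (\<lambda>x. if x = 0 then dig \<beta> h0 else dig \<beta> h) [0..<N])"
    by (intro arg_cong[of _ _ concat] map_cong refl) (simp add: f)
  have 2: "concat (map (\<lambda>i. ?f (N + i)) [0..<1]) = dig \<beta> hN" using N by (simp add: f)
  have 3: "concat (map (\<lambda>i. ?f (N + (1 + i))) [0..<1]) = dig \<beta> (din fin)"
    using N by (simp add: f inp input_row_def)
  have 4: "concat (map (\<lambda>i. ?f (N + (1 + (1 + i)))) [0..<T]) = concat (replicate T (dig \<beta> (din (ic 0))))"
    by (rule concat_map_upt_const) (use N dims(1) in \<open>simp add: f inp input_row_def word_tape_def\<close>)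
  have 5: "concat (map (\<lambda>i. ?f (N + (1 + (1 + (T + i))))) [0..<T1]) =
      concat (map (\<lambda>i. dig \<beta> (din (if i = 0 then hc (word_tape w (int i)) else ic (word_tape w (int i))))) [0..<T1])"
  proof (intro arg_cong[of _ _ concat] map_cong refl)
    fix i assume "i \<in> set [0..<T1]"
    then have i: "i < T1" by (metis atLeastLessThan_iff set_upt)
    have "f (N + (1 + (1 + (T + i)))) = din (inp (T + 1 + i))" using i N dims(1) by (simp add: f T1_def)
    moreover have "inp (T + 1 + i) = (if i = 0 then hc (word_tape w (int i)) else ic (word_tape w (int i)))"
      by (simp add: inp input_row_def)
    ultimately show "?f (N + (1 + (1 + (T + i)))) =
        dig \<beta> (din (if i = 0 then hc (word_tape w (int i)) else ic (word_tape w (int i))))" by simp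
  qed
  have 6: "concat (map (\<lambda>i. ?f (N + (1 + (1 + (T + (T1 + i)))))) [0..<b]) = concat (replicate b (dig \<beta> v))"
    by (rule concat_map_upt_const) (use N dims(1) in \<open>simp add: f T1_def\<close>)
  have 7: "concat (map (\<lambda>i. ?f (N + (1 + (1 + (T + (T1 + (b + i))))))) [0..<W]) = concat (replicate W (dig \<beta> fi))"
    by (rule concat_map_upt_const) (use N dims(1) in \<open>simp add: f T1_def\<close>)
  have 8: "concat (map (\<lambda>i. ?f (N + (1 + (1 + (T + (T1 + (b + (W + i)))))))) [0..<N]) = concat (replicate N (dig \<beta> ce))"
    by (rule concat_map_upt_const) (use N dims(1) in \<open>simp add: f T1_def\<close>)
  have p1: "printed w (For iN (IfZero d (Dg h0) (Dg h))) env =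
      concat (map (\<lambda>x. if x = 0 then dig \<beta> h0 else dig \<beta> h) [0..<N])"
    using env(1,2) by (simp add: nth_append cong: if_cong)
  have p5: "printed w (For iT1 ?in) env =
      concat (map (\<lambda>i. dig \<beta> (din (if i = 0 then hc (word_tape w (int i)) else ic (word_tape w (int i))))) [0..<T1])"
  proof -
    have "printed w ?in (env @ [i, T1 - Suc i]) =
      dig \<beta> (din (if i = 0 then hc (word_tape w (int i)) else ic (word_tape w (int i))))" for i
      using sym[of "int i"] env(1) by (auto simp: nth_append Let_def)
    then show ?thesis unfolding printed.simps(3) env(4) T1_def[symmetric] by (simp only:)
  qed
  have "enc_nat (val N W f) = printed w (For iN (IfZero d (Dg h0) (Dg h))) env @ dig \<beta> hN @ dig \<beta> (din fin) @
      concat (replicate T (dig \<beta> (din (ic 0)))) @ printed w (For iT1 ?in) env @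
      concat (replicate b (dig \<beta> v)) @ concat (replicate W (dig \<beta> fi)) @ concat (replicate N (dig \<beta> ce)) @ [False]"
    unfolding enc k concat_map_upt_add 1 2 3 4 5 6 7 8 p1 p5 by simp
  moreover have "printed w (For i (Dg x)) env = concat (replicate (env ! i) (dig \<beta> x))" for i x
    by (simp add: map_replicate_const)
  ultimately show ?thesis
    unfolding complement_prog_def printed_Thens using env(2-6)
    by (simp del: printed.simps(3) add: enc_rat_of_nat b_def)
qed

end

section \<open>The program for the whole instance\<close>

context reduction
begin

lemma input_row_le: "input_row fin hc ic T w u \<le> C"
proof -
  have "word_tape w p \<le> 2" for p by (simp add: word_tape_def)
  then show ?thesis using input_colors boundary_le(3) by (simp add: input_row_def)
qed

abbreviation "target_prog b \<equiv> complement_prog (b + 8) (b + 3) (b + 4) (b + 7) (b + 5) (b + 13)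
        (g - (C - l0)) (g - C) (g - r0) (\<lambda>c. g - (C - c)) (g - C) (g - fin) (g - 1)"
abbreviation "rest_prog b \<equiv> complement_prog (b + 8) (b + 3) (b + 4) (b + 7) (b + 5) (b + 13)
        (g + (C - l0) - SL) (g + C - (SL + SR)) (g + r0 - SR) (\<lambda>c. g + (C - c) - SD)
        (g + C - (SD + SU)) (g + fin - SU) (g + 1 - K)"

text \<open>The variables from \<open>b + 1\<close> on are \<open>1\<close>, \<open>2\<close>, \<open>T\<close>, \<open>T + 1\<close>, \<open>W\<close>, \<open>W - 1\<close>, \<open>N - W\<close>, \<open>N\<close>, \<open>K\<close>,
  the number of columns, \<open>3\<close>, and the number of vertices.\<close>

definition body :: "nat \<Rightarrow> prog" where
  "body b = Thens
     [Bin (b + 12), Emit [False],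
      Emit [False, True, False, True, True],
      For (b + 8) (Emit (concat (replicate (3 * \<beta>) [True, False]))),
      For (b + 5) (Emit (concat (replicate \<beta> [True, False]))), Emit (concat (replicate \<beta> [True, False])),
      For (b + 8) (Emit (concat (replicate (3 * \<beta>) [True, True]))),
      For (b + 5) (Emit (concat (replicate \<beta> [True, True]))), Emit (concat (replicate (\<beta> - 1) [True, True])),
      Emit [False, True, True, False],
      Emit (rat0 @ rat0),
      target_prog b,
      rest_prog b,
      For (b + 8) (Thens (map (item_prog (b + 6) (b + 13)) [0..<K])),
      For (b + 10) (matrix_prog (b + 13))]"

text \<open>Variable 1 is 0, so \<open>Bind 1 1 n\<close> introduces the constant \<open>n\<close>,
  and multiplying by variable \<open>b + 1\<close>, which is 1, gives sums. Variable
  \<open>b\<close> is \<open>T - 1\<close>; this yields \<open>W\<close> as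
  \<open>2 * (T - 1) + 4\<close> and \<open>N - W\<close> as \<open>W * (T - 1)\<close> without
  subtraction.\<close>

definition main_prog :: "nat \<Rightarrow> prog" where
  "main_prog b = Bind 1 1 1 (Bind 1 1 2 (Bind b (b + 1) 1 (Bind b (b + 1) 2 (Bind b (b + 2) 4
     (Bind b (b + 2) 3 (Bind (b + 5) b 0 (Bind (b + 5) (b + 3) 0 (Bind 1 1 K (Bind (b + 8) (b + 9) 3
       (Bind 1 1 3 (Bind (b + 10) (b + 11) 0 (body b))))))))))))"

lemma scoped_main_prog:
  assumes "0 < b"
  shows "scoped (Suc b) (main_prog b)"
  using assms by (simp add: main_prog_def body_def complement_prog_def item_prog_def matrix_prog_def scoped_Thens)

lemma printed_For_Emit: "printed w (For i (Emit s)) env = concat (replicate (env ! i) s)"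
  by (simp add: map_replicate_const)

definition column_code :: "(nat \<Rightarrow> nat) \<Rightarrow> nat \<Rightarrow> bool list" where
  "column_code D c = rat0 @ enc_rat (of_nat (D c)) @ rat0"

text \<open>Column 0 contributes only two codes, both of 0, because its vertex in row 0 is the
  root.\<close>

lemma demand_codes:
  fixes N m D h
  defines "m \<equiv> cols N"
  assumes "D 0 = 0"
  shows "concat (map (\<lambda>v. enc_rat (demand (ladder m D h) v)) (filter (\<lambda>v. v \<noteq> 0) [0..<3 * m])) =
    rat0 @ rat0 @ column_code D 1 @ column_code D 2 @
    concat (map (\<lambda>u. concat (map (\<lambda>t. column_code D (u * K + t + 3)) [0..<K])) [0..<N])"
proof -
  let ?f = "\<lambda>v. enc_rat (demand (ladder m D h) v)"
  have m: "0 < m" "m - Suc 0 = 1 + (1 + N * K)" by (simp_all add: m_def cols_def)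
  have "[0..<3 * m] = 0 # 1 # 2 # [3 * (0 + 1)..<3 * m]"
    using m(1) by (simp add: upt_conv_Cons numeral_3_eq_3 numeral_2_eq_2)
  then have filter: "filter (\<lambda>v. v \<noteq> 0) [0..<3 * m] = 1 # 2 # [3 * (0 + 1)..<3 * m]" by simp
  have first: "?f 1 = rat0" "?f 2 = rat0" using assms(2) by (simp_all add: demand_ladder rat0_def)
  have col: "?f (3 * c) @ ?f (3 * c + 1) @ ?f (3 * c + 2) = column_code D c" for c
    using mod_3_cases[of c] by (simp add: demand_ladder rat0_def column_code_def)
  have "concat (map ?f [3 * (0 + 1)..<3 * m]) = concat (map (\<lambda>y. column_code D (0 + 1 + y)) [0..<m - Suc 0])"
    unfolding upt_columns[OF m(1)] by (simp only: col)
  also have "\<dots> = column_code D 1 @ column_code D 2 @ concat (map (\<lambda>i. column_code D (i + 3)) [0..<N * K])"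
    unfolding m(2) concat_map_upt_add by (simp add: eval_nat_numeral)
  also have "concat (map (\<lambda>i. column_code D (i + 3)) [0..<N * K]) =
      concat (map (\<lambda>u. concat (map (\<lambda>t. column_code D (u * K + t + 3)) [0..<K])) [0..<N])"
    by (rule concat_map_upt_mult)
  finally show ?thesis unfolding filter by (simp add: first[simplified])
qed

lemma bound_code:
  assumes "env ! iN = N" "env ! iW = W"
  shows "enc_rat (2 * (of_nat (half N W))\<^sup>2) = concat (map (\<lambda>p. printed w p env)
     [Emit [False, True, False, True, True],
      For iN (Emit (concat (replicate (3 * \<beta>) [True, False]))),
      For iW (Emit (concat (replicate \<beta> [True, False]))), Emit (concat (replicate \<beta> [True, False])),
      For iN (Emit (concat (replicate (3 * \<beta>) [True, True]))),
      For iW (Emit (concat (replicate \<beta> [True, True]))), Emit (concat (replicate (\<beta> - 1) [True, True])),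
      Emit [False, True, True, False]])"
proof -
  let ?n = "\<beta> * (3 * N + W + 1)"
  have "\<beta> \<noteq> 1" using \<beta>(1) by auto
  then have "2 \<le> \<beta>" using \<beta>(2) by simp
  then have n: "2 \<le> ?n" by (metis le_trans mult.right_neutral mult_le_mono2 le_add2)
  have n1: "?n = 3 * \<beta> * N + (\<beta> * W + \<beta>)" by (simp add: algebra_simps)
  have n2: "?n - 1 = 3 * \<beta> * N + (\<beta> * W + (\<beta> - 1))" using \<open>2 \<le> \<beta>\<close> by (simp add: algebra_simps)
  have "2 * (of_nat (half N W))\<^sup>2 = (of_nat (2 * (2 ^ ?n - 1)\<^sup>2) :: rat)" by (simp add: half_def)
  then have "enc_rat (2 * (of_nat (half N W))\<^sup>2) = False # enc_nat (2 * (2 ^ ?n - 1)\<^sup>2) @ [True, True, False]"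
    by (simp only: enc_rat_of_nat)
  also have "\<dots> = False # ([True, False, True, True] @ concat (replicate ?n [True, False]) @
      concat (replicate (?n - 1) [True, True]) @ [False]) @ [True, True, False]"
    by (simp only: enc_nat_twice_square_ones[OF n])
  finally show ?thesis
    unfolding n2 unfolding n1 by (simp add: printed_For_Emit assms replicate_add concat_replicate_concat del: printed.simps(3))
qed

lemma printed_body:
  fixes T w
  defines "W \<equiv> 2 * T + 2"
  defines "N \<equiv> W * T"
  defines "inp \<equiv> input_row fin hc ic T w"
  assumes "0 < T" and env: "length env = b + 13" "env ! (b + 3) = T" "env ! (b + 4) = T + 1" "env ! (b + 5) = W"
    "env ! (b + 6) = W - 1" "env ! (b + 7) = N - W" "env ! (b + 8) = N" "env ! (b + 10) = cols N"
    "env ! (b + 12) = 3 * cols N"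
  shows "printed w (body b) env = enc_ednr (ladder (cols N) (column N W inp) (half N W))"
proof -
  let ?D = "column N W inp" and ?t = "target N W inp" and ?T = "total N W"
  let ?I = "ladder (cols N) ?D (half N W)"
  have W: "0 < W" by (simp add: W_def)
  have t_le: "?t k \<le> ?T k" for k by (rule target_le) (simp add: inp_def input_row_le)
  have T_less: "?T k + 1 < 2 ^ (\<beta> - 1)" for k by (rule total_less)
  have pow: "(2 :: nat) ^ \<beta> = 2 * 2 ^ (\<beta> - 1)" using \<beta>(2) by (cases \<beta>) auto
  have y1: "printed w (target_prog b) env = column_code ?D 1"
  proof -
    have "printed w (target_prog b) env =
        rat0 @ enc_rat (of_nat (val N W (\<lambda>k. g - ?t k))) @ rat0"
    proof (rule printed_complement_prog[where inp = inp])
      show "(\<lambda>k. g - ?t k) = (\<lambda>k. if k = 0 then g - (C - l0) else if k < N then g - C else if k = N then g - r0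
        else if k < N + 1 + W then g - (C - inp (k - (N + 1))) else if k < 2 * N + 1 then g - C
        else if k < 2 * N + W + 1 then g - fin else g - 1)"
        by (rule ext) (simp add: target_def)
      show "g - ?t k < 2 ^ \<beta>" for k by (metis diff_le_self less_le_trans diff_less le_less_trans pos2 zero_less_one zero_less_power)
      \<comment> \<open>The room left by the choice of \<open>\<beta>\<close> keeps the top bit of
        the highest digit set.\<close>
      show "2 ^ (\<beta> - 1) \<le> g - 1" using \<beta>(1) pow by simp
    qed (use assms in \<open>simp_all add: mult.commute\<close>)
    then show ?thesis by (simp add: column_code_def column_def)
  qed
  have y2: "printed w (rest_prog b) env = column_code ?D 2"
  proof -
    have "printed w (rest_prog b) env =
        rat0 @ enc_rat (of_nat (val N W (\<lambda>k. g + ?t k - ?T k))) @ rat0"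
    proof (rule printed_complement_prog[where inp = inp])
      show "(\<lambda>k. g + ?t k - ?T k) = (\<lambda>k. if k = 0 then g + (C - l0) - SL else if k < N then g + C - (SL + SR)
        else if k = N then g + r0 - SR
        else if k < N + 1 + W then g + (C - inp (k - (N + 1))) - SD else if k < 2 * N + 1 then g + C - (SD + SU)
        else if k < 2 * N + W + 1 then g + fin - SU else g + 1 - K)"
        by (rule ext) (simp add: target_def total_def)
      show "g + ?t k - ?T k < 2 ^ \<beta>" for k
      proof -
        have "g + ?t k - ?T k \<le> g" using t_le[of k] by linarith
        moreover have "g < 2 ^ \<beta>" by simp
        ultimately show ?thesis by linarith
      qed
      show "2 ^ (\<beta> - 1) \<le> g + 1 - K" using \<beta>(1) pow by simp
    qed (use assms in \<open>simp_all add: mult.commute\<close>)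
    then show ?thesis by (simp add: column_code_def column_def)
  qed
  have items: "printed w (For (b + 8) (Thens (map (item_prog (b + 6) (b + 13)) [0..<K]))) env =
      concat (map (\<lambda>u. concat (map (\<lambda>t. column_code ?D (u * K + t + 3)) [0..<K])) [0..<N])"
  proof -
    have "printed w (item_prog (b + 6) (b + 13) t) (env @ [u, N - Suc u]) = column_code ?D (u * K + t + 3)"
      if "u < N" "t < K" for u t
    proof -
      have "printed w (item_prog (b + 6) (b + 13) t) (env @ [u, N - Suc u]) =
          rat0 @ enc_rat (of_nat (val N W (item N W u t))) @ rat0"
        by (rule printed_item_prog[OF that(1) W that(2)]) (use env in \<open>simp_all add: nth_append\<close>)
      moreover have "column N W inp (u * K + t + 3) = val N W (item N W u t)"
        using that(2) K_pos by (simp add: column_def)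
      ultimately show ?thesis by (simp add: column_code_def)
    qed
    then show ?thesis
      unfolding printed.simps(3) env(7) printed_Thens by (auto intro!: arg_cong[of _ _ concat] map_cong)
  qed
  have column_0: "?D 0 = 0" by (simp add: column_def)
  have matrix: "printed w (For (b + 10) (matrix_prog (b + 13))) env =
      concat (map (\<lambda>u. concat (map (edge_code ?I u) [Suc u..<3 * cols N])) [0..<3 * cols N])"
    by (rule printed_matrix_prog) (use env in simp_all)
  have enc: "enc_ednr ?I = enc_nat (3 * cols N) @ [False] @ enc_rat (2 * (of_nat (half N W))\<^sup>2) @
      concat (map (\<lambda>v. enc_rat (demand ?I v)) (filter (\<lambda>v. v \<noteq> 0) [0..<3 * cols N])) @
      concat (map (\<lambda>u. concat (map (edge_code ?I u) [Suc u..<3 * cols N])) [0..<3 * cols N])"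
    unfolding enc_ednr_def edge_code_def[abs_def] by simp
  show ?thesis
    unfolding enc bound_code[OF env(7,4), of w] demand_codes[of ?D, OF column_0] items[symmetric] matrix[symmetric] y1[symmetric] y2[symmetric]
    unfolding body_def printed_Thens using env(9) by (simp del: printed.simps(3))
qed

lemma printed_main_prog:
  fixes S w
  defines "T \<equiv> S + 1"
  defines "W \<equiv> 2 * T + 2"
  defines "N \<equiv> W * T"
  assumes env: "length env = Suc b" "0 < b" "env ! 1 = 0" "env ! b = S"
  shows "printed w (main_prog b) env =
    enc_ednr (ladder (cols N) (column N W (input_row fin hc ic T w)) (half N W))"
proof -
  let ?env = "env @ [Suc 0, Suc (Suc 0), Suc S, Suc (Suc S), 2 * S + 4, 2 * S + 3, (2 * S + 4) * S,
    2 * S + 4 + (2 * S + 4) * S, K, (2 * S + 4 + (2 * S + 4) * S) * K + 3, 3,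
    (2 * S + 4 + (2 * S + 4) * S) * K * 3 + 9]"
  have "printed w (main_prog b) env = printed w (body b) ?env"
    using env by (simp add: main_prog_def nth_append)
  also have "\<dots> = enc_ednr (ladder (cols N) (column N W (input_row fin hc ic T w)) (half N W))"
    unfolding W_def N_def
    by (rule printed_body) (use env in \<open>simp_all add: nth_append T_def cols_def algebra_simps\<close>)
  finally show ?thesis .
qed

end

text \<open>Each step multiplies by variable 0, the input length, and adds the next coefficient,
  highest first; intermediate values stay in the environment.\<close>

fun horner :: "nat list \<Rightarrow> nat \<Rightarrow> prog \<Rightarrow> prog" where
  "horner [] i q = q"
| "horner (a # as) i q = Bind i 0 a (horner as (Suc i) q)"

lemma printed_horner:
  assumes "length env = Suc i"
  shows "\<exists>xs. printed w (horner as i q) env = printed w q (env @ xs) \<and> length xs = length as \<and>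
    (env @ xs) ! (i + length as) = foldl (\<lambda>v a. v * env ! 0 + a) (env ! i) as"
  using assms
proof (induction as arbitrary: i env)
  case Nil
  then show ?case by simp
next
  case (Cons a as)
  let ?env = "env @ [env ! i * env ! 0 + a]"
  obtain xs where "printed w (horner as (Suc i) q) ?env = printed w q (?env @ xs) \<and> length xs = length as \<and>
      (?env @ xs) ! (Suc i + length as) = foldl (\<lambda>v a. v * ?env ! 0 + a) (?env ! Suc i) as"
    using Cons.IH[of ?env "Suc i"] Cons.prems by auto
  then show ?case
    using Cons.prems by (intro exI[of _ "(env ! i * env ! 0 + a) # xs"]) (simp add: nth_append)
qed

lemma scoped_horner: "0 < i \<Longrightarrow> scoped (Suc i) (horner as i q) \<longleftrightarrow> scoped (Suc (i + length as)) q"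
  by (induction as arbitrary: i) auto

lemma foldr_coeffs: "foldr (\<lambda>a v. v * x + a) (coeffs p) 0 = poly p x" for x :: nat
  by (induction p) (auto simp: cCons_def algebra_simps)

section \<open>NP-hardness\<close>

theorem theorem1:
  shows "NP_hard enc_ednr
    {I \<in> ednr_instances. grid_of_height 3 (verts I) (edges I) \<and>
       (\<forall>e \<in> edges I. resistance I e \<in> {0, 1})}
    ednr_yes"
  unfolding NP_hard_def
proof (rule ballI)
  fix A assume "A \<in> NP"
  then show "\<exists>f. polytime_computable f \<and> (\<forall>w. \<exists>I \<in> {I \<in> ednr_instances.
      grid_of_height 3 (verts I) (edges I) \<and> (\<forall>e \<in> edges I. resistance I e \<in> {0, 1})}.
      f w = enc_ednr I \<and> (w \<in> A \<longleftrightarrow> ednr_yes I))"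
  proof (rule NP_imp_tiling)
    fix tiles C l0 fin hc ic and p :: "nat poly"
    assume t: "\<And>a b c d. (a, b, c, d) \<in> set tiles \<Longrightarrow> a \<le> C \<and> b \<le> C \<and> c \<le> C \<and> d \<le> C"
        "l0 \<le> C" "fin \<le> C" "\<And>x. x \<le> 2 \<Longrightarrow> hc x \<le> C" "\<And>x. x \<le> 2 \<Longrightarrow> ic x \<le> C" "(0, C, 0, C) \<in> set tiles"
      and A: "\<And>(w :: bool list) T. poly p (length w) + 2 \<le> T \<Longrightarrow>
          w \<in> A \<longleftrightarrow> (\<exists>s. tiling tiles l0 l0 fin (T * (2 * T + 2)) (2 * T + 2) (input_row fin hc ic T w) s)"
    \<comment> \<open>\<open>\<beta> - 1\<close> is the required lower bound itself, and any number
      lies below its power of two.\<close>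
    define \<beta> where "\<beta> = Suc (2 * length tiles * C + length tiles + C + 2)"
    interpret reduction tiles C l0 l0 fin \<beta> hc ic
    proof
      show "2 * length tiles * C + length tiles + C + 2 \<le> 2 ^ (\<beta> - 1)"
        unfolding \<beta>_def diff_Suc_1 by (rule less_imp_le[OF less_exp])
      show "0 < \<beta>" by (simp add: \<beta>_def)
    qed (fact t)+
    define q where "q = p + 1"
    define cs where "cs = rev (coeffs q)"
    define b where "b = 1 + length cs"
    define P where "P = horner cs 1 (main_prog b)"
    have "scoped (Suc b) (main_prog b)" by (rule scoped_main_prog) (simp add: b_def)
    then have "scoped 2 P" using scoped_horner[of 1 cs "main_prog b"] by (simp add: P_def b_def numeral_2_eq_2)
    then have "polytime_computable (\<lambda>w. printed w P [length w, 0])" by (rule polytime_computable_printed)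
    moreover have "\<exists>I \<in> {I \<in> ednr_instances. grid_of_height 3 (verts I) (edges I) \<and>
         (\<forall>e \<in> edges I. resistance I e \<in> {0, 1})}.
        printed w P [length w, 0] = enc_ednr I \<and> (w \<in> A \<longleftrightarrow> ednr_yes I)" for w
    proof -
      define S where "S = poly q (length w)"
      define T where "T = S + 1"
      define W where "W = 2 * T + 2"
      define N where "N = W * T"
      let ?inp = "input_row fin hc ic T w"
      let ?I = "ladder (cols N) (column N W ?inp) (half N W)"
      obtain xs where xs: "printed w P [length w, 0] = printed w (main_prog b) ([length w, 0] @ xs)"
        "length xs = length cs" "([length w, 0] @ xs) ! (1 + length cs) = foldl (\<lambda>v a. v * length w + a) 0 cs"
        using printed_horner[of "[length w, 0]" 1 w cs "main_prog b"] unfolding P_def by auto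
      have "foldl (\<lambda>v a. v * length w + a) 0 cs = S"
        unfolding cs_def S_def foldr_coeffs[symmetric] by (simp add: foldl_conv_foldr)
      then have P: "printed w P [length w, 0] = enc_ednr ?I"
        unfolding xs(1) N_def W_def T_def using xs(2,3)
        by (intro printed_main_prog) (simp_all add: b_def)
      have dims: "0 < N" "0 < W" "W \<le> N" by (simp_all add: N_def W_def T_def)
      have inp: "?inp u \<le> C" for u by (rule input_row_le)
      have "0 < cols N" by (simp add: cols_def)
      have sum: "sum (column N W ?inp) {..<cols N} = 2 * half N W" by (rule sum_all_columns[OF dims(1,3) inp])
      have "ednr_yes ?I \<longleftrightarrow> (\<exists>X \<subseteq> {..<cols N}. sum (column N W ?inp) X = half N W)"
      proof
        assume "ednr_yes ?I"
        then show "\<exists>X \<subseteq> {..<cols N}. sum (column N W ?inp) X = half N W"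
          by (rule ladder_yes_imp_partition[OF \<open>0 < cols N\<close> sum])
      next
        assume "\<exists>X \<subseteq> {..<cols N}. sum (column N W ?inp) X = half N W"
        then obtain X where "X \<subseteq> {..<cols N}" "sum (column N W ?inp) X = half N W" by blast
        then show "ednr_yes ?I"
          by (intro partition_imp_ladder_yes[OF \<open>0 < cols N\<close> sum]) (simp_all add: column_def)
      qed
      also have "\<dots> \<longleftrightarrow> (\<exists>s. tiling tiles l0 l0 fin N W ?inp s)" by (rule partition_iff_tiling[OF dims inp])
      also have "\<dots> \<longleftrightarrow> w \<in> A"
        using A[of w T] by (simp add: N_def W_def T_def S_def q_def mult.commute)
      finally have "w \<in> A \<longleftrightarrow> ednr_yes ?I" by simp
      then show ?thesis using P ladder_instance[OF \<open>0 < cols N\<close>] by blast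
    qed
    ultimately show ?thesis by blast
  qed
qed

end
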